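(* A (possibly infinite) graph $G$ is $4$-ac if and only if it is a chain graph such that (1) all links are $2$-connected and $4$-ac, (2) all interior links are edges, and (3) if $v$ is a cut vertex of $G$ and $L$ is a link of $G$ with $v\in L$, then $\deg_L(v)\le 2$.
   Context: A graph $G=(V,E)$ consists of a (possibly infinite) vertex set $V$ and a set $E\subseteq[V]^2$ of edges (vertex degrees may be infinite). $|G|$ denotes the $1$-complex of $G$: the quotient of $V\oplus\bigoplus_{e\in E}[0,1]_e$ ($V$ discrete) in which, for each edge $e=\{v,w\}$, $0\in[0,1]_e$ is identified with $v$ and $1\in[0,1]_e$ with $w$. An arc is a homeomorphic copy of $[0,1]$. $G$ is $n$-ac if for any choice of at most $n$ points of $|G|$ there is an arc in $|G|$ containing them. $G$ is $k$-connected if $G-W$ is connected for all $W\subseteq V$ with $|W|<k$ (so the complete graph $K_2$, i.e. a single edge with its two endvertices, counts as $2$-connected). A connected graph is a chain graph if it is a linearly ordered union (possibly of just one) of subgraphs, called links, such that only consecutive links meet, and the intersection of two consecutive links consists of a single vertex. (The linear order may be finite, one-way infinite or two-way infinite.) An interior link is a link that is neither first nor last in the linear order; it is an edge if it is a copy of $K_2$. $\deg_L(v)$ is the degree of $v$ in the subgraph $L$. *)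

theory Defs
  imports "HOL-Analysis.Analysis" "HOL-Library.Extended_Nat" "HOL-Library.Ramsey"
begin

record 'a ugraph =
  verts :: "'a set"
  edges :: "'a set set"

definition graph :: "'a ugraph \<Rightarrow> bool" where
  "graph G \<longleftrightarrow> edges G \<subseteq> [verts G]\<^bsup>2\<^esup>"

definition subgraph :: "'a ugraph \<Rightarrow> 'a ugraph \<Rightarrow> bool" where
  "subgraph H G \<longleftrightarrow> graph H \<and> verts H \<subseteq> verts G \<and> edges H \<subseteq> edges G"

definition delete_verts :: "'a ugraph \<Rightarrow> 'a set \<Rightarrow> 'a ugraph" where
  "delete_verts G W = \<lparr>verts = verts G - W, edges = {e \<in> edges G. e \<inter> W = {}}\<rparr>"

definition adjacent :: "'a ugraph \<Rightarrow> 'a \<Rightarrow> 'a \<Rightarrow> bool" where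
  "adjacent G u v \<longleftrightarrow> {u, v} \<in> edges G"

definition linked :: "'a ugraph \<Rightarrow> 'a \<Rightarrow> 'a \<Rightarrow> bool" where
  "linked G u v \<longleftrightarrow> u \<in> verts G \<and> v \<in> verts G \<and> (adjacent G)\<^sup>*\<^sup>* u v"

definition connected_graph :: "'a ugraph \<Rightarrow> bool" where
  "connected_graph G \<longleftrightarrow> verts G \<noteq> {} \<and> (\<forall>u\<in>verts G. \<forall>v\<in>verts G. linked G u v)"

(* As there is no lower bound on the number of vertices, K_2 is 2-connected. *)
definition k_connected :: "nat \<Rightarrow> 'a ugraph \<Rightarrow> bool" where
  "k_connected k G \<longleftrightarrow>
     (\<forall>W. W \<subseteq> verts G \<and> finite W \<and> card W < k \<longrightarrow> connected_graph (delete_verts G W))"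

definition cut_vertex :: "'a ugraph \<Rightarrow> 'a \<Rightarrow> bool" where
  "cut_vertex G v \<longleftrightarrow>
     v \<in> verts G \<and>
     (\<exists>a\<in>verts G - {v}. \<exists>b\<in>verts G - {v}. linked G a b \<and> \<not> linked (delete_verts G {v}) a b)"

definition vertex_degree :: "'a ugraph \<Rightarrow> 'a \<Rightarrow> enat" where
  "vertex_degree G v =
     (if finite {e \<in> edges G. v \<in> e} then enat (card {e \<in> edges G. v \<in> e}) else \<infinity>)"

(* Every edge gets an arbitrary orientation, which decides the ends of the unit interval
   that are glued to its two endvertices. *)
definition tail :: "'a set \<Rightarrow> 'a" where
  "tail e = (SOME v. v \<in> e)"

definition head :: "'a set \<Rightarrow> 'a" where
  "head e = (SOME w. e = {tail e, w})"

lemma tail_head: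
  assumes "graph G" "e \<in> edges G"
  shows "e = {tail e, head e}" "tail e \<noteq> head e" "tail e \<in> verts G" "head e \<in> verts G"
proof -
  have e: "e \<subseteq> verts G" "card e = 2"
    using assms by (auto simp: graph_def nsets_def)
  then obtain x y where xy: "e = {x, y}" "x \<noteq> y"
    by (auto simp: card_2_iff)
  have t: "tail e \<in> e"
    unfolding tail_def by (rule someI[of _ x]) (use xy in simp)
  then have "\<exists>w. e = {tail e, w}"
    using xy by auto
  then show h: "e = {tail e, head e}"
    unfolding head_def by (rule someI_ex)
  show "tail e \<noteq> head e"
    using e h by (metis card_1_singleton_iff insert_absorb2 numeral_One numeral_eq_iff
        One_nat_def semiring_norm(85))
  show "tail e \<in> verts G" "head e \<in> verts G"
    using e h by auto
qed

(* The discrete space of vertices is the disjoint sum of one-point spaces: the point of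
   vertex v is (Inl v, 0), and (Inr e, t) is the point t of the unit interval of e. *)
definition cell_sum :: "'a ugraph \<Rightarrow> (('a + 'a set) \<times> real) topology" where
  "cell_sum G =
     sum_topology (case_sum (\<lambda>v. top_of_set {0}) (\<lambda>e. top_of_set {0..1})) (verts G <+> edges G)"

inductive glued :: "'a ugraph \<Rightarrow> ('a + 'a set) \<times> real \<Rightarrow> ('a + 'a set) \<times> real \<Rightarrow> bool"
  for G where
  "e \<in> edges G \<Longrightarrow> glued G (Inr e, 0) (Inl (tail e), 0)"
| "e \<in> edges G \<Longrightarrow> glued G (Inr e, 1) (Inl (head e), 0)"

definition quotient_topology :: "'a topology \<Rightarrow> ('a \<Rightarrow> 'b) \<Rightarrow> 'b topology" where
  "quotient_topology X q =
     topology (\<lambda>U. U \<subseteq> q ` topspace X \<and> openin X {x \<in> topspace X. q x \<in> U})"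

lemma openin_quotient_topology:
  "openin (quotient_topology X q) U \<longleftrightarrow>
     U \<subseteq> q ` topspace X \<and> openin X {x \<in> topspace X. q x \<in> U}"
proof -
  have 1: "{x \<in> topspace X. q x \<in> S \<inter> T} =
      {x \<in> topspace X. q x \<in> S} \<inter> {x \<in> topspace X. q x \<in> T}" for S T
    by auto
  have 2: "{x \<in> topspace X. q x \<in> \<Union>\<K>} = (\<Union>K\<in>\<K>. {x \<in> topspace X. q x \<in> K})" for \<K>
    by auto
  have "istopology (\<lambda>U. U \<subseteq> q ` topspace X \<and> openin X {x \<in> topspace X. q x \<in> U})"
    unfolding istopology_def 1 2 by blast
  then show ?thesis
    by (simp add: quotient_topology_def)
qed

lemma topspace_quotient_topology: "topspace (quotient_topology X q) = q ` topspace X"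
proof -
  have "{x \<in> topspace X. q x \<in> q ` topspace X} = topspace X"
    by auto
  then have "openin (quotient_topology X q) (q ` topspace X)"
    by (simp add: openin_quotient_topology)
  then show ?thesis
    by (metis openin_quotient_topology openin_subset openin_topspace subset_antisym)
qed

lemma quotient_map_quotient_topology: "quotient_map X (quotient_topology X q) q"
  by (auto simp: quotient_map_def topspace_quotient_topology openin_quotient_topology)

definition one_complex :: "'a ugraph \<Rightarrow> (('a + 'a set) \<times> real) set topology" where
  "one_complex G = quotient_topology (cell_sum G) (\<lambda>x. {y. equivclp (glued G) x y})"

definition arc_in :: "'b topology \<Rightarrow> 'b set \<Rightarrow> bool" where
  "arc_in X A \<longleftrightarrow>
     A \<subseteq> topspace X \<and> subtopology X A homeomorphic_space top_of_set {0..1::real}"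

(* P may be empty, so a graph without any arc, such as the empty graph, is not n-ac. *)
definition n_ac :: "nat \<Rightarrow> 'a ugraph \<Rightarrow> bool" where
  "n_ac n G \<longleftrightarrow>
     (\<forall>P. P \<subseteq> topspace (one_complex G) \<and> finite P \<and> card P \<le> n \<longrightarrow>
        (\<exists>A. arc_in (one_complex G) A \<and> P \<subseteq> A))"

(* G is a chain graph with links L i, i \<in> I. The order types of the nonempty intervals I of
   integers are the finite ones and those of the one-way and two-way infinite chains. *)
definition chain_graph_links :: "'a ugraph \<Rightarrow> int set \<Rightarrow> (int \<Rightarrow> 'a ugraph) \<Rightarrow> bool" where
  "chain_graph_links G I L \<longleftrightarrow>
     connected_graph G \<and>
     I \<noteq> {} \<and> (\<forall>i\<in>I. \<forall>k\<in>I. {i..k} \<subseteq> I) \<and>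
     (\<forall>i\<in>I. subgraph (L i) G) \<and>
     verts G = (\<Union>i\<in>I. verts (L i)) \<and> edges G = (\<Union>i\<in>I. edges (L i)) \<and>
     (\<forall>i\<in>I. \<forall>j\<in>I. i + 1 < j \<longrightarrow> verts (L i) \<inter> verts (L j) = {}) \<and>
     (\<forall>i\<in>I. i + 1 \<in> I \<longrightarrow>
        (\<exists>v. verts (L i) \<inter> verts (L (i + 1)) = {v}) \<and> edges (L i) \<inter> edges (L (i + 1)) = {})"

definition interior_index :: "int set \<Rightarrow> int \<Rightarrow> bool" where
  "interior_index I i \<longleftrightarrow> i \<in> I \<and> (\<exists>j\<in>I. j < i) \<and> (\<exists>j\<in>I. i < j)"

definition is_K2 :: "'a ugraph \<Rightarrow> bool" where
  "is_K2 H \<longleftrightarrow> (\<exists>v w. v \<noteq> w \<and> verts H = {v, w} \<and> edges H = {{v, w}})"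

end

theory Submission
  imports Defs
begin

text \<open>
  The points behind the cut vertices force the chain. An arc meets a cut vertex only once, so a
  $4$-ac graph falls into exactly two parts at a cut vertex \<open>v\<close>. If the part \<open>C\<close> together with
  \<open>v\<close> still has a cut vertex, then four points, namely one beyond either of the two cut vertices
  and the midpoints of two edges from \<open>v\<close> into \<open>C\<close>, show that \<open>v\<close> has only one neighbour in \<open>C\<close>.
  Peeling off this edge and repeating gives one half of the chain. The bound on the degree comes from
  one point beyond \<open>v\<close> and the midpoints of three edges at \<open>v\<close>.

  Conversely, it suffices that in a $2$-connected $4$-ac link any three points lie on an arc starting
  at a given vertex \<open>v\<close> of degree at most $2$. The three points lie on a circle, or on the three
  branches of a theta graph with branch points \<open>a\<close> and \<open>b\<close>. If an arc from \<open>v\<close> reaches the circle or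
  the interior of a branch first, it can be prolonged through all three points. Otherwise \<open>{a, b}\<close>
  separates \<open>v\<close> from them, and as an arc through the four points has at most three parts outside
  \<open>{a, b}\<close>, two of the branches are joined outside \<open>{a, b}\<close>; the joining arc yields a circle through
  the three points or allows to prolong an arc from \<open>v\<close> to \<open>a\<close> or to \<open>b\<close>.
\<close>

text \<open>The degree bound enters the converse at one place only: three arcs that join
  \<open>v\<close> to a common end and are otherwise disjoint would leave \<open>v\<close> along
  three different edges. Hence \<open>v\<close> is not a branch point of a theta graph and lies off
  the one considered.

  The theta argument is free of graphs. It needs a Hausdorff space that no point separates and in
  which any two points are joined by a finite chain of arcs with open interiors; this holds also
  with vertices of infinite degree. The graph K2 counts as 2-connected, yet the midpoint of its edge
  separates its 1-complex, so K2 is treated apart.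

  Midpoints of edges are probes: an arc that visits one and has both ends outside the interior of
  this edge traverses the whole edge, in particular it visits both endvertices.

  The peeling may go on forever. It still exhausts the side, because a vertex at distance k from the
  first cut vertex is no longer in the rest after k steps.\<close>

section \<open>Arcs in a topological space\<close>

text \<open>Degenerate arcs (\<open>s = t\<close>) are admitted, so that an arc can be split at each of its points.\<close>

definition seg :: "'b topology \<Rightarrow> 'b \<Rightarrow> 'b \<Rightarrow> 'b set \<Rightarrow> bool" where
  "seg X a b A \<longleftrightarrow> (\<exists>s t h. s \<le> t \<and> continuous_map (top_of_set {s..t::real}) X h \<and>
     inj_on h {s..t} \<and> h s = a \<and> h t = b \<and> A = h ` {s..t})"

lemma seg_subset: "seg X a b A \<Longrightarrow> A \<subseteq> topspace X"
  unfolding seg_def continuous_map_def by auto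

lemma seg_ends: "seg X a b A \<Longrightarrow> a \<in> A" "seg X a b A \<Longrightarrow> b \<in> A"
  unfolding seg_def by auto

lemma seg_refl: "a \<in> topspace X \<Longrightarrow> seg X a a {a}"
  unfolding seg_def
  by (rule exI[of _ 0], rule exI[of _ 0], rule exI[of _ "\<lambda>_. a"]) auto

lemma seg_degenerate: "seg X a a A \<Longrightarrow> A = {a}"
  unfolding seg_def
proof (elim exE conjE)
  fix s t h assume "s \<le> t" "inj_on h {s..t::real}" "h s = a" "h t = a" "A = h ` {s..t}"
  moreover from this have "s = t" by (auto dest: inj_onD)
  ultimately show ?thesis by auto
qed

lemma seg_sym: "seg X a b A \<Longrightarrow> seg X b a A"
  unfolding seg_def
proof (elim exE conjE)
  fix s t h assume st: "s \<le> t" and h: "continuous_map (top_of_set {s..t::real}) X h" "inj_on h {s..t}"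
    "h s = a" "h t = b" "A = h ` {s..t}"
  have im: "uminus ` {-t..-s} = {s..t}" by auto
  show "\<exists>s t h. s \<le> t \<and> continuous_map (top_of_set {s..t::real}) X h \<and>
     inj_on h {s..t} \<and> h s = b \<and> h t = a \<and> A = h ` {s..t}"
  proof (intro exI conjI)
    show "-t \<le> -s" using st by simp
    have "continuous_map (top_of_set {-t..-s}) (top_of_set {s..t}) uminus"
      by (auto intro!: continuous_intros)
    from continuous_map_compose[OF this h(1)]
    show "continuous_map (top_of_set {-t..-s}) X (h \<circ> uminus)" .
    show "inj_on (h \<circ> uminus) {-t..-s}"
      by (intro comp_inj_on) (use h(2) im in auto)
    show "A = (h \<circ> uminus) ` {-t..-s}" by (simp only: image_comp[symmetric] im h(5))
  qed (use h in auto)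
qed

lemma seg_param_shift:
  fixes r :: real
  assumes "s \<le> t" "continuous_map (top_of_set {s..t::real}) X h"
    "inj_on h {s..t}" "h s = a" "h t = b" "A = h ` {s..t}"
  obtains u g where "r \<le> u" "continuous_map (top_of_set {r..u}) X g"
    "inj_on g {r..u}" "g r = a" "g u = b" "A = g ` {r..u}"
proof
  let ?f = "\<lambda>x. x + (s - r)"
  have im: "?f ` {r..r+t-s} = {s..t}" 
    unfolding image_add_atLeastAtMost' by simp
  show "r \<le> r + t - s" using assms by simp
  have "continuous_map (top_of_set {r..r+t-s}) (top_of_set {s..t}) ?f"
    by (auto intro!: continuous_intros)
  from continuous_map_compose[OF this assms(2)]
  show "continuous_map (top_of_set {r..r+t-s}) X (h \<circ> ?f)" .
  show "inj_on (h \<circ> ?f) {r..r+t-s}"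
    by (intro comp_inj_on) (use assms(3) im in \<open>auto simp: inj_on_def\<close>)
  show "A = (h \<circ> ?f) ` {r..r+t-s}" by (simp only: image_comp[symmetric] im assms(6))
qed (use assms in auto)

lemma seg_join:
  assumes "seg X a c A" "seg X c b B" "A \<inter> B = {c}"
  shows "seg X a b (A \<union> B)"
proof -
  obtain s t h where h: "s \<le> t" "continuous_map (top_of_set {s..t::real}) X h"
    "inj_on h {s..t}" "h s = a" "h t = c" "A = h ` {s..t}"
    using assms(1) unfolding seg_def by blast
  obtain s' t' h' where h': "s' \<le> t'" "continuous_map (top_of_set {s'..t'::real}) X h'"
    "inj_on h' {s'..t'}" "h' s' = c" "h' t' = b" "B = h' ` {s'..t'}"
    using assms(2) unfolding seg_def by blast
  obtain u g where g: "t \<le> u" "continuous_map (top_of_set {t..u}) X g"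
    "inj_on g {t..u}" "g t = c" "g u = b" "B = g ` {t..u}"
    by (rule seg_param_shift[OF h', of t])
  let ?k = "\<lambda>x. if x \<le> t then h x else g x"
  have un: "{s..u} = {s..t} \<union> {t..u}" using h g by auto
  have e1: "?k ` {s..t} = A" using h(6) by simp
  have "?k x = g x" if "x \<in> {t..u}" for x
    using that g(4) h(5) by (cases "x = t") auto
  then have e2: "?k ` {t..u} = B" unfolding g(6) by (intro image_cong) auto
  have inj: "inj_on ?k {s..u}"
  proof (rule inj_onI)
    have *: "x = y" if "x \<in> {s..u}" "y \<in> {s..u}" "?k x = ?k y" "x \<le> y" for x y
    proof (cases "y \<le> t")
      case True
      then show ?thesis using that by (intro inj_onD[OF h(3)]) auto
    next
      case False
      show ?thesis
      proof (cases "x \<le> t")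
        case True
        have "h x = g y" using that True False by simp
        moreover have "h x \<in> A" unfolding h(6) using that True by (intro imageI) simp
        moreover have "g y \<in> B" unfolding g(6) using that False by (intro imageI) simp
        ultimately have "g y = c" using assms(3) by auto
        then have "y = t" using g that False by (intro inj_onD[OF g(3)]) auto
        with False show ?thesis by simp
      next
        case f: False
        then show ?thesis using that by (intro inj_onD[OF g(3)]) auto
      qed
    qed
    fix x y assume "x \<in> {s..u}" "y \<in> {s..u}" "?k x = ?k y"
    then show "x = y" using *[of x y] *[of y x] by (metis linorder_linear)
  qed
  have cont: "continuous_map (top_of_set {s..u}) X ?k"
  proof (rule continuous_map_cases_le)
    have t1: "{x \<in> topspace (top_of_set {s..u}). x \<le> t} = {s..t}" using h g by auto
    have t2: "{x \<in> topspace (top_of_set {s..u}). t \<le> x} = {t..u}" using h g by auto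
    show "continuous_map (subtopology (top_of_set {s..u}) {x \<in> topspace (top_of_set {s..u}). x \<le> t}) X h"
      unfolding t1 using h by (simp add: subtopology_subtopology un Int_absorb1)
    show "continuous_map (subtopology (top_of_set {s..u}) {x \<in> topspace (top_of_set {s..u}). t \<le> x}) X g"
      unfolding t2 using g by (simp add: subtopology_subtopology un Int_absorb1)
  qed (use h g in auto)
  show ?thesis unfolding seg_def
  proof (intro exI conjI)
    show "s \<le> u" using h g by simp
    show "A \<union> B = ?k ` {s..u}" unfolding un image_Un e1 e2 ..
    show "?k s = a" using h by simp
    show "?k u = b" using h g by auto
  qed (fact cont inj)+
qed

lemma seg_between:
  assumes h: "continuous_map (top_of_set {s..t::real}) X h" "inj_on h {s..t}"
    and "s \<le> x" "x \<le> y" "y \<le> t"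
  shows "seg X (h x) (h y) (h ` {x..y})"
proof -
  have sub: "{x..y} \<subseteq> {s..t}" using assms by auto
  then have "continuous_map (top_of_set {x..y}) X h"
    using continuous_map_from_subtopology_mono[OF h(1)] by blast
  then show ?thesis unfolding seg_def using assms sub by (blast intro: inj_on_subset)
qed

lemma seg_split_param:
  assumes h: "continuous_map (top_of_set {s..t::real}) X h" "inj_on h {s..t}"
    and "s \<le> x" "x \<le> t"
  shows "seg X (h s) (h x) (h ` {s..x})" "seg X (h x) (h t) (h ` {x..t})"
    "h ` {s..x} \<union> h ` {x..t} = h ` {s..t}" "h ` {s..x} \<inter> h ` {x..t} = {h x}"
proof -
  show "seg X (h s) (h x) (h ` {s..x})" "seg X (h x) (h t) (h ` {x..t})"
    using assms by (auto intro: seg_between[OF h])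
  have "{s..x} \<union> {x..t} = {s..t}" "{s..x} \<inter> {x..t} = {x}" "{s..x} \<subseteq> {s..t}" "{x..t} \<subseteq> {s..t}"
    using assms by auto
  then show "h ` {s..x} \<union> h ` {x..t} = h ` {s..t}" "h ` {s..x} \<inter> h ` {x..t} = {h x}"
    using inj_on_image_Int[OF h(2), of "{s..x}" "{x..t}"] by (auto simp flip: image_Un)
qed

lemma seg_split:
  assumes "seg X a b A" "c \<in> A"
  obtains A1 A2 where "seg X a c A1" "seg X c b A2" "A1 \<union> A2 = A" "A1 \<inter> A2 = {c}"
proof -
  obtain s t h where h: "s \<le> t" "continuous_map (top_of_set {s..t::real}) X h"
    "inj_on h {s..t}" "h s = a" "h t = b" "A = h ` {s..t}"
    using assms(1) unfolding seg_def by blast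
  obtain x where x: "s \<le> x" "x \<le> t" "c = h x" using assms h by auto
  show ?thesis using seg_split_param[OF h(2,3) x(1,2)] h x that by simp
qed

text \<open>Used for arcs that end at a cut vertex: without this end they are still connected and
  therefore stay on one side.\<close>

lemma seg_connected_minus_end:
  assumes "seg X a b A" shows "connectedin X (A - {b})"
proof -
  obtain s t h where h: "s \<le> t" "continuous_map (top_of_set {s..t::real}) X h"
    "inj_on h {s..t}" "h s = a" "h t = b" "A = h ` {s..t}"
    using assms(1) unfolding seg_def by blast
  have "A - {b} = h ` {s..<t}"
  proof -
    have "{s..<t} = {s..t} - {t}" by auto
    then show ?thesis using h inj_on_image_set_diff[OF h(3), of "{s..t}" "{t}"] by simp
  qed
  moreover have "connectedin X (h ` {s..<t})"
    by (rule connectedin_continuous_map_image[OF h(2)])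
      (auto simp: connectedin_subtopology)
  ultimately show ?thesis by simp
qed

lemma seg_connected:
  assumes "seg X a b A" shows "connectedin X A"
proof -
  obtain s t h where h: "s \<le> t" "continuous_map (top_of_set {s..t::real}) X h" "A = h ` {s..t}"
    using assms(1) unfolding seg_def by blast
  show ?thesis unfolding h(3)
    by (rule connectedin_continuous_map_image[OF h(2)])
      (auto simp: connectedin_subtopology)
qed

lemma seg_closed:
  assumes "Hausdorff_space X" "seg X a b A" shows "closedin X A"
proof -
  obtain s t h where h: "s \<le> t" "continuous_map (top_of_set {s..t::real}) X h" "A = h ` {s..t}"
    using assms(2) unfolding seg_def by blast
  have "compactin X A" unfolding h(3)
    by (rule image_compactin[OF _ h(2)]) (auto simp: compactin_subtopology)
  then show ?thesis using assms(1) compactin_imp_closedin by blast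
qed

text \<open>The parameters that are mapped into \<open>K\<close> form a nonempty compact set; its
  least element is where the arc first meets \<open>K\<close>.\<close>

lemma seg_first_hit:
  assumes "seg X a b A" "closedin X K" "A \<inter> K \<noteq> {}"
  obtains c A1 A2 where "seg X a c A1" "seg X c b A2" "A1 \<union> A2 = A" "A1 \<inter> A2 = {c}" "A1 \<inter> K = {c}"
proof -
  obtain s t h where h: "s \<le> t" "continuous_map (top_of_set {s..t::real}) X h"
    "inj_on h {s..t}" "h s = a" "h t = b" "A = h ` {s..t}"
    using assms(1) unfolding seg_def by blast
  let ?S = "{x \<in> {s..t}. h x \<in> K}"
  have "closedin (top_of_set {s..t}) ?S"
    using closedin_continuous_map_preimage[OF h(2) assms(2)] by simp
  then have "compact ?S" 
    using closedin_compact compact_Icc by blast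
  moreover have "?S \<noteq> {}" using assms(3) h(6) by auto
  ultimately obtain x where x: "x \<in> ?S" "\<forall>y\<in>?S. x \<le> y"
    using compact_attains_inf by blast
  have "h ` {s..x} \<inter> K = {h x}"
  proof (intro set_eqI iffI)
    fix z assume "z \<in> h ` {s..x} \<inter> K"
    then obtain y where "y \<in> {s..x}" "h y \<in> K" "z = h y" by auto
    then show "z \<in> {h x}" using x by force
  next
    fix z assume "z \<in> {h x}" then show "z \<in> h ` {s..x} \<inter> K" using x by auto
  qed
  then show ?thesis using that[of "h x"] seg_split_param[OF h(2,3), of x] h x by auto
qed

text \<open>Concatenation need not be injective, so the new arc follows \<open>A\<close> only up to
  its first point on \<open>B\<close>.\<close>

lemma seg_trans:
  assumes "Hausdorff_space X" "seg X a b A" "seg X b c B"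
  obtains C where "seg X a c C" "C \<subseteq> A \<union> B"
proof -
  have "A \<inter> B \<noteq> {}" using seg_ends(2)[OF assms(2)] seg_ends(1)[OF assms(3)] by blast
  then obtain d A1 A2 where A: "seg X a d A1" "seg X d b A2" "A1 \<union> A2 = A" "A1 \<inter> A2 = {d}" "A1 \<inter> B = {d}"
    by (rule seg_first_hit[OF assms(2) seg_closed[OF assms(1,3)]])
  then have "d \<in> B" by blast
  then obtain B1 B2 where B: "seg X b d B1" "seg X d c B2" "B1 \<union> B2 = B" "B1 \<inter> B2 = {d}"
    by (rule seg_split[OF assms(3)])
  have "A1 \<inter> B2 = {d}" using A(5) B(3) seg_ends(2)[OF A(1)] seg_ends(1)[OF B(2)] by blast
  from seg_join[OF A(1) B(2) this] show ?thesis by (rule that) (use A B in blast)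
qed

lemma seg_mid:
  assumes "seg X a b A" "a \<noteq> b" obtains c where "c \<in> A" "c \<noteq> a" "c \<noteq> b"
proof -
  obtain s t h where h: "s \<le> t" "inj_on h {s..t::real}" "h s = a" "h t = b" "A = h ` {s..t}"
    using assms(1) unfolding seg_def by blast
  have "s < t" using h assms by (cases "s = t") auto
  then obtain m where m: "s < m" "m < t" using dense by blast
  have "h m \<noteq> h s" "h m \<noteq> h t"
    using m h(1) inj_onD[OF h(2), of m s] inj_onD[OF h(2), of m t] by auto
  moreover have "h m \<in> A" using m h by auto
  ultimately show ?thesis using h m that by blast
qed

text \<open>A continuous injection of a compact interval into a Hausdorff space is an embedding, so
  \<open>seg\<close> need not mention an inverse map. Distinct ends exclude the one-point
  arcs.\<close>

lemma arc_in_iff_seg: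
  assumes "Hausdorff_space X"
  shows "arc_in X A \<longleftrightarrow> (\<exists>a b. a \<noteq> b \<and> seg X a b A)"
proof
  assume "arc_in X A"
  then have A: "A \<subseteq> topspace X" and "subtopology X A homeomorphic_space top_of_set {0..1::real}"
    by (auto simp: arc_in_def)
  then have "top_of_set {0..1::real} homeomorphic_space subtopology X A"
    using homeomorphic_space_sym by blast
  then obtain h where h: "homeomorphic_map (top_of_set {0..1::real}) (subtopology X A) h"
    unfolding homeomorphic_space by blast
  have c: "continuous_map (top_of_set {0..1}) X h"
    using h homeomorphic_imp_continuous_map continuous_map_into_fulltopology by blast
  have i: "inj_on h {0..1}" using homeomorphic_imp_injective_map[OF h] by simp
  have s: "h ` {0..1} = A" using homeomorphic_imp_surjective_map[OF h] A by auto
  have "seg X (h 0) (h 1) A" unfolding seg_def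
    by (rule exI[of _ 0], rule exI[of _ 1], rule exI[of _ h]) (simp add: c i s)
  moreover have "h 0 \<noteq> h 1" using inj_onD[OF i, of 0 1] by auto
  ultimately show "\<exists>a b. a \<noteq> b \<and> seg X a b A" by blast
next
  assume "\<exists>a b. a \<noteq> b \<and> seg X a b A"
  then obtain a b where ab: "a \<noteq> b" "seg X a b A" by blast
  then obtain s t h where h: "s \<le> t" "continuous_map (top_of_set {s..t::real}) X h"
    "inj_on h {s..t}" "h s = a" "h t = b" "A = h ` {s..t}"
    unfolding seg_def by blast
  have A: "A \<subseteq> topspace X" using seg_subset[OF ab(2)] .
  have "embedding_map (top_of_set {s..t}) X h"
    using continuous_imp_embedding_map[OF h(2) _ assms] h(3)
    by (simp add: compact_space_subtopology)
  then have "homeomorphic_map (top_of_set {s..t}) (subtopology X A) h"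
    by (simp add: embedding_map_def h(6))
  then have XA: "top_of_set {s..t} homeomorphic_space subtopology X A"
    by (rule homeomorphic_map_imp_homeomorphic_space)
  have "{s..t} homeomorphic {0..1::real}"
  proof -
    have "s < t" using h ab by (cases "s = t") auto
    then show ?thesis by (rule homeomorphic_closed_intervals_real) simp
  qed
  then have "top_of_set {s..t} homeomorphic_space top_of_set {0..1::real}"
    unfolding homeomorphic_def homeomorphic_space_def
    by (elim exE, rule_tac x=f in exI, rule_tac x=g in exI)
      (auto simp: homeomorphism_def homeomorphic_maps_def continuous_map_in_subtopology)
  then have "subtopology X A homeomorphic_space top_of_set {0..1::real}"
    using XA homeomorphic_space_trans homeomorphic_space_sym by blast
  then show "arc_in X A" using A by (simp add: arc_in_def)
qed

text \<open>The points \<open>a\<close> and \<open>b\<close> cut the arc into at most three parts,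
  so two of the four points lie in the same part.\<close>

lemma seg_pigeonhole:
  assumes "seg X s t A" "S \<subseteq> A - {a, b}" "card S = 4"
  obtains x y B where "x \<in> S" "y \<in> S" "x \<noteq> y" "seg X x y B" "B \<subseteq> A - {a, b}"
proof -
  obtain s' t' h where h: "s' \<le> t'" "continuous_map (top_of_set {s'..t'::real}) X h"
    "inj_on h {s'..t'}" "A = h ` {s'..t'}"
    using assms(1) unfolding seg_def by blast
  \<comment> \<open>The position along the arc. A point off the arc is placed before the start,
    where it separates nothing.\<close>
  define k where "k = (\<lambda>c. if c \<in> A then the_inv_into {s'..t'} h c else s' - 1)"
  have khy: "k (h y) = y" if "y \<in> {s'..t'}" for y
    using that h(3,4) by (simp add: k_def the_inv_into_f_f)
  have k: "h (k c) = c" "k c \<in> {s'..t'}" if "c \<in> A" for c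
    using that khy unfolding h(4) by auto
  \<comment> \<open>The part in which \<open>x\<close> lies. Of the four conceivable values one is
    excluded by the order of \<open>a\<close> and \<open>b\<close>.\<close>
  define f where "f = (\<lambda>x. (k x < k a, k x < k b))"
  have "f ` S \<subseteq> UNIV - {(True, False)} \<or> f ` S \<subseteq> UNIV - {(False, True)}"
    by (cases "k a \<le> k b") (auto simp: f_def image_subset_iff)
  moreover have "card (UNIV - {(True, False)}) = 3" "card (UNIV - {(False, True)}) = 3"
    by (simp_all add: card_Diff_subset)
  ultimately have "card (f ` S) \<le> 3" by (metis card_mono finite_code)
  then have "\<not> inj_on f S" using assms(3) card_image[of f S] by auto
  then obtain x y where xy: "x \<in> S" "y \<in> S" "x \<noteq> y" "f x = f y" "k x \<le> k y"
    unfolding inj_on_def by (metis linorder_linear)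
  have xA: "x \<in> A" "y \<in> A" using xy assms by auto
  let ?B = "h ` {k x..k y}"
  have "seg X x y ?B" using seg_between[OF h(2,3), of "k x" "k y"] k xA xy by auto
  moreover have "?B \<subseteq> A" using h k[OF xA(1)] k[OF xA(2)] by auto
  moreover have "c \<notin> ?B" if "c \<in> {a,b}" for c
  proof
    assume "c \<in> ?B"
    then obtain z where z: "z \<in> {k x..k y}" "c = h z" by blast
    then have "k c = z" using khy k[OF xA(1)] k[OF xA(2)] by auto
    then have "k x \<le> k c" "k c \<le> k y" using z by auto
    moreover have "k x < k c \<longleftrightarrow> k y < k c" using xy that by (auto simp: f_def)
    ultimately have "k x = k c" by linarith
    then have "c = x" using z(2) k(1)[OF xA(1)] \<open>k c = z\<close> by simp
    then show False using that xy assms by blast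
  qed
  ultimately show ?thesis using that xy by blast
qed

section \<open>Circles and ears in spaces without cut points\<close>

text \<open>Identities and inclusions between configurations of arcs are verified point by point
  with these rules.\<close>

lemmas set_pointwise = set_eq_iff subset_iff Un_iff Int_iff Diff_iff insert_iff empty_iff

text \<open>The part of \<open>J\<close> between \<open>x\<close> and \<open>z\<close> is replaced
  by \<open>N\<close>. The two cases are the two orders in which \<open>x\<close> and
  \<open>z\<close> may occur along \<open>J\<close>.\<close>

lemma seg_reroute:
  assumes J: "seg X a b J" and xz: "x \<in> J" "z \<in> J" "x \<noteq> z"
    and N: "seg X x z N" "N \<inter> J = {x, z}"
  obtains J' where "seg X a b J'" "N \<subseteq> J'" "J' \<subseteq> J \<union> N"
proof -
  obtain J1 J2 where S: "seg X a x J1" "seg X x b J2" "J1 \<union> J2 = J" "J1 \<inter> J2 = {x}"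
    by (rule seg_split[OF J xz(1)])
  show ?thesis
  proof (cases "z \<in> J2")
    case True
    obtain J3 J4 where T: "seg X x z J3" "seg X z b J4" "J3 \<union> J4 = J2" "J3 \<inter> J4 = {z}"
      by (rule seg_split[OF S(2) True])
    have "x \<in> J3" "z \<in> J4" "z \<in> J3" "x \<in> J1" using seg_ends[OF T(1)] seg_ends[OF T(2)] seg_ends[OF S(1)] by auto
    then have 1: "J1 \<inter> N = {x}" and 2: "(J1 \<union> N) \<inter> J4 = {z}" using N S T xz True unfolding set_pointwise by (smt (verit))+
    show ?thesis
      by (rule that[OF seg_join[OF seg_join[OF S(1) N(1) 1] T(2) 2]]) (use S T in blast)+
  next
    case False
    then have z: "z \<in> J1" using xz S unfolding set_pointwise by (smt (verit))
    obtain J3 J4 where T: "seg X a z J3" "seg X z x J4" "J3 \<union> J4 = J1" "J3 \<inter> J4 = {z}"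
      by (rule seg_split[OF S(1) z])
    have "x \<in> J4" "z \<in> J3" "x \<in> J2" using seg_ends[OF T(1)] seg_ends[OF T(2)] seg_ends[OF S(2)] by auto
    then have 1: "J3 \<inter> N = {z}" and 2: "(J3 \<union> N) \<inter> J2 = {x}" using N S T xz False unfolding set_pointwise by (smt (verit))+
    show ?thesis
      by (rule that[OF seg_join[OF seg_join[OF T(1) seg_sym[OF N(1)] 1] S(2) 2]]) (use S T in blast)+
  qed
qed

text \<open>A topological circle given by two arcs, so that only arcs have to be handled. The two
  common ends carry no information: by \<open>circle_split\<close> any two points of the circle can
  take their place.\<close>

definition circle :: "'b topology \<Rightarrow> 'b set \<Rightarrow> bool" where
  "circle X E \<longleftrightarrow> (\<exists>a b E1 E2. a \<noteq> b \<and> seg X a b E1 \<and> seg X a b E2 \<and> E1 \<inter> E2 = {a, b} \<and> E = E1 \<union> E2)"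

lemma circleI: "a \<noteq> b \<Longrightarrow> seg X a b E1 \<Longrightarrow> seg X a b E2 \<Longrightarrow> E1 \<inter> E2 = {a, b} \<Longrightarrow> circle X (E1 \<union> E2)"
  unfolding circle_def by blast

lemma circle_closed: "Hausdorff_space X \<Longrightarrow> circle X E \<Longrightarrow> closedin X E"
  unfolding circle_def by (auto intro: seg_closed)

text \<open>The part of \<open>E1\<close> between \<open>a\<close> and \<open>x\<close> is handed
  over to the other arc.\<close>

lemma circle_move_end:
  assumes E: "seg X a b E1" "seg X a b E2" "E1 \<inter> E2 = {a, b}" "a \<noteq> b" and x: "x \<in> E1" "x \<noteq> b"
  obtains F1 F2 where "seg X x b F1" "seg X x b F2" "F1 \<inter> F2 = {x, b}" "F1 \<union> F2 = E1 \<union> E2"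
proof -
  obtain U V where S: "seg X a x U" "seg X x b V" "U \<union> V = E1" "U \<inter> V = {x}"
    by (rule seg_split[OF E(1) x(1)])
  have e: "a \<in> U" "b \<in> V" "x \<in> U" "a \<in> E2" "b \<in> E2" using seg_ends[OF S(1)] seg_ends[OF S(2)] seg_ends[OF E(2)] by auto
  have 1: "U \<inter> E2 = {a}" and 2: "V \<inter> (U \<union> E2) = {x, b}" and 3: "V \<union> (U \<union> E2) = E1 \<union> E2"
    using S E x e unfolding set_pointwise by (smt (verit))+
  show ?thesis by (rule that[OF S(2) seg_join[OF seg_sym[OF S(1)] E(2) 1] 2 3])
qed

lemma circle_rebase:
  assumes "circle X E" "x \<in> E"
  obtains y E1 E2 where "x \<noteq> y" "seg X x y E1" "seg X x y E2" "E1 \<inter> E2 = {x, y}" "E = E1 \<union> E2"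
proof -
  obtain a b E1 E2 where E: "a \<noteq> b" "seg X a b E1" "seg X a b E2" "E1 \<inter> E2 = {a, b}" "E = E1 \<union> E2"
    using assms(1) unfolding circle_def unfolding set_pointwise by (smt (verit))
  have E': "E2 \<inter> E1 = {a, b}" using E unfolding set_pointwise by (smt (verit))
  consider "x = b" | "x \<noteq> b" "x \<in> E1" | "x \<noteq> b" "x \<in> E2" using assms(2) E unfolding set_pointwise by (smt (verit))
  then show ?thesis
  proof cases
    case 1
    then have "E1 \<inter> E2 = {x, a}" using E unfolding set_pointwise by (smt (verit))
    then show ?thesis using that[of a E1 E2] E seg_sym 1 by metis
  next
    case 2
    obtain F1 F2 where F: "seg X x b F1" "seg X x b F2" "F1 \<inter> F2 = {x, b}" "F1 \<union> F2 = E1 \<union> E2"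
      by (rule circle_move_end[OF E(2,3,4,1) 2(2,1)])
    show ?thesis by (rule that[OF 2(1) F(1-3)]) (use F E in simp)
  next
    case 3
    obtain F1 F2 where F: "seg X x b F1" "seg X x b F2" "F1 \<inter> F2 = {x, b}" "F1 \<union> F2 = E2 \<union> E1"
      by (rule circle_move_end[OF E(3,2) E' E(1) 3(2,1)])
    show ?thesis by (rule that[OF 3(1) F(1-3)]) (use F E in blast)
  qed
qed

text \<open>One common end is moved to \<open>x\<close>, and then the other one to
  \<open>y\<close>.\<close>

lemma circle_split:
  assumes "circle X E" "x \<in> E" "y \<in> E" "x \<noteq> y"
  obtains E1 E2 where "seg X x y E1" "seg X x y E2" "E1 \<inter> E2 = {x, y}" "E = E1 \<union> E2"
proof -
  obtain z E1 E2 where E: "x \<noteq> z" "seg X x z E1" "seg X x z E2" "E1 \<inter> E2 = {x, z}" "E = E1 \<union> E2"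
    by (rule circle_rebase[OF assms(1,2)])
  have *: "E1 \<inter> E2 = {z, x}" "E2 \<inter> E1 = {z, x}" "z \<noteq> x" "y \<noteq> x" using E assms unfolding set_pointwise by (smt (verit))+
  obtain F1 F2 where F: "seg X y x F1" "seg X y x F2" "F1 \<inter> F2 = {y, x}" "F1 \<union> F2 = E"
  proof (cases "y \<in> E1")
    case True
    show ?thesis
      by (rule circle_move_end[OF seg_sym[OF E(2)] seg_sym[OF E(3)] *(1,3) True *(4)])
        (use that E in auto)
  next
    case False
    then have "y \<in> E2" using assms E unfolding set_pointwise by (smt (verit))
    show ?thesis
      by (rule circle_move_end[OF seg_sym[OF E(3)] seg_sym[OF E(2)] *(2,3) \<open>y \<in> E2\<close> *(4)])
        (use that E in \<open>auto simp: Un_commute\<close>)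
  qed
  show ?thesis by (rule that[OF seg_sym[OF F(1)] seg_sym[OF F(2)]]) (use F in auto)
qed

text \<open>Walk round the circle from \<open>c\<close>, first along \<open>E1\<close> and then back
  along \<open>E2\<close>, and stop at the last required point before \<open>c\<close> is reached
  again.\<close>

lemma circle_arc:
  assumes X: "Hausdorff_space X" and E: "circle X E" "c \<in> E" and P: "finite P" "P \<subseteq> E"
  obtains w A where "seg X c w A" "A \<subseteq> E" "P \<subseteq> A"
proof -
  obtain y E1 E2 where B: "c \<noteq> y" "seg X c y E1" "seg X c y E2" "E1 \<inter> E2 = {c, y}" "E = E1 \<union> E2"
    by (rule circle_rebase[OF E])
  \<comment> \<open>Adding \<open>y\<close> guarantees that \<open>E2\<close> meets the set;
    \<open>c\<close> is left out because the search along \<open>E2\<close> starts there.\<close>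
  let ?Q = "(P \<union> {y}) \<inter> E2 - {c}"
  have y: "y \<in> E2" "c \<in> E1" "y \<in> E1" using seg_ends[OF B(3)] seg_ends[OF B(2)] by auto
  have "?Q \<subseteq> topspace X" using seg_subset[OF B(3)] unfolding set_pointwise by (smt (verit))
  then have "closedin X ?Q" using P X
    by (intro closedin_Hausdorff_finite) auto
  moreover have "E2 \<inter> ?Q \<noteq> {}" using y B unfolding set_pointwise by (smt (verit))
  ultimately obtain d E3 E4 where F: "seg X c d E3" "seg X d y E4" "E3 \<union> E4 = E2" "E3 \<inter> E4 = {d}" "E3 \<inter> ?Q = {d}"
    by (rule seg_first_hit[OF B(3)])
  have e: "c \<in> E3" "d \<in> E4" "y \<in> E4" using seg_ends[OF F(1)] seg_ends[OF F(2)] by auto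
  have i: "E1 \<inter> E4 = {y}" using B F e y unfolding set_pointwise by (smt (verit))
  show ?thesis
  proof (rule that[OF seg_join[OF B(2) seg_sym[OF F(2)] i]])
    show "E1 \<union> E4 \<subseteq> E" using B F unfolding set_pointwise by (smt (verit))
    show "P \<subseteq> E1 \<union> E4"
    proof
      fix p assume "p \<in> P"
      then show "p \<in> E1 \<union> E4" using P F B y e unfolding set_pointwise by (smt (verit))
    qed
  qed
qed

text \<open>The stick \<open>A\<close> is prolonged by a walk round the circle that starts at the
  point of attachment.\<close>

lemma lollipop:
  assumes X: "Hausdorff_space X" and A: "seg X v c A" and E: "circle X E" "A \<inter> E = {c}"
    and P: "finite P" "P \<subseteq> A \<union> E"
  obtains w B where "seg X v w B" "P \<subseteq> B"
proof -
  have "c \<in> E" using E unfolding set_pointwise by (smt (verit))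
  moreover have "finite (P \<inter> E)" "P \<inter> E \<subseteq> E" using P by auto
  ultimately obtain w C where C: "seg X c w C" "C \<subseteq> E" "P \<inter> E \<subseteq> C"
    by (rule circle_arc[OF X E(1)])
  have "A \<inter> C = {c}" using C E seg_ends[OF C(1)] unfolding set_pointwise by (smt (verit))
  then show ?thesis using that[OF seg_join[OF A C(1)]] C P unfolding set_pointwise by (smt (verit))
qed

text \<open>In a 1-complex these are the pieces of edges. Nothing branches off in the interior: a
  connected set that lies partly inside and partly outside the arc contains one of its ends.\<close>

definition free_seg :: "'b topology \<Rightarrow> 'b \<Rightarrow> 'b \<Rightarrow> 'b set \<Rightarrow> bool" where
  "free_seg X a b S \<longleftrightarrow> a \<noteq> b \<and> seg X a b S \<and> openin X (S - {a, b})"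

lemma free_seg_sym: "free_seg X a b S \<Longrightarrow> free_seg X b a S"
  unfolding free_seg_def using seg_sym[of X a b S] by (auto simp: insert_commute)

text \<open>The interior of the part \<open>S1\<close> is the interior of \<open>S\<close> without
  the closed set \<open>S2\<close>.\<close>

lemma free_seg_part:
  assumes X: "Hausdorff_space X" and S: "free_seg X a b S"
    and "seg X a c S1" "seg X c b S2" "S1 \<union> S2 = S" "S1 \<inter> S2 = {c}" "c \<noteq> a"
  shows "free_seg X a c S1"
proof -
  have "a \<in> S1" "c \<in> S1" "b \<in> S2" "c \<in> S2" 
    using seg_ends[OF assms(3)] seg_ends[OF assms(4)] by auto
  then have "S1 - {a, c} = (S - {a, b}) - S2" using assms(5-7) unfolding set_pointwise by (smt (verit))
  moreover have "openin X (S - {a, b} - S2)"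
    using S seg_closed[OF X assms(4)] unfolding free_seg_def by blast
  ultimately show ?thesis using assms unfolding free_seg_def by simp
qed

text \<open>An abstraction of the 1-complex of a 2-connected graph other than K2. The chains of free
  arcs allow properties to be propagated from one point to any other by induction.\<close>

locale cyclic_space =
  fixes X :: "'b topology"
  assumes hausdorff: "Hausdorff_space X"
    and avoid: "y \<in> topspace X \<Longrightarrow> z \<in> topspace X \<Longrightarrow> y \<noteq> x \<Longrightarrow> z \<noteq> x \<Longrightarrow> \<exists>A. seg X y z A \<and> x \<notin> A"
    and chain: "y \<in> topspace X \<Longrightarrow> z \<in> topspace X \<Longrightarrow> (\<lambda>u w. \<exists>S. free_seg X u w S)\<^sup>*\<^sup>* y z"
begin

lemma arc_to:
  assumes "closedin X K" "k \<in> K" "k \<noteq> x" "y \<in> topspace X" "y \<noteq> x"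
  obtains z A where "seg X y z A" "x \<notin> A" "A \<inter> K = {z}"
proof -
  have "k \<in> topspace X" using assms closedin_subset unfolding set_pointwise by (smt (verit))
  then obtain A where A: "seg X y k A" "x \<notin> A" using avoid[of y k x] assms by blast
  then have "A \<inter> K \<noteq> {}" using assms seg_ends[OF A(1)] unfolding set_pointwise by (smt (verit))
  then obtain c A1 A2 where "seg X y c A1" "seg X c k A2" "A1 \<union> A2 = A" "A1 \<inter> A2 = {c}" "A1 \<inter> K = {c}"
    by (rule seg_first_hit[OF A(1) assms(1)])
  then show ?thesis using that A by blast
qed

definition on_ear :: "'b set \<Rightarrow> 'b \<Rightarrow> bool" where
  "on_ear K q \<longleftrightarrow> (\<exists>a b J. a \<noteq> b \<and> seg X a b J \<and> J \<inter> K = {a, b} \<and> q \<in> J)"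

text \<open>The new ear follows \<open>J\<close> from \<open>a\<close> to \<open>x\<close> and then
  \<open>N\<close>. Its ends differ because \<open>y\<close> is not on \<open>J\<close>.\<close>

lemma on_ear_extend:
  assumes J: "seg X a b J" "J \<inter> K = {a, b}" and xy: "x \<in> J - K" "y \<in> K - J"
    and N: "seg X x y N" "N \<inter> (K \<union> J) = {x, y}" "w \<in> N"
  shows "on_ear K w"
proof -
  obtain J1 J2 where S: "seg X a x J1" "seg X x b J2" "J1 \<union> J2 = J" "J1 \<inter> J2 = {x}"
    by (rule seg_split[OF J(1)]) (use xy in blast)+
  have e: "a \<in> J1" "x \<in> J1" "b \<in> J2" using seg_ends[OF S(1)] seg_ends[OF S(2)] by auto
  have b: "b \<notin> J1" using e S xy J unfolding set_pointwise by (smt (verit))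
  have 1: "J1 \<inter> N = {x}" using N S xy e unfolding set_pointwise by (smt (verit))
  have "(J1 \<union> N) \<inter> K = {a, y}" using J N S xy e b unfolding set_pointwise by (smt (verit))
  moreover have "a \<noteq> y" using xy e S unfolding set_pointwise by (smt (verit))
  ultimately show ?thesis unfolding on_ear_def using seg_join[OF S(1) N(1) 1] N(3) by blast
qed

text \<open>Whitney's argument: an ear through \<open>u\<close> is rerouted along the free arc to \<open>w\<close> and an arc
  that leads from \<open>w\<close> back while avoiding \<open>u\<close>.\<close>

lemma on_ear_step:
  assumes K: "closedin X K" "k0 \<in> K" "k1 \<in> K" "k0 \<noteq> k1"
    and u: "u \<in> K \<or> on_ear K u" and F: "free_seg X u w S"
  shows "w \<in> K \<or> on_ear K w"
proof (rule ccontr)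
  assume con: "\<not> (w \<in> K \<or> on_ear K w)"
  have uw: "u \<noteq> w" and S: "seg X u w S" using F unfolding free_seg_def by auto
  have top: "w \<in> topspace X" "u \<in> topspace X" using seg_subset[OF S] seg_ends[OF S] by auto
  \<comment> \<open>If \<open>u\<close> lies on \<open>K\<close> there need not be an ear through
    it; the one-point arc \<open>{u}\<close> then takes its place, so that both situations are
    treated together.\<close>
  obtain a b J where J: "seg X a b J" "u \<in> J" and aJ: "a \<noteq> b \<and> J \<inter> K = {a, b} \<or> u \<in> K \<and> J = {u}"
  proof (cases "u \<in> K")
    case True then show ?thesis using that[OF seg_refl[OF top(2)]] by blast
  next
    case False
    then obtain a b J where "a \<noteq> b" "seg X a b J" "J \<inter> K = {a, b}" "u \<in> J"
      using u unfolding on_ear_def by blast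
    then show ?thesis using that[of a b J] by blast
  qed
  let ?H = "K \<union> J"
  have H: "closedin X ?H" using K seg_closed[OF hausdorff J(1)] by blast
  have w: "w \<notin> ?H" using con aJ J uw unfolding on_ear_def by blast
  have "S \<inter> ?H \<noteq> {}" using seg_ends[OF S] J unfolding set_pointwise by (smt (verit))
  then obtain c S1 S2 where C: "seg X w c S1" "seg X c u S2" "S1 \<union> S2 = S" "S1 \<inter> S2 = {c}" "S1 \<inter> ?H = {c}"
    by (rule seg_first_hit[OF seg_sym[OF S] H])
  have cw: "c \<noteq> w" "c \<in> ?H" using C w unfolding set_pointwise by (smt (verit))+
  have op: "openin X (S1 - {w, c})"
    using free_seg_part[OF hausdorff free_seg_sym[OF F] C(1-4) cw(1)] unfolding free_seg_def by blast
  obtain k where k: "k \<in> ?H" "k \<noteq> c" using K by blast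
  obtain z T where T: "seg X w z T" "c \<notin> T" "T \<inter> ?H = {z}"
    by (rule arc_to[OF H k top(1)]) (use cw in auto)
  have zc: "z \<noteq> c" "z \<in> ?H" using T seg_ends[OF T(1)] unfolding set_pointwise by (smt (verit))+
  have wS1: "w \<in> S1" "w \<in> T" "c \<in> S1" "z \<in> T" using seg_ends[OF C(1)] seg_ends[OF T(1)] by auto
  \<comment> \<open>If \<open>T\<close> met \<open>S1\<close> in a further point \<open>y\<close>,
    its part from \<open>y\<close> to \<open>z\<close> would be connected and avoid both ends
    \<open>w\<close> and \<open>c\<close> of the free arc \<open>S1\<close>, although it starts
    inside \<open>S1\<close> and ends outside.\<close>
  have TS: "S1 \<inter> T = {w}"
  proof (rule ccontr)
    assume "S1 \<inter> T \<noteq> {w}"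
    then obtain y where y: "y \<in> S1" "y \<in> T" "y \<noteq> w" using wS1 by blast
    obtain T1 T2 where T12: "seg X w y T1" "seg X y z T2" "T1 \<union> T2 = T" "T1 \<inter> T2 = {y}"
      by (rule seg_split[OF T(1) y(2)])
    have wT2: "w \<notin> T2" using seg_ends[OF T12(1)] T12(4) y(3) unfolding set_pointwise by (smt (verit))
    have "y \<noteq> c" using y T unfolding set_pointwise by (smt (verit))
    have zS1: "z \<notin> S1" using zc C unfolding set_pointwise by (smt (verit))
    have "openin X (topspace X - S1)" using seg_closed[OF hausdorff C(1)] by blast
    moreover have "T2 \<subseteq> (S1 - {w, c}) \<union> (topspace X - S1)"
      using wT2 T T12 seg_subset[OF T(1)] unfolding set_pointwise by (smt (verit))
    moreover have "(S1 - {w, c}) \<inter> (topspace X - S1) \<inter> T2 = {}" by blast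
    moreover have "(S1 - {w, c}) \<inter> T2 \<noteq> {}" using y \<open>y \<noteq> c\<close> seg_ends[OF T12(2)] unfolding set_pointwise by (smt (verit))
    moreover have "(topspace X - S1) \<inter> T2 \<noteq> {}"
      using zS1 seg_ends[OF T12(2)] seg_subset[OF T12(2)] unfolding set_pointwise by (smt (verit))
    ultimately show False using seg_connected[OF T12(2)] op unfolding connectedin by blast
  qed
  define N where "N = S1 \<union> T"
  have N: "seg X c z N" unfolding N_def by (rule seg_join[OF seg_sym[OF C(1)] T(1) TS])
  have NH: "N \<inter> ?H = {c, z}" unfolding N_def using C T unfolding set_pointwise by (smt (verit))
  have wN: "w \<in> N" unfolding N_def using wS1 unfolding set_pointwise by (smt (verit))
  \<comment> \<open>With both ends on \<open>K\<close>, the arc \<open>N\<close> is itself an ear.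
    With both ends on \<open>J\<close>, the ear is rerouted along \<open>N\<close>. In the mixed
    cases a part of \<open>J\<close> is prolonged by \<open>N\<close>.\<close>
  consider "c \<in> K" "z \<in> K" | "c \<in> J" "z \<in> J" | "c \<in> J - K" "z \<in> K - J" | "z \<in> J - K" "c \<in> K - J"
    using cw zc unfolding set_pointwise by (smt (verit))
  then have "on_ear K w"
  proof cases
    case 1
    then have "N \<inter> K = {c, z}" using NH unfolding set_pointwise by (smt (verit))
    then show ?thesis unfolding on_ear_def using N zc wN by metis
  next
    case 2
    then have ab: "a \<noteq> b" "J \<inter> K = {a, b}" using aJ zc unfolding set_pointwise by (smt (verit))+
    have "N \<inter> J = {c, z}" using NH 2 unfolding set_pointwise by (smt (verit))
    then obtain J' where J': "seg X a b J'" "N \<subseteq> J'" "J' \<subseteq> J \<union> N"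
      using seg_reroute[OF J(1) 2 zc(1)[symmetric] N] by metis
    have "a \<in> J'" "b \<in> J'" using seg_ends[OF J'(1)] by auto
    then have "J' \<inter> K = {a, b}" using J' ab NH 2 unfolding set_pointwise by (smt (verit))
    then show ?thesis unfolding on_ear_def using J' ab wN by blast
  next
    case 3
    then have "J \<inter> K = {a, b}" using aJ unfolding set_pointwise by (smt (verit))
    then show ?thesis using on_ear_extend[OF J(1) _ 3 N NH wN] unfolding set_pointwise by (smt (verit))
  next
    case 4
    then have "J \<inter> K = {a, b}" using aJ unfolding set_pointwise by (smt (verit))
    moreover have "N \<inter> ?H = {z, c}" using NH unfolding set_pointwise by (smt (verit))
    ultimately show ?thesis using on_ear_extend[OF J(1) _ 4 seg_sym[OF N] _ wN] by blast
  qed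
  with con show False by blast
qed

text \<open>Starting at \<open>k0\<close> in \<open>K\<close>, the step above is iterated along a
  finite chain of free arcs that ends in \<open>p\<close>.\<close>

lemma ear:
  assumes K: "closedin X K" "k0 \<in> K" "k1 \<in> K" "k0 \<noteq> k1" and p: "p \<in> topspace X" "p \<notin> K"
  obtains a b J where "a \<noteq> b" "seg X a b J" "J \<inter> K = {a, b}" "p \<in> J"
proof -
  have "k0 \<in> topspace X" using K closedin_subset unfolding set_pointwise by (smt (verit))
  from chain[OF this p(1)] have "p \<in> K \<or> on_ear K p"
  proof induction
    case base
    then show ?case using K by blast
  next
    case (step y z)
    then show ?case using on_ear_step[OF K] by blast
  qed
  then show ?thesis using p that unfolding on_ear_def by blast
qed

text \<open>Take a free arc \<open>T\<close> from \<open>p\<close> that misses \<open>q\<close>. An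
  ear of \<open>T\<close> through \<open>q\<close> cannot be attached in the open interior of
  \<open>T\<close>, so it joins the two ends of \<open>T\<close> and closes it up to a
  circle.\<close>

lemma circle_through_two:
  assumes "p \<in> topspace X" "q \<in> topspace X" "p \<noteq> q"
  obtains E where "circle X E" "p \<in> E" "q \<in> E"
proof -
  obtain r S where S: "free_seg X p r S"
    using chain[OF assms(1,2)] assms(3) by (auto elim: converse_rtranclpE)
  \<comment> \<open>A free arc at \<open>p\<close> that contains \<open>q\<close> is shortened so as
    to stop before \<open>q\<close>.\<close>
  obtain c T where T: "free_seg X p c T" "q \<notin> T"
  proof (cases "q \<in> S")
    case False then show ?thesis using that S by blast
  next
    case True
    have S': "seg X p r S" using S unfolding free_seg_def by blast
    obtain S1 S2 where 1: "seg X p q S1" "seg X q r S2" "S1 \<union> S2 = S" "S1 \<inter> S2 = {q}"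
      by (rule seg_split[OF S' True])
    have f: "free_seg X p q S1" using free_seg_part[OF hausdorff S 1] assms by blast
    obtain c where c: "c \<in> S1" "c \<noteq> p" "c \<noteq> q" by (rule seg_mid[OF 1(1) assms(3)])
    obtain S3 S4 where 2: "seg X p c S3" "seg X c q S4" "S3 \<union> S4 = S1" "S3 \<inter> S4 = {c}"
      by (rule seg_split[OF 1(1) c(1)])
    have "q \<notin> S3" using 2(4) seg_ends[OF 2(2)] c unfolding set_pointwise by (smt (verit))
    then show ?thesis using that free_seg_part[OF hausdorff f 2] c by blast
  qed
  have pc: "p \<noteq> c" and Ts: "seg X p c T" and op: "openin X (T - {p, c})"
    using T unfolding free_seg_def by auto
  have e: "p \<in> T" "c \<in> T" using seg_ends[OF Ts] by auto
  have cl: "closedin X T" by (rule seg_closed[OF hausdorff Ts])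
  obtain a b J where J: "a \<noteq> b" "seg X a b J" "J \<inter> T = {a, b}" "q \<in> J"
    by (rule ear[OF cl e pc assms(2) T(2)])
  \<comment> \<open>If the end \<open>x\<close> were in the interior of \<open>T\<close>, the ear
    without its other end \<open>y\<close> would be a connected set divided by two open sets, this
    interior and the complement of \<open>T\<close>.\<close>
  have *: "x \<in> {p, c}" if xy: "x \<noteq> y" "seg X x y J" "J \<inter> T = {x, y}" for x y
  proof (rule ccontr)
    assume x: "x \<notin> {p, c}"
    have "openin X (topspace X - T)" using cl by blast
    moreover have "J - {y} \<subseteq> (T - {p, c}) \<union> (topspace X - T)"
      using xy x seg_subset[OF xy(2)] unfolding set_pointwise by (smt (verit))
    moreover have "(T - {p, c}) \<inter> (topspace X - T) \<inter> (J - {y}) = {}" by blast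
    moreover have "(T - {p, c}) \<inter> (J - {y}) \<noteq> {}" using x xy unfolding set_pointwise by (smt (verit))
    moreover have "(topspace X - T) \<inter> (J - {y}) \<noteq> {}" using J(4) T(2) xy assms(2) unfolding set_pointwise by (smt (verit))
    ultimately show False using seg_connected_minus_end[OF xy(2)] op unfolding connectedin by blast
  qed
  have "J \<inter> T = {b, a}" using J unfolding set_pointwise by (smt (verit))
  then have "a \<in> {p, c}" "b \<in> {p, c}" using *[of a b] *[of b a] J seg_sym by metis+
  then have ab: "a = p \<and> b = c \<or> a = c \<and> b = p" using J unfolding set_pointwise by (smt (verit))
  then have "seg X p c J" using J(2) seg_sym by metis
  moreover have "T \<inter> J = {p, c}" using J ab unfolding set_pointwise by (smt (verit))
  ultimately have "circle X (T \<union> J)" by (intro circleI[OF pc Ts])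
  then show ?thesis using that e J by blast
qed

lemma arc_to_circle:
  assumes "circle X E" "finite P" "P \<subseteq> E" "v \<in> topspace X"
  obtains w B where "seg X v w B" "P \<subseteq> B"
proof -
  obtain c A where A: "seg X v c A" "A \<inter> E = {c}"
  proof (cases "v \<in> E")
    case True then show ?thesis using that[OF seg_refl[OF assms(4)]] by blast
  next
    case False
    obtain a b E1 E2 where E: "a \<noteq> b" "seg X a b E1" "E = E1 \<union> E2"
      using assms(1) unfolding circle_def by blast
    have ab: "a \<in> E" "b \<in> E" using seg_ends[OF E(2)] E(3) by auto
    show ?thesis
      by (rule arc_to[OF circle_closed[OF hausdorff assms(1)] ab(1) E(1) assms(4)])
        (use False ab that in auto)
  qed
  show ?thesis by (rule lollipop[OF hausdorff A(1) assms(1) A(2) assms(2)]) (use assms that in auto)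
qed

section \<open>Theta graphs\<close>

text \<open>From \<open>c\<close> the branch \<open>D1\<close> leads through \<open>p1\<close> to
  one branch point without passing the other. There the circle formed by the other two branches is
  attached, which gives a lollipop.\<close>

lemma theta_off_branch:
  assumes D: "a \<noteq> b" "seg X a b D1" "seg X a b D2" "seg X a b D3"
      "D1 \<inter> D2 = {a, b}" "D1 \<inter> D3 = {a, b}" "D2 \<inter> D3 = {a, b}"
    and p: "p1 \<in> D1" "p2 \<in> D2" "p3 \<in> D3"
    and A: "seg X v c A" "A \<inter> (D1 \<union> D2 \<union> D3) = {c}" "c \<in> D1" "c \<noteq> a" "c \<noteq> b"
  shows "\<exists>w B. seg X v w B \<and> {p1, p2, p3} \<subseteq> B"
proof -
  have core: "\<exists>w B. seg X v w B \<and> {p1, p2, p3} \<subseteq> B"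
    if U: "seg X c y U" "U \<subseteq> D1" "p1 \<in> U" "{a, b} = {x, y}" "x \<notin> U" for x y U
  proof -
    have 1: "A \<inter> U = {c}" using A U seg_ends[OF U(1)] unfolding set_pointwise by (smt (verit))
    have c: "circle X (D2 \<union> D3)" by (rule circleI[OF D(1,3,4,7)])
    have "y \<in> U" "a \<in> D2" "b \<in> D2" using seg_ends[OF U(1)] seg_ends[OF D(3)] by auto
    then have "(A \<union> U) \<inter> (D2 \<union> D3) = {y}"
      using A U D unfolding set_pointwise by (smt (verit))
    then obtain w B where "seg X v w B" "{p1, p2, p3} \<subseteq> B"
      by (rule lollipop[OF hausdorff seg_join[OF A(1) U(1) 1] c, where P = "{p1, p2, p3}"]) (use p U in auto)
    then show ?thesis by blast
  qed
  obtain U V where S: "seg X a c U" "seg X c b V" "U \<union> V = D1" "U \<inter> V = {c}"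
    by (rule seg_split[OF D(2) A(3)])
  have e: "a \<in> U" "b \<in> V" using seg_ends[OF S(1)] seg_ends[OF S(2)] by auto
  show ?thesis
  proof (cases "p1 \<in> V")
    case True
    have "a \<notin> V" "V \<subseteq> D1" using S e A unfolding set_pointwise by (smt (verit))+
    then show ?thesis using core[OF S(2) _ True, of a] by blast
  next
    case False
    then have "p1 \<in> U" "b \<notin> U" "U \<subseteq> D1" using S e A p unfolding set_pointwise by (smt (verit))+
    then show ?thesis using core[OF seg_sym[OF S(1)], of b] by blast
  qed
qed

text \<open>The circle runs from \<open>a\<close> along \<open>D2\<close> to \<open>c2\<close>, over
  \<open>Q\<close> to \<open>c1\<close>, along \<open>D1\<close> to \<open>b\<close> and back along
  \<open>D3\<close>.\<close>

lemma theta_bridge_cross: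
  assumes D: "a \<noteq> b" "seg X a b D1" "seg X a b D2" "seg X a b D3"
      "D1 \<inter> D2 = {a, b}" "D1 \<inter> D3 = {a, b}" "D2 \<inter> D3 = {a, b}"
    and Q: "seg X c1 c2 Q" "Q \<inter> (D1 \<union> D2 \<union> D3) = {c1, c2}" "c1 \<in> D1 - {a, b}" "c2 \<in> D2 - {a, b}"
    and V: "seg X c1 b V" "V \<subseteq> D1" "a \<notin> V" and U: "seg X a c2 U" "U \<subseteq> D2" "b \<notin> U"
    and p: "p1 \<in> V" "p2 \<in> U" "p3 \<in> D3"
  shows "\<exists>E. circle X E \<and> {p1, p2, p3} \<subseteq> E"
proof -
  have e: "c1 \<in> V" "b \<in> V" "a \<in> U" "c2 \<in> U" "a \<in> D3" "b \<in> D3"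
    using seg_ends[OF V(1)] seg_ends[OF U(1)] seg_ends[OF D(4)] by auto
  have 1: "U \<inter> Q = {c2}" using Q U D e unfolding set_pointwise by (smt (verit))
  have 2: "(U \<union> Q) \<inter> V = {c1}" using Q U V D e unfolding set_pointwise by (smt (verit))
  have 3: "D3 \<inter> ((U \<union> Q) \<union> V) = {a, b}" using Q U V D e unfolding set_pointwise by (smt (verit))
  have "circle X (D3 \<union> ((U \<union> Q) \<union> V))"
    by (rule circleI[OF D(1,4) seg_join[OF seg_join[OF U(1) seg_sym[OF Q(1)] 1] V(1) 2] 3])
  then show ?thesis using p by blast
qed

text \<open>\<open>V1\<close>, \<open>V2\<close> and \<open>Q\<close> form a circle through
  \<open>p1\<close> and \<open>p2\<close>; the stick of the lollipop is \<open>A\<close> followed by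
  \<open>D3\<close>, which contains \<open>p3\<close>.\<close>

lemma theta_bridge_parallel:
  assumes D: "a \<noteq> b" "seg X a b D3"
    and Q: "seg X c1 c2 Q" "Q \<inter> D3 = {}"
    and V1: "seg X c1 b V1" "V1 \<inter> D3 = {b}" and V2: "seg X c2 b V2" "V2 \<inter> D3 = {b}"
    and i: "Q \<inter> V1 = {c1}" "Q \<inter> V2 = {c2}" "V1 \<inter> V2 = {b}" "c1 \<noteq> b"
    and A: "seg X v a A" "A \<inter> (D3 \<union> V1 \<union> V2 \<union> Q) = {a}"
    and p: "p1 \<in> V1" "p2 \<in> V2" "p3 \<in> D3"
  shows "\<exists>w B. seg X v w B \<and> {p1, p2, p3} \<subseteq> B"
proof -
  have e: "c1 \<in> V1" "b \<in> V1" "c1 \<in> Q" "b \<in> V2" "b \<in> D3" "a \<in> D3"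
    using seg_ends[OF V1(1)] seg_ends[OF V2(1)] seg_ends[OF Q(1)] seg_ends[OF D(2)] by auto
  have 1: "A \<inter> D3 = {a}" using A e unfolding set_pointwise by (smt (verit))
  have 2: "V1 \<inter> (Q \<union> V2) = {c1, b}" using i e unfolding set_pointwise by (smt (verit))
  have c: "circle X (V1 \<union> (Q \<union> V2))"
    by (rule circleI[OF i(4) V1(1) seg_join[OF Q(1) V2(1) i(2)] 2])
  have 3: "(A \<union> D3) \<inter> (V1 \<union> (Q \<union> V2)) = {b}" using A V1 V2 Q D e unfolding set_pointwise by (smt (verit))
  obtain w B where "seg X v w B" "{p1, p2, p3} \<subseteq> B"
    by (rule lollipop[OF hausdorff seg_join[OF A(1) D(2) 1] c 3, where P = "{p1, p2, p3}"]) (use p in auto)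
  then show ?thesis by blast
qed

text \<open>Each of \<open>c1\<close> and \<open>c2\<close> divides its branch. If \<open>p1\<close>
  and \<open>p2\<close> lie towards different branch points, there is a circle through all three
  points. If both lie towards the same branch point, the arc from \<open>v\<close> to the other
  branch point is used.\<close>

lemma theta_bridge:
  assumes D: "a \<noteq> b" "seg X a b D1" "seg X a b D2" "seg X a b D3"
      "D1 \<inter> D2 = {a, b}" "D1 \<inter> D3 = {a, b}" "D2 \<inter> D3 = {a, b}"
    and p: "p1 \<in> D1" "p2 \<in> D2" "p3 \<in> D3"
    and Q: "seg X c1 c2 Q" "Q \<inter> (D1 \<union> D2 \<union> D3) = {c1, c2}" "c1 \<in> D1 - {a, b}" "c2 \<in> D2 - {a, b}"
    and Aa: "seg X v a Aa" "Aa \<inter> (D1 \<union> D2 \<union> D3 \<union> Q) = {a}"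
    and Ab: "seg X v b Ab" "Ab \<inter> (D1 \<union> D2 \<union> D3 \<union> Q) = {b}"
  shows "\<exists>w B. seg X v w B \<and> {p1, p2, p3} \<subseteq> B"
proof -
  have c1: "c1 \<in> D1" and c2: "c2 \<in> D2" using Q by auto
  obtain U1 V1 where S1: "seg X a c1 U1" "seg X c1 b V1" "U1 \<union> V1 = D1" "U1 \<inter> V1 = {c1}"
    by (rule seg_split[OF D(2) c1])
  obtain U2 V2 where S2: "seg X a c2 U2" "seg X c2 b V2" "U2 \<union> V2 = D2" "U2 \<inter> V2 = {c2}"
    by (rule seg_split[OF D(3) c2])
  have e: "a \<in> U1" "a \<in> U2" "b \<in> V1" "b \<in> V2" "c1 \<in> U1" "c1 \<in> V1" "c2 \<in> U2" "c2 \<in> V2" "a \<in> D3" "b \<in> D3"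
    "c1 \<in> Q" "c2 \<in> Q"
    using seg_ends[OF S1(1)] seg_ends[OF S1(2)] seg_ends[OF S2(1)] seg_ends[OF S2(2)] seg_ends[OF D(4)]
      seg_ends[OF Q(1)] by auto
  have n: "a \<notin> V1" "a \<notin> V2" "b \<notin> U1" "b \<notin> U2" using S1 S2 e Q unfolding set_pointwise by (smt (verit))+
  have sub: "U1 \<subseteq> D1" "V1 \<subseteq> D1" "U2 \<subseteq> D2" "V2 \<subseteq> D2" using S1 S2 unfolding set_pointwise by (smt (verit))+
  have v: "v \<in> topspace X" using seg_subset[OF Aa(1)] seg_ends[OF Aa(1)] unfolding set_pointwise by (smt (verit))
  have circ: "\<exists>w B. seg X v w B \<and> {p1, p2, p3} \<subseteq> B" if "circle X E" "{p1, p2, p3} \<subseteq> E" for E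
    using arc_to_circle[OF that(1) _ that(2) v] by (metis finite.emptyI finite_insert)
  consider "p1 \<in> V1" "p2 \<in> U2" | "p1 \<in> U1" "p2 \<in> V2" | "p1 \<in> V1" "p2 \<in> V2" | "p1 \<in> U1" "p2 \<in> U2"
    using p S1 S2 unfolding set_pointwise by (smt (verit))
  then show ?thesis
  proof cases
    case 1
    from theta_bridge_cross[OF D Q S1(2) sub(2) n(1) S2(1) sub(3) n(4) 1 p(3)] circ show ?thesis by blast
  next
    case 2
    have D': "D2 \<inter> D1 = {a, b}" "Q \<inter> (D2 \<union> D1 \<union> D3) = {c2, c1}" using D Q unfolding set_pointwise by (smt (verit))+
    from theta_bridge_cross[OF D(1,3,2,4) D'(1) D(7,6) seg_sym[OF Q(1)] D'(2) Q(4,3) S2(2) sub(4) n(2)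
        S1(1) sub(1) n(3) 2(2,1) p(3)] circ
    show ?thesis by (metis insert_commute)
  next
    case 3
    show ?thesis
    proof (rule theta_bridge_parallel[OF D(1,4) Q(1) _ S1(2) _ S2(2) _ _ _ _ _ Aa(1) _ 3 p(3)])
      show "Q \<inter> D3 = {}" using Q D unfolding set_pointwise by (smt (verit))
      show "V1 \<inter> D3 = {b}" "V2 \<inter> D3 = {b}" "V1 \<inter> V2 = {b}" using D n sub e unfolding set_pointwise by (smt (verit))+
      show "Q \<inter> V1 = {c1}" "Q \<inter> V2 = {c2}" "c1 \<noteq> b" using Q D sub e unfolding set_pointwise by (smt (verit))+
      show "Aa \<inter> (D3 \<union> V1 \<union> V2 \<union> Q) = {a}" using Aa sub e unfolding set_pointwise by (smt (verit))
    qed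
  next
    case 4
    show ?thesis
    proof (rule theta_bridge_parallel[OF D(1)[symmetric] seg_sym[OF D(4)] Q(1) _ seg_sym[OF S1(1)] _
          seg_sym[OF S2(1)] _ _ _ _ _ Ab(1) _ 4 p(3)])
      show "Q \<inter> D3 = {}" using Q D unfolding set_pointwise by (smt (verit))
      show "U1 \<inter> D3 = {a}" "U2 \<inter> D3 = {a}" "U1 \<inter> U2 = {a}" using D n sub e unfolding set_pointwise by (smt (verit))+
      show "Q \<inter> U1 = {c1}" "Q \<inter> U2 = {c2}" "c1 \<noteq> a" using Q D sub e unfolding set_pointwise by (smt (verit))+
      show "Ab \<inter> (D3 \<union> U1 \<union> U2 \<union> Q) = {b}" using Ab sub e unfolding set_pointwise by (smt (verit))
    qed
  qed
qed

lemma seg_meets_gate: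
  assumes K: "closedin X K" and gate: "\<And>c A. seg X v c A \<Longrightarrow> A \<inter> K = {c} \<Longrightarrow> c \<in> F"
    and q: "seg X v q C" "q \<in> K"
  shows "C \<inter> F \<noteq> {}"
proof -
  have "C \<inter> K \<noteq> {}" using q seg_ends(2)[OF q(1)] by blast
  then obtain c A1 A2 where A: "seg X v c A1" "seg X c q A2" "A1 \<union> A2 = C" "A1 \<inter> A2 = {c}" "A1 \<inter> K = {c}"
    by (rule seg_first_hit[OF q(1) K])
  show ?thesis using gate[OF A(1,5)] A(3) seg_ends(2)[OF A(1)] by blast
qed

text \<open>The arc \<open>B\<close> yields a bridge between \<open>D1\<close> and another branch.
  To apply \<open>theta_bridge\<close>, arcs from \<open>v\<close> to \<open>a\<close> and to
  \<open>b\<close> are needed that miss this bridge.\<close>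

lemma theta_connected_branches:
  assumes D: "a \<noteq> b" "seg X a b D1" "seg X a b D2" "seg X a b D3"
      "D1 \<inter> D2 = {a, b}" "D1 \<inter> D3 = {a, b}" "D2 \<inter> D3 = {a, b}"
    and p: "p1 \<in> D1" "p2 \<in> D2" "p3 \<in> D3"
    and v: "v \<in> topspace X" "v \<notin> D1 \<union> D2 \<union> D3"
    and ab: "\<And>c A. seg X v c A \<Longrightarrow> A \<inter> (D1 \<union> D2 \<union> D3) = {c} \<Longrightarrow> c \<in> {a, b}"
    and B: "seg X p1 p2 B" "a \<notin> B" "b \<notin> B"
  shows "\<exists>w B. seg X v w B \<and> {p1, p2, p3} \<subseteq> B"
proof -
  let ?T = "D1 \<union> D2 \<union> D3"
  have cl: "closedin X D1" "closedin X D2" "closedin X D3" using D(2-4) seg_closed[OF hausdorff] by auto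
  then have T: "closedin X ?T" "closedin X (D2 \<union> D3)" by blast+
  have sep: False if q: "seg X v q C" "q \<in> ?T" "a \<notin> C" "b \<notin> C" for q C
  proof -
    have "C \<inter> {a, b} \<noteq> {}" by (rule seg_meets_gate[OF T(1) _ q(1,2)]) (rule ab)
    then show False using q(3,4) by blast
  qed
  \<comment> \<open>\<open>B\<close> is cut down to a bridge \<open>Q\<close>: it is followed from
    \<open>p1\<close> to its first point on \<open>D2\<close> or \<open>D3\<close>, and from there
    backwards to the first point on \<open>D1\<close>.\<close>
  have "B \<inter> (D2 \<union> D3) \<noteq> {}" using p seg_ends[OF B(1)] unfolding set_pointwise by (smt (verit))
  then obtain c2 B1 B2 where B1: "seg X p1 c2 B1" "seg X c2 p2 B2" "B1 \<union> B2 = B" "B1 \<inter> B2 = {c2}" "B1 \<inter> (D2 \<union> D3) = {c2}"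
    by (rule seg_first_hit[OF B(1) T(2)])
  have "B1 \<inter> D1 \<noteq> {}" using p seg_ends[OF B1(1)] unfolding set_pointwise by (smt (verit))
  then obtain c1 Q B4 where Q: "seg X c2 c1 Q" "seg X c1 p1 B4" "Q \<union> B4 = B1" "Q \<inter> B4 = {c1}" "Q \<inter> D1 = {c1}"
    by (rule seg_first_hit[OF seg_sym[OF B1(1)] cl(1)])
  have e: "c2 \<in> Q" "c1 \<in> Q" "a \<in> D1" "b \<in> D1" using seg_ends[OF Q(1)] seg_ends[OF D(2)] by auto
  have Qab: "a \<notin> Q" "b \<notin> Q" using B B1 Q unfolding set_pointwise by (smt (verit))+
  have QT: "Q \<inter> ?T = {c1, c2}" using B1 Q e unfolding set_pointwise by (smt (verit))
  have c1: "c1 \<in> D1 - {a, b}" and c2: "c2 \<in> (D2 \<union> D3) - {a, b}" using Qab e Q B1 unfolding set_pointwise by (smt (verit))+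
  \<comment> \<open>From \<open>v\<close> the theta graph is accessible only through
    \<open>a\<close> and \<open>b\<close>, so an arc that avoids \<open>x\<close> arrives at
    \<open>y\<close>. If it met \<open>Q\<close>, turning into \<open>Q\<close> would lead to
    \<open>c1\<close> past neither \<open>a\<close> nor \<open>b\<close>.\<close>
  have stem: "\<exists>A. seg X v y A \<and> A \<inter> (?T \<union> Q) = {y}" if xy: "{a, b} = {x, y}" for x y
  proof -
    have xy': "y \<in> ?T" "y \<noteq> x" "v \<noteq> x" using xy e v D unfolding set_pointwise by (smt (verit))+
    obtain z A where A: "seg X v z A" "x \<notin> A" "A \<inter> ?T = {z}"
      by (rule arc_to[OF T(1) xy'(1,2) v(1) xy'(3)])
    have "z \<noteq> x" using A seg_ends[OF A(1)] unfolding set_pointwise by (smt (verit))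
    then have z: "z = y" using ab[OF A(1,3)] xy unfolding set_pointwise by (smt (verit))
    have "A \<inter> Q = {}"
    proof (rule ccontr)
      assume "A \<inter> Q \<noteq> {}"
      then obtain q where q: "q \<in> A" "q \<in> Q" by blast
      obtain F G where F: "seg X v q F" "seg X q z G" "F \<union> G = A" "F \<inter> G = {q}"
        by (rule seg_split[OF A(1) q(1)])
      have "y \<noteq> q" "y \<in> G" using q Qab xy z seg_ends[OF F(2)] unfolding set_pointwise by (smt (verit))+
      then have Fab: "a \<notin> F" "b \<notin> F" using F A xy unfolding set_pointwise by (smt (verit))+
      obtain H I where H: "seg X c2 q H" "seg X q c1 I" "H \<union> I = Q" "H \<inter> I = {q}"
        by (rule seg_split[OF Q(1) q(2)])
      obtain C where C: "seg X v c1 C" "C \<subseteq> F \<union> I" by (rule seg_trans[OF hausdorff F(1) H(2)])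
      have "a \<notin> C" "b \<notin> C" using C Fab H Qab unfolding set_pointwise by (smt (verit))+
      then show False using sep[OF C(1)] c1 unfolding set_pointwise by (smt (verit))
    qed
    then show ?thesis using A z by blast
  qed
  obtain Aa where Aa: "seg X v a Aa" "Aa \<inter> (?T \<union> Q) = {a}" using stem[of b a] unfolding set_pointwise by (smt (verit))
  obtain Ab where Ab: "seg X v b Ab" "Ab \<inter> (?T \<union> Q) = {b}" using stem[of a b] unfolding set_pointwise by (smt (verit))
  show ?thesis
  proof (cases "c2 \<in> D2")
    case True
    then have "c2 \<in> D2 - {a, b}" using c2 unfolding set_pointwise by (smt (verit))
    from theta_bridge[OF D p seg_sym[OF Q(1)] QT c1 this Aa Ab] show ?thesis .
  next
    \<comment> \<open>\<open>B\<close> may reach \<open>D3\<close> before \<open>D2\<close>. Then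
      the bridge joins \<open>D1\<close> to \<open>D3\<close>, and these two branches take the roles
      in \<open>theta_bridge\<close>.\<close>
    case False
    then have c2: "c2 \<in> D3 - {a, b}" using c2 unfolding set_pointwise by (smt (verit))
    have r: "D3 \<inter> D2 = {a, b}" "D1 \<union> D3 \<union> D2 = ?T" using D unfolding set_pointwise by (smt (verit))+
    have "\<exists>w B. seg X v w B \<and> {p1, p3, p2} \<subseteq> B"
      by (rule theta_bridge[OF D(1,2,4,3,6,5) r(1) p(1,3,2) seg_sym[OF Q(1)] _ c1 c2 Aa(1) _ Ab(1)])
        (simp_all only: r(2) QT Aa(2) Ab(2))
    then show ?thesis by (simp add: insert_commute)
  qed
qed

text \<open>\<open>triod\<close> says that \<open>v\<close> is not a branch point of a theta graph.
  The theta graph of the proof is a circle through \<open>p1\<close> and \<open>p2\<close> together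
  with an ear through \<open>p3\<close>; symmetric cases are obtained by permuting its
  branches.\<close>

lemma arc_from_point:
  assumes top: "v \<in> topspace X" "p1 \<in> topspace X" "p2 \<in> topspace X" "p3 \<in> topspace X"
    and dist: "distinct [v, p1, p2, p3]"
    and A: "seg X s t A" "{v, p1, p2, p3} \<subseteq> A"
    and triod: "\<And>w T1 T2 T3. v \<noteq> w \<Longrightarrow> seg X v w T1 \<Longrightarrow> seg X v w T2 \<Longrightarrow> seg X v w T3 \<Longrightarrow>
      \<not> (T1 \<inter> T2 = {v, w} \<and> T1 \<inter> T3 = {v, w} \<and> T2 \<inter> T3 = {v, w})"
  obtains w B where "seg X v w B" "{p1, p2, p3} \<subseteq> B"
proof (rule ccontr)
  assume "\<not> thesis"
  then have bad: "\<not> (\<exists>w B. seg X v w B \<and> {p1, p2, p3} \<subseteq> B)" using that by blast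
  have circ: False if "circle X E" "p1 \<in> E" "p2 \<in> E" "p3 \<in> E" for E
    using arc_to_circle[OF that(1), of "{p1, p2, p3}" v] that bad top by (metis empty_subsetI finite.emptyI finite_insert insert_subset)
  obtain E where E: "circle X E" "p1 \<in> E" "p2 \<in> E"
    by (rule circle_through_two[OF top(2,3)]) (use dist in auto)
  have p3: "p3 \<notin> E" using circ E unfolding set_pointwise by (smt (verit))
  have "p1 \<noteq> p2" using dist by simp
  then obtain a b D3 where D3: "a \<noteq> b" "seg X a b D3" "D3 \<inter> E = {a, b}" "p3 \<in> D3"
    by (rule ear[OF circle_closed[OF hausdorff E(1)] E(2,3) _ top(4) p3])
  have abE: "a \<in> E" "b \<in> E" using D3 unfolding set_pointwise by (smt (verit))+
  obtain F1 F2 where F: "seg X a b F1" "seg X a b F2" "F1 \<inter> F2 = {a, b}" "E = F1 \<union> F2"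
    by (rule circle_split[OF E(1) abE D3(1)])
  \<comment> \<open>Otherwise the part of \<open>E\<close> with both points closes up with
    \<open>D3\<close> to a circle through all three.\<close>
  have one: "\<not> (p1 \<in> F \<and> p2 \<in> F)" if "F = F1 \<or> F = F2" for F
  proof
    assume p: "p1 \<in> F \<and> p2 \<in> F"
    have 1: "seg X a b F" using that F by blast
    have "a \<in> F" "b \<in> F" "F \<subseteq> E" using seg_ends[OF 1] that F(4) by auto
    then have "F \<inter> D3 = {a, b}" using D3(3) unfolding set_pointwise by (smt (verit))
    from circleI[OF D3(1) 1 D3(2) this] have "circle X (F \<union> D3)" .
    from circ[OF this] show False using p D3(4) by blast
  qed
  have pF: "p1 \<in> F1 - F2 \<and> p2 \<in> F2 - F1 \<or> p1 \<in> F2 - F1 \<and> p2 \<in> F1 - F2"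
    using one[of F1] one[of F2] E(2,3) F(4) by blast
  have abF: "a \<in> F1 \<inter> F2" "b \<in> F1 \<inter> F2" using F(3) by auto
  obtain D1 D2 where D': "seg X a b D1" "seg X a b D2" "D1 \<inter> D2 = {a, b}" "E = D1 \<union> D2"
    and p: "p1 \<in> D1 - {a, b}" "p2 \<in> D2 - {a, b}"
  proof (cases "p1 \<in> F1")
    case True
    show ?thesis by (rule that[OF F]) (use True pF abF in blast)+
  next
    case False
    have r: "F2 \<inter> F1 = {a, b}" "E = F2 \<union> F1" using F(3,4) by blast+
    show ?thesis by (rule that[OF F(2,1) r]) (use False pF abF in blast)+
  qed
  have ab: "a \<in> D1" "b \<in> D1" "a \<in> D2" "b \<in> D2" using seg_ends[OF D'(1)] seg_ends[OF D'(2)] by auto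
  have D: "a \<noteq> b" "seg X a b D1" "seg X a b D2" "seg X a b D3"
      "D1 \<inter> D2 = {a, b}" "D1 \<inter> D3 = {a, b}" "D2 \<inter> D3 = {a, b}"
    using D' D3 ab unfolding set_pointwise by (smt (verit))+
  have p3': "p3 \<in> D3 - {a, b}" using D3 p3 abE unfolding set_pointwise by (smt (verit))
  let ?T = "D1 \<union> D2 \<union> D3"
  have r: "D2 \<inter> D1 = {a, b}" "D3 \<inter> D1 = {a, b}" "D3 \<inter> D2 = {a, b}"
    "D1 \<union> D3 \<union> D2 = ?T" "D2 \<union> D3 \<union> D1 = ?T" "D2 \<union> D1 \<union> D3 = ?T" "D3 \<union> D1 \<union> D2 = ?T" using D unfolding set_pointwise by (smt (verit))+
  have q: "p1 \<in> D1" "p2 \<in> D2" "p3 \<in> D3" using p p3' by auto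
  have perm: "{p2, p1, p3} = {p1, p2, p3}" "{p3, p1, p2} = {p1, p2, p3}"
    "{p1, p3, p2} = {p1, p2, p3}" "{p2, p3, p1} = {p1, p2, p3}" by auto
  have only_ab: "c \<in> {a, b}" if A: "seg X v c A" "A \<inter> ?T = {c}" for c A
  proof (rule ccontr)
    assume c: "c \<notin> {a, b}"
    then have cab: "c \<noteq> a" "c \<noteq> b" by auto
    consider "c \<in> D1" | "c \<in> D2" | "c \<in> D3" using A unfolding set_pointwise by (smt (verit))
    then show False
    proof cases
      case 1
      show False using theta_off_branch[OF D q A 1 cab] bad by blast
    next
      case 2
      have "\<exists>w B. seg X v w B \<and> {p2, p1, p3} \<subseteq> B"
        by (rule theta_off_branch[OF D(1,3,2,4) r(1) D(7,6) q(2,1,3) A(1) _ 2 cab]) (simp only: r A)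
      then show False using bad unfolding perm by blast
    next
      case 3
      have "\<exists>w B. seg X v w B \<and> {p3, p1, p2} \<subseteq> B"
        by (rule theta_off_branch[OF D(1,4,2,3) r(2,3) D(5) q(3,1,2) A(1) _ 3 cab]) (simp only: r A)
      then show False using bad unfolding perm by blast
    qed
  qed
  \<comment> \<open>If \<open>v\<close> were on the theta graph, \<open>only_ab\<close> applied to
    the one-point arc at \<open>v\<close> would make it a branch point, contrary to
    \<open>triod\<close>.\<close>
  have vT: "v \<notin> ?T"
  proof
    assume "v \<in> ?T"
    then have "{v} \<inter> ?T = {v}" by blast
    then have "v \<in> {a, b}" using only_ab[OF seg_refl[OF top(1)]] unfolding set_pointwise by (smt (verit))
    then consider "v = a" | "v = b" by blast
    then show False
    proof cases
      case 1
      show False using triod[of b D1 D2 D3] D unfolding 1 by blast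
    next
      case 2
      show False using triod[of a D1 D2 D3] D seg_sym[OF D(2)] seg_sym[OF D(3)] seg_sym[OF D(4)]
        unfolding 2 insert_commute[of b a] by blast
    qed
  qed
  \<comment> \<open>No two of the four points are joined off \<open>{a, b}\<close>: if one of them
    is \<open>v\<close> this contradicts \<open>only_ab\<close>, and two of the others would give
    the desired arc. The pigeonhole principle then finishes the proof.\<close>
  have *: False if xy: "x \<in> {v, p1, p2, p3}" "y \<in> {v, p1, p2, p3}" "x \<noteq> y" "seg X x y B" "B \<subseteq> A - {a, b}" for x y B
  proof -
    have cl: "closedin X ?T" using D(2-4) seg_closed[OF hausdorff] by blast
    have sep: False if q: "seg X v q C" "q \<in> ?T" "a \<notin> C" "b \<notin> C" for q C
    proof -
      have "C \<inter> {a, b} \<noteq> {}" by (rule seg_meets_gate[OF cl _ q(1,2)]) (rule only_ab)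
      then show False using q(3,4) by blast
    qed
    have B: "a \<notin> B" "b \<notin> B" using xy by auto
    have Bs: "seg X y x B" using seg_sym[OF xy(4)] .
    have 12: False if C: "seg X p1 p2 C" "a \<notin> C" "b \<notin> C" for C
    proof -
      have "\<exists>w B. seg X v w B \<and> {p1, p2, p3} \<subseteq> B"
        by (rule theta_connected_branches[OF D q top(1) vT _ C]) (rule only_ab)
      then show False using bad by blast
    qed
    have 13: False if C: "seg X p1 p3 C" "a \<notin> C" "b \<notin> C" for C
    proof -
      have "\<exists>w B. seg X v w B \<and> {p1, p3, p2} \<subseteq> B"
        by (rule theta_connected_branches[OF D(1,2,4,3,6,5) r(3) q(1,3,2) top(1) _ _ C, unfolded r(4), OF vT]) (rule only_ab)
      then show False using bad unfolding perm by blast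
    qed
    have 23: False if C: "seg X p2 p3 C" "a \<notin> C" "b \<notin> C" for C
    proof -
      have "\<exists>w B. seg X v w B \<and> {p2, p3, p1} \<subseteq> B"
        by (rule theta_connected_branches[OF D(1,3,4,2,7) r(1,2) q(2,3,1) top(1) _ _ C, unfolded r(5), OF vT]) (rule only_ab)
      then show False using bad unfolding perm by blast
    qed
    have x: "x \<noteq> v" using sep[of y B] xy B q unfolding set_pointwise by (smt (verit))
    have y: "y \<noteq> v" using sep[of x B] Bs xy B q unfolding set_pointwise by (smt (verit))
    consider "x = p1" "y = p2" | "x = p2" "y = p1" | "x = p1" "y = p3" | "x = p3" "y = p1"
      | "x = p2" "y = p3" | "x = p3" "y = p2" using xy x y unfolding set_pointwise by (smt (verit))
    then show False using xy(4) Bs B by cases (blast intro: 12 13 23)+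
  qed
  have "{v, p1, p2, p3} \<subseteq> A - {a, b}" using A vT ab p p3' unfolding set_pointwise by (smt (verit))
  moreover have "card {v, p1, p2, p3} = 4" using dist by simp
  ultimately show False by (rule seg_pigeonhole[OF A(1)]) (rule *)
qed

end

section \<open>A concrete model of the 1-complex\<close>

text \<open>Points are written in normal form: \<open>Inl v\<close> is a vertex and
  \<open>Inr (e, t)\<close> with 0 < t < 1 an inner point of an edge. The parameters 0 and 1
  therefore return the vertices glued there.\<close>

definition edge_pt :: "'a set \<Rightarrow> real \<Rightarrow> 'a + 'a set \<times> real" where
  "edge_pt e t = (if t = 0 then Inl (tail e) else if t = 1 then Inl (head e) else Inr (e, t))"

definition collapse :: "('a + 'a set) \<times> real \<Rightarrow> 'a + 'a set \<times> real" where
  "collapse x = (case fst x of Inl v \<Rightarrow> Inl v | Inr e \<Rightarrow> edge_pt e (snd x))"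

text \<open>A quotient of the same cell sum as the 1-complex, but with normal forms instead of
  equivalence classes as points.\<close>

definition realization :: "'a ugraph \<Rightarrow> ('a + 'a set \<times> real) topology" where
  "realization G = quotient_topology (cell_sum G) collapse"

lemma edge_pt_simps [simp]: "edge_pt e 0 = Inl (tail e)" "edge_pt e 1 = Inl (head e)"
  by (auto simp: edge_pt_def)

lemma edge_pt_interior: "0 < t \<Longrightarrow> t < 1 \<Longrightarrow> edge_pt e t = Inr (e, t)"
  by (auto simp: edge_pt_def)

lemma collapse_simps [simp]: "collapse (Inl v, t) = Inl v" "collapse (Inr e, t) = edge_pt e t"
  by (auto simp: collapse_def)

lemma topspace_cell_sum: "topspace (cell_sum G) = (Inl ` verts G) \<times> {0} \<union> (Inr ` edges G) \<times> {0..1}"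
proof (rule set_eqI)
  fix x :: "('a + 'a set) \<times> real"
  obtain i t where [simp]: "x = (i, t)" by (cases x)
  then show "x \<in> topspace (cell_sum G) \<longleftrightarrow> x \<in> (Inl ` verts G) \<times> {0} \<union> (Inr ` edges G) \<times> {0..1}"
    unfolding cell_sum_def topspace_sum_topology
    by (cases i) (simp_all add: image_iff Plus_def)
qed

text \<open>The one-point summands impose no condition, so openness is tested on the edges
  alone.\<close>

lemma openin_cell_sum:
  "openin (cell_sum G) U \<longleftrightarrow> U \<subseteq> topspace (cell_sum G) \<and>
    (\<forall>e\<in>edges G. openin (top_of_set {0..1}) {t \<in> {0..1}. (Inr e, t) \<in> U})"
proof -
  have 1: "{x. (Inl v, x) \<in> U} = {} \<or> {x. (Inl v, x) \<in> U} = {0}" if "U \<subseteq> topspace (cell_sum G)" for v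
    using that unfolding topspace_cell_sum by auto
  have 2: "{x. (Inr e, x) \<in> U} = {t \<in> {0..1}. (Inr e, t) \<in> U}" if "U \<subseteq> topspace (cell_sum G)" for e
    using that unfolding topspace_cell_sum by auto
  have 3: "openin (top_of_set {0::real}) {x. (Inl v, x) \<in> U}" if "U \<subseteq> topspace (cell_sum G)" for v
    using 1[OF that, of v] by (elim disjE) (simp_all only: openin_empty openin_subtopology_self)
  have "openin (cell_sum G) U \<longleftrightarrow> U \<subseteq> topspace (cell_sum G) \<and>
    (\<forall>i\<in>verts G <+> edges G. openin (case_sum (\<lambda>v. top_of_set {0}) (\<lambda>e. top_of_set {0..1}) i) {x. (i, x) \<in> U})"
    unfolding cell_sum_def openin_sum_topology topspace_sum_topology ..
  also have "\<dots> \<longleftrightarrow> U \<subseteq> topspace (cell_sum G) \<and>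
    (\<forall>e\<in>edges G. openin (top_of_set {0..1}) {t \<in> {0..1}. (Inr e, t) \<in> U})"
  proof -
    have "(\<forall>i\<in>verts G <+> edges G. Q i) \<longleftrightarrow> (\<forall>v\<in>verts G. Q (Inl v)) \<and> (\<forall>e\<in>edges G. Q (Inr e))" for Q
      by (auto simp: Plus_def)
    then show ?thesis using 2 3 by (simp cong: conj_cong)
  qed
  finally show ?thesis .
qed

lemma topspace_realization:
  assumes "graph G"
  shows "topspace (realization G) = Inl ` verts G \<union> Inr ` (edges G \<times> {0<..<1})"
proof -
  have "edge_pt e t \<in> Inl ` verts G \<union> Inr ` (edges G \<times> {0<..<1})" if "e \<in> edges G" "t \<in> {0..1}" for e t
    using that tail_head[OF assms that(1)] by (auto simp: edge_pt_def)
  moreover have "Inr (e, t) \<in> collapse ` topspace (cell_sum G)" if "e \<in> edges G" "t \<in> {0<..<1}" for e t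
    using that by (intro image_eqI[of _ _ "(Inr e, t)"]) (auto simp: edge_pt_interior topspace_cell_sum)
  moreover have "Inl v \<in> collapse ` topspace (cell_sum G)" if "v \<in> verts G" for v
    using that by (intro image_eqI[of _ _ "(Inl v, 0)"]) (auto simp: topspace_cell_sum)
  ultimately show ?thesis
    unfolding realization_def topspace_quotient_topology
  proof (intro equalityI subsetI, goal_cases)
    case (1 p)
    then obtain i t where "(i, t) \<in> topspace (cell_sum G)" "p = collapse (i, t)" by auto
    then show ?case using 1 by (cases i) (auto simp: topspace_cell_sum)
  next
    case (2 p)
    then show ?case by blast
  qed
qed

lemma edge_pt_in_topspace:
  "graph G \<Longrightarrow> e \<in> edges G \<Longrightarrow> t \<in> {0..1} \<Longrightarrow> edge_pt e t \<in> topspace (realization G)"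
  using tail_head[of G e] by (auto simp: topspace_realization edge_pt_def)

text \<open>The edges are tested independently of each other, so vertices of infinite degree need no
  special care.\<close>

lemma openin_realization:
  assumes "graph G"
  shows "openin (realization G) U \<longleftrightarrow> U \<subseteq> topspace (realization G) \<and>
    (\<forall>e\<in>edges G. openin (top_of_set {0..1}) {t \<in> {0..1}. edge_pt e t \<in> U})"
proof -
  have "{t \<in> {0..1}. (Inr e, t) \<in> {x \<in> topspace (cell_sum G). collapse x \<in> U}} =
    {t \<in> {0..1}. edge_pt e t \<in> U}" if "e \<in> edges G" for e
    using that by (auto simp: topspace_cell_sum)
  then show ?thesis
    unfolding realization_def openin_quotient_topology topspace_quotient_topology openin_cell_sum by auto
qed

lemma closedin_realization:
  assumes "graph G"
  shows "closedin (realization G) C \<longleftrightarrow> C \<subseteq> topspace (realization G) \<and>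
    (\<forall>e\<in>edges G. closed {t \<in> {0..1}. edge_pt e t \<in> C})"
proof -
  have "{t \<in> {0..1}. edge_pt e t \<in> topspace (realization G) - C} = {0..1} - {t \<in> {0..1}. edge_pt e t \<in> C}"
    if "e \<in> edges G" for e
    using that assms edge_pt_in_topspace by blast
  moreover have "openin (top_of_set {0..1}) ({0..1} - S) \<longleftrightarrow> closed S" if "S \<subseteq> {0..1}" for S :: "real set"
    using that by (metis closed_atLeastAtMost closedin_closed_eq closedin_def topspace_euclidean_subtopology)
  ultimately have "openin (top_of_set {0..1}) {t \<in> {0..1}. edge_pt e t \<in> topspace (realization G) - C} \<longleftrightarrow>
      closed {t \<in> {0..1}. edge_pt e t \<in> C}" if "e \<in> edges G" for e
    using that by (metis (no_types, lifting) mem_Collect_eq subsetI)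
  then show ?thesis
    unfolding closedin_def openin_realization[OF assms] by blast
qed

lemma continuous_map_realization_real:
  assumes G: "graph G" and f: "\<And>e. e \<in> edges G \<Longrightarrow> continuous_on {0..1} (\<lambda>t. f (edge_pt e t) :: real)"
  shows "continuous_map (realization G) euclideanreal f"
  unfolding continuous_map_def openin_realization[OF G]
proof (intro conjI allI impI ballI)
  fix U :: "real set" and e assume U: "openin euclideanreal U" and e: "e \<in> edges G"
  have "{t \<in> {0..1}. edge_pt e t \<in> {x \<in> topspace (realization G). f x \<in> U}} = {0..1} \<inter> (\<lambda>t. f (edge_pt e t)) -` U"
    using edge_pt_in_topspace[OF G e] by auto
  also have "openin (top_of_set {0..1}) \<dots>"
    using continuous_openin_preimage_gen[OF f[OF e]] U by auto
  finally show "openin (top_of_set {0..1}) {t \<in> {0..1}. edge_pt e t \<in> {x \<in> topspace (realization G). f x \<in> U}}" .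
qed auto

lemma continuous_map_edge_pt:
  assumes G: "graph G" and e: "e \<in> edges G"
  shows "continuous_map (top_of_set {0..1}) (realization G) (edge_pt e)"
  unfolding continuous_map_def using edge_pt_in_topspace[OF G e] e
  by (auto simp: openin_realization[OF G])

lemma inj_on_edge_pt: "graph G \<Longrightarrow> e \<in> edges G \<Longrightarrow> inj_on (edge_pt e) {0..1}"
  using tail_head[of G e] by (auto simp: inj_on_def edge_pt_def)

text \<open>The witness is a tent on the edge, respectively on the star, of the point.\<close>

lemma realization_peak:
  fixes G :: "'a ugraph"
  assumes G: "graph G" and x: "x \<in> topspace (realization G)"
  shows "\<exists>f. continuous_map (realization G) euclideanreal f \<and> f x = 1 \<and>
    (\<forall>y \<in> topspace (realization G) - {x}. f y < 1)"
proof -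
  consider v where "v \<in> verts G" "x = Inl v" | e t where "e \<in> edges G" "0 < t" "t < 1" "x = Inr (e, t)"
    using x unfolding topspace_realization[OF G] by auto
  then show ?thesis
  proof cases
    case 1
    define f :: "'a + 'a set \<times> real \<Rightarrow> real" where "f = (\<lambda>y. case y of Inl u \<Rightarrow> (if u = v then 1 else 0)
      | Inr (e, t) \<Rightarrow> (if v = tail e then 1 - t else if v = head e then t else 0 :: real))"
    show ?thesis
    proof (intro exI conjI ballI)
      show "continuous_map (realization G) euclideanreal f"
      proof (rule continuous_map_realization_real[OF G])
        fix e assume e: "e \<in> edges G"
        have "f (edge_pt e t) = (if v = tail e then 1 - t else if v = head e then t else 0)" for t
          using tail_head(2)[OF G e] by (auto simp: f_def edge_pt_def)
        then show "continuous_on {0..1} (\<lambda>t. f (edge_pt e t))"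
          by (cases "v = tail e"; cases "v = head e") (auto intro!: continuous_intros)
      qed
    qed (use 1 in \<open>auto simp: f_def topspace_realization[OF G] split: if_splits\<close>)
  next
    case 2
    \<comment> \<open>The width is chosen so that the tent has come down to 0 at both ends of the
      edge and extends by 0 to the rest of the complex.\<close>
    define d where "d = min t (1 - t)"
    have d: "0 < d" "d \<le> t" "d \<le> 1 - t" using 2 by (auto simp: d_def)
    define f :: "'a + 'a set \<times> real \<Rightarrow> real" where "f = (\<lambda>y. case y of Inl u \<Rightarrow> 0
      | Inr (e', s) \<Rightarrow> (if e' = e then max 0 (1 - \<bar>s - t\<bar> / d) else 0 :: real))"
    show ?thesis
    proof (intro exI conjI ballI)
      show "continuous_map (realization G) euclideanreal f"
      proof (rule continuous_map_realization_real[OF G])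
        fix e'
        have 1: "f (edge_pt e' s) = (if e' = e then max 0 (1 - \<bar>s - t\<bar> / d) else 0)" if "s \<in> {0..1}" for s
          using d 2 by (auto simp: f_def edge_pt_def max_def field_simps)
        have "continuous_on {0..1} (\<lambda>s. if e' = e then max 0 (1 - \<bar>s - t\<bar> / d) else 0 :: real)"
          using d by (cases "e' = e") (auto intro!: continuous_intros)
        then show "continuous_on {0..1} (\<lambda>t. f (edge_pt e' t))"
          by (rule continuous_on_eq) (simp add: 1)
      qed
      fix y assume "y \<in> topspace (realization G) - {x}"
      then show "f y < 1" using d 2 
        by (auto simp: f_def topspace_realization[OF G] max_def field_simps split: if_splits)
    qed (use 2 d in \<open>auto simp: f_def\<close>)
  qed
qed

text \<open>The function from \<open>realization_peak\<close> has the value 1 at \<open>x\<close>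
  only, so the preimages of the half-lines above and below the mean of 1 and \<open>f y\<close>
  separate the points.\<close>

lemma Hausdorff_realization:
  assumes G: "graph G" shows "Hausdorff_space (realization G)"
  unfolding Hausdorff_space_def
proof (intro allI impI, elim conjE)
  fix x y assume x: "x \<in> topspace (realization G)" and y: "y \<in> topspace (realization G)" "x \<noteq> y"
  obtain f where f: "continuous_map (realization G) euclideanreal f" "f x = 1"
    "\<forall>y \<in> topspace (realization G) - {x}. f y < 1"
    using realization_peak[OF G x] by blast
  define m where "m = (1 + f y) / 2"
  have m: "f y < m" "m < f x" using f(2,3) y by (auto simp: m_def)
  let ?U = "{z \<in> topspace (realization G). f z \<in> {m<..}}"
  let ?V = "{z \<in> topspace (realization G). f z \<in> {..<m}}"
  have "openin (realization G) ?U" "openin (realization G) ?V"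
    by (rule openin_continuous_map_preimage[OF f(1)], simp)+
  then show "\<exists>U V. openin (realization G) U \<and> openin (realization G) V \<and> x \<in> U \<and> y \<in> V \<and> disjnt U V"
    using m x y by (intro exI[of _ ?U] exI[of _ ?V]) (auto simp: disjnt_def)
qed

section \<open>Arcs along edges and in subgraphs\<close>

lemma seg_edge:
  assumes G: "graph G" and e: "e \<in> edges G" and st: "0 \<le> s" "s \<le> t" "t \<le> 1"
  shows "seg (realization G) (edge_pt e s) (edge_pt e t) (edge_pt e ` {s..t})"
  using seg_between[OF continuous_map_edge_pt[OF G e] inj_on_edge_pt[OF G e]] st by auto

lemma open_edge_interval:
  assumes G: "graph G" and e: "e \<in> edges G" and st: "0 \<le> s" "t \<le> 1"
  shows "openin (realization G) (edge_pt e ` {s<..<t})"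
  unfolding openin_realization[OF G]
proof (intro conjI ballI)
  show "edge_pt e ` {s<..<t} \<subseteq> topspace (realization G)"
    using st by (auto intro!: edge_pt_in_topspace[OF G e])
  fix e' assume e': "e' \<in> edges G"
  have eq: "{u \<in> {0..1}. edge_pt e' u \<in> edge_pt e ` {s<..<t}} = (if e' = e then {s<..<t} else {})"
    using st by (auto simp: edge_pt_def image_iff)
  have "openin (top_of_set {0..1}) {s<..<t}"
    using st unfolding openin_open by (intro exI[of _ "{s<..<t}"]) auto
  then show "openin (top_of_set {0..1}) {u \<in> {0..1}. edge_pt e' u \<in> edge_pt e ` {s<..<t}}"
    unfolding eq by simp
qed

text \<open>A closed set of the subcomplex meets an edge outside \<open>H\<close> at most in the
  ends of this edge, hence in a closed set; so it is closed in the whole complex.\<close>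

lemma realization_subgraph:
  assumes G: "graph G" and H: "subgraph H G"
  shows "realization H = subtopology (realization G) (topspace (realization H))"
proof -
  have gH: "graph H" and sub: "verts H \<subseteq> verts G" "edges H \<subseteq> edges G" using H by (auto simp: subgraph_def)
  have top: "topspace (realization H) \<subseteq> topspace (realization G)"
    using sub by (auto simp: topspace_realization G gH)
  let ?S = "subtopology (realization G) (topspace (realization H))"
  have cl: "closedin (realization H) C \<longleftrightarrow> closedin ?S C" for C
  proof
    assume C: "closedin (realization H) C"
    have "closedin (realization G) C"
      unfolding closedin_realization[OF G]
    proof (intro conjI ballI)
      show "C \<subseteq> topspace (realization G)" using C top closedin_subset by blast
      fix e assume "e \<in> edges G"
      show "closed {t \<in> {0..1}. edge_pt e t \<in> C}"
      proof (cases "e \<in> edges H")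
        case True then show ?thesis using C unfolding closedin_realization[OF gH] by blast
      next
        case False
        then have "{t \<in> {0..1}. edge_pt e t \<in> C} \<subseteq> {0, 1}"
          using closedin_subset[OF C] by (auto simp: edge_pt_def topspace_realization[OF gH] split: if_splits)
        then show ?thesis by (meson finite.emptyI finite_insert finite_subset finite_imp_closed)
      qed
    qed
    then show "closedin (subtopology (realization G) (topspace (realization H))) C"
      using closedin_subset[OF C] by (auto simp: closedin_subtopology)
  next
    assume "closedin (subtopology (realization G) (topspace (realization H))) C"
    then obtain D where D: "closedin (realization G) D" "C = D \<inter> topspace (realization H)"
      by (auto simp: closedin_subtopology)
    have "{t \<in> {0..1}. edge_pt e t \<in> C} = {t \<in> {0..1}. edge_pt e t \<in> D}" if "e \<in> edges H" for e
      using edge_pt_in_topspace[OF gH that] D by auto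
    then show "closedin (realization H) C"
      using D sub unfolding closedin_realization[OF G] closedin_realization[OF gH] by auto
  qed
  have "topspace ?S = topspace (realization H)" using top by (simp add: Int_absorb1)
  then have "openin (realization H) U \<longleftrightarrow> openin ?S U" for U
    unfolding openin_closedin_eq[of "realization H"] openin_closedin_eq[of ?S] cl by simp
  then show ?thesis unfolding topology_eq by blast
qed

lemma seg_subgraph_iff:
  assumes "graph G" "subgraph H G"
  shows "seg (realization H) a b A \<longleftrightarrow> seg (realization G) a b A \<and> A \<subseteq> topspace (realization H)"
proof -
  have "continuous_map Y (realization H) h \<longleftrightarrow>
      continuous_map Y (realization G) h \<and> h ` topspace Y \<subseteq> topspace (realization H)" for Y :: "real topology" and h
    by (subst realization_subgraph[OF assms], simp only: continuous_map_in_subtopology image_subset_iff_funcset)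
  then show ?thesis unfolding seg_def by auto
qed

section \<open>The model is homeomorphic to the 1-complex\<close>

definition rep :: "'a + 'a set \<times> real \<Rightarrow> ('a + 'a set) \<times> real" where
  "rep p = (case p of Inl v \<Rightarrow> (Inl v, 0) | Inr (e, t) \<Rightarrow> (Inr e, t))"

text \<open>Gluing does not change the normal form, and each point is equivalent to the
  representative of its normal form.\<close>

lemma equivclp_glued_iff:
  assumes x: "x \<in> topspace (cell_sum G)" and y: "y \<in> topspace (cell_sum G)"
  shows "equivclp (glued G) x y \<longleftrightarrow> collapse x = collapse y"
proof
  have g: "collapse x = collapse y" if "glued G x y" for x y
    using that by (auto elim!: glued.cases)
  assume "equivclp (glued G) x y"
  then show "collapse x = collapse y"
    by (induction rule: equivclp_induct) (auto elim!: symclpE dest: g)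
next
  have *: "equivclp (glued G) z (rep (collapse z))" if z: "z \<in> topspace (cell_sum G)" for z
  proof -
    consider v where "z = (Inl v, 0)" | e t where "e \<in> edges G" "z = (Inr e, t)"
      using z unfolding topspace_cell_sum by auto
    then show ?thesis
    proof cases
      case 1 then show ?thesis by (simp add: rep_def)
    next
      case 2
      have "equivclp (glued G) (Inr e, 0) (Inl (tail e), 0)" "equivclp (glued G) (Inr e, 1) (Inl (head e), 0)"
        using glued.intros[OF 2(1)] by (auto intro: r_into_equivclp)
      then show ?thesis using 2 by (simp add: rep_def edge_pt_def)
    qed
  qed
  assume "collapse x = collapse y"
  then have "equivclp (glued G) y (rep (collapse x))" using *[OF y] by simp
  from equivclp_trans[OF *[OF x] equivclp_sym[OF this]] show "equivclp (glued G) x y" .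
qed

text \<open>Two quotient maps on the same space with the same fibres have homeomorphic targets. The
  homeomorphism sends a normal form to the class of a chosen preimage.\<close>

lemma homeomorphic_realization:
  "realization G homeomorphic_space one_complex G"
proof -
  let ?q = "\<lambda>x. {y. equivclp (glued G) x y}"
  have q: "?q x = ?q y \<longleftrightarrow> collapse x = collapse y" if "x \<in> topspace (cell_sum G)" "y \<in> topspace (cell_sum G)" for x y
  proof -
    have "?q x = ?q y \<longleftrightarrow> equivclp (glued G) x y"
      by (auto intro: equivclp_sym equivclp_trans)
    then show ?thesis using equivclp_glued_iff[OF that] by simp
  qed
  have t: "topspace (realization G) = collapse ` topspace (cell_sum G)"
    unfolding realization_def topspace_quotient_topology ..
  define c where "c p = (SOME x. x \<in> topspace (cell_sum G) \<and> collapse x = p)" for p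
  have c: "c (collapse x) \<in> topspace (cell_sum G)" "collapse (c (collapse x)) = collapse x"
    if "x \<in> topspace (cell_sum G)" for x
    unfolding c_def using someI[of "\<lambda>z. z \<in> topspace (cell_sum G) \<and> collapse z = collapse x" x] that by auto
  let ?f = "\<lambda>p. ?q (c p)"
  have "quotient_map (cell_sum G) (one_complex G) ?q"
    unfolding one_complex_def by (rule quotient_map_quotient_topology)
  moreover have "?q x = (?f \<circ> collapse) x" if "x \<in> topspace (cell_sum G)" for x
    using q[OF that c(1)[OF that]] c(2)[OF that] by simp
  ultimately have "quotient_map (cell_sum G) (one_complex G) (?f \<circ> collapse)"
    using quotient_map_eq by blast
  then have "quotient_map (realization G) (one_complex G) ?f"
    unfolding realization_def by (rule iffD1[OF quotient_map_compose_eq[OF quotient_map_quotient_topology]])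
  moreover have "inj_on ?f (topspace (realization G))"
  proof (rule inj_onI)
    fix p p' assume "p \<in> topspace (realization G)" "p' \<in> topspace (realization G)" "?f p = ?f p'"
    then obtain x y where "x \<in> topspace (cell_sum G)" "y \<in> topspace (cell_sum G)" "p = collapse x" "p' = collapse y"
      "?q (c (collapse x)) = ?q (c (collapse y))" unfolding t by blast
    then show "p = p'" using q[OF c(1)[of x] c(1)[of y]] c(2)[of x] c(2)[of y] by simp
  qed
  ultimately have "homeomorphic_map (realization G) (one_complex G) ?f" by (simp add: homeomorphic_map_def)
  then show ?thesis by (rule homeomorphic_map_imp_homeomorphic_space)
qed

lemma arc_in_homeomorphic_map:
  assumes f: "homeomorphic_map X Y f" and A: "arc_in X A"
  shows "arc_in Y (f ` A)"
proof -
  have "A \<subseteq> topspace X" using A by (simp add: arc_in_def)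
  then have "homeomorphic_map (subtopology X A) (subtopology Y (f ` A)) f"
    using homeomorphic_imp_surjective_map[OF f] by (intro homeomorphic_map_subtopologies[OF f]) blast
  then have "subtopology X A homeomorphic_space subtopology Y (f ` A)"
    by (rule homeomorphic_map_imp_homeomorphic_space)
  moreover have "f ` A \<subseteq> topspace Y"
    using \<open>A \<subseteq> topspace X\<close> homeomorphic_imp_surjective_map[OF f] by blast
  ultimately show ?thesis using A homeomorphic_space_sym homeomorphic_space_trans
    unfolding arc_in_def by blast
qed

lemma n_ac_iff_seg:
  assumes G: "graph G"
  shows "n_ac n G \<longleftrightarrow> (\<forall>P. P \<subseteq> topspace (realization G) \<and> finite P \<and> card P \<le> n \<longrightarrow>
    (\<exists>a b A. a \<noteq> b \<and> seg (realization G) a b A \<and> P \<subseteq> A))"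
proof -
  \<comment> \<open>Stated for arbitrary homeomorphic spaces because it is applied in both
    directions.\<close>
  have *: "\<forall>P. P \<subseteq> topspace Y \<and> finite P \<and> card P \<le> n \<longrightarrow> (\<exists>A. arc_in Y A \<and> P \<subseteq> A)"
    if XY: "X homeomorphic_space Y" and X: "\<forall>P. P \<subseteq> topspace X \<and> finite P \<and> card P \<le> n \<longrightarrow> (\<exists>A. arc_in X A \<and> P \<subseteq> A)"
    for X :: "'c topology" and Y :: "'d topology"
  proof (intro allI impI, elim conjE)
    fix P assume P: "P \<subseteq> topspace Y" "finite P" "card P \<le> n"
    obtain f g where f: "homeomorphic_map X Y f" and g: "homeomorphic_map Y X g"
      and fg: "\<And>y. y \<in> topspace Y \<Longrightarrow> f (g y) = y"
      using XY unfolding homeomorphic_space_def homeomorphic_maps_map by blast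
    have "g ` P \<subseteq> topspace X" using P homeomorphic_imp_surjective_map[OF g] by blast
    moreover have "card (g ` P) \<le> n" using P card_image_le le_trans by blast
    ultimately obtain A where A: "arc_in X A" "g ` P \<subseteq> A" using X P by blast
    have "P \<subseteq> f ` A"
    proof
      fix p assume "p \<in> P"
      then have "g p \<in> A" "p = f (g p)" using A(2) P(1) fg by auto
      then show "p \<in> f ` A" by (rule rev_image_eqI)
    qed
    then show "\<exists>A. arc_in Y A \<and> P \<subseteq> A" using arc_in_homeomorphic_map[OF f A(1)] by blast
  qed
  have s: "one_complex G homeomorphic_space realization G"
    using homeomorphic_realization homeomorphic_space_sym by blast
  have "n_ac n G \<longleftrightarrow> (\<forall>P. P \<subseteq> topspace (realization G) \<and> finite P \<and> card P \<le> n \<longrightarrow>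
    (\<exists>A. arc_in (realization G) A \<and> P \<subseteq> A))"
    unfolding n_ac_def by (rule iffI, erule *[OF s], erule *[OF homeomorphic_realization])
  moreover have "(\<exists>A. arc_in (realization G) A \<and> P \<subseteq> A) \<longleftrightarrow>
    (\<exists>a b A. a \<noteq> b \<and> seg (realization G) a b A \<and> P \<subseteq> A)" for P
    unfolding arc_in_iff_seg[OF Hausdorff_realization[OF G]] by blast
  ultimately show ?thesis by (simp only:)
qed

section \<open>The 1-complex of a 2-connected graph\<close>

lemma edge_cases:
  assumes "graph G" "{u, v} \<in> edges G"
  obtains "tail {u, v} = u" "head {u, v} = v" | "tail {u, v} = v" "head {u, v} = u"
  using tail_head[OF assms] by (metis doubleton_eq_iff)

lemma mem_edge_iff: "graph G \<Longrightarrow> e \<in> edges G \<Longrightarrow> v \<in> e \<longleftrightarrow> v = tail e \<or> v = head e"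
  using tail_head(1)[of G e] by (metis insert_iff singletonD)

lemma edge_subset: "graph G \<Longrightarrow> e \<in> edges G \<Longrightarrow> e \<subseteq> verts G"
  by (auto simp: graph_def nsets_def)

lemma edge_obtain:
  assumes "graph G" "e \<in> edges G" "v \<in> e"
  obtains w where "e = {v, w}" "v \<noteq> w"
  using tail_head(1,2)[OF assms(1,2)] assms(3) by (metis insert_commute insertE singletonD)

lemma graph_delete_verts: "graph G \<Longrightarrow> graph (delete_verts G W)"
  unfolding graph_def delete_verts_def nsets_def by auto

lemma delete_verts_empty: "delete_verts G {} = G"
  by (simp add: delete_verts_def)

lemma subgraph_delete_verts: "graph G \<Longrightarrow> subgraph (delete_verts G W) G"
  using graph_delete_verts[of G W] by (auto simp: subgraph_def delete_verts_def)

lemma seg_along_edge: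
  assumes "graph G" "{u, v} \<in> edges G"
  shows "seg (realization G) (Inl u) (Inl v) (edge_pt {u, v} ` {0..1})"
proof -
  have s: "seg (realization G) (Inl (tail {u, v})) (Inl (head {u, v})) (edge_pt {u, v} ` {0..1})"
    using seg_edge[OF assms, of 0 1] by simp
  show ?thesis by (rule edge_cases[OF assms]) (use s seg_sym[OF s] in simp_all)
qed

lemma seg_linked:
  assumes "graph G" "linked G u v"
  obtains A where "seg (realization G) (Inl u) (Inl v) A"
proof -
  have "(adjacent G)\<^sup>*\<^sup>* u v" "u \<in> verts G" using assms(2) by (auto simp: linked_def)
  then have "\<exists>A. seg (realization G) (Inl u) (Inl v) A"
  proof induction
    case base
    then show ?case using seg_refl[of "Inl u" "realization G"] by (auto simp: topspace_realization[OF assms(1)])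
  next
    case (step y z)
    then obtain A where A: "seg (realization G) (Inl u) (Inl y) A" by blast
    have e: "{y, z} \<in> edges G" using step(2) by (simp add: adjacent_def)
    obtain C where "seg (realization G) (Inl u) (Inl z) C"
      by (rule seg_trans[OF Hausdorff_realization[OF assms(1)] A seg_along_edge[OF assms(1) e]])
    then show ?case by blast
  qed
  then show ?thesis using that by blast
qed

text \<open>The arc is found in the complex of the graph without \<open>w\<close>, so it also misses
  the inner points of all edges at \<open>w\<close>. In this way inner points of an edge are avoided
  by deleting an endvertex.\<close>

lemma seg_linked_delete:
  assumes G: "graph G" and l: "linked (delete_verts G {w}) u v"
  obtains A where "seg (realization G) (Inl u) (Inl v) A" "Inl w \<notin> A" "\<And>e t. w \<in> e \<Longrightarrow> Inr (e, t) \<notin> A"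
proof -
  let ?H = "delete_verts G {w}"
  obtain A where A: "seg (realization ?H) (Inl u) (Inl v) A"
    by (rule seg_linked[OF graph_delete_verts[OF G] l])
  have "seg (realization G) (Inl u) (Inl v) A"
    using A seg_subgraph_iff[OF G subgraph_delete_verts[OF G]] by blast
  moreover have "A \<subseteq> Inl ` verts ?H \<union> Inr ` (edges ?H \<times> {0<..<1})"
    using seg_subset[OF A] by (simp add: topspace_realization[OF graph_delete_verts[OF G]])
  ultimately show ?thesis by (intro that) (auto simp: delete_verts_def)
qed

lemma free_seg_edge:
  assumes G: "graph G" and e: "e \<in> edges G" and st: "s \<in> {0..1}" "t \<in> {0..1}" "s \<noteq> t"
  shows "\<exists>S. free_seg (realization G) (edge_pt e s) (edge_pt e t) S"
proof -
  have *: "free_seg (realization G) (edge_pt e s) (edge_pt e t) (edge_pt e ` {s..t})"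
    if "0 \<le> s" "s < t" "t \<le> 1" for s t
  proof -
    have i: "inj_on (edge_pt e) {0..1}" by (rule inj_on_edge_pt[OF G e])
    have "edge_pt e s \<noteq> edge_pt e t" using inj_onD[OF i, of s t] that by auto
    moreover have "edge_pt e ` {s..t} - {edge_pt e s, edge_pt e t} = edge_pt e ` {s<..<t}"
    proof -
      have "{s..t} - {s, t} = {s<..<t}" "{s<..<t} \<subseteq> {0..1}" "{s, t} \<subseteq> {0..1}" using that by auto
      then show ?thesis using inj_on_image_set_diff[OF i, of "{s..t}" "{s, t}"] by simp
    qed
    ultimately show ?thesis
      unfolding free_seg_def using seg_edge[OF G e, of s t] open_edge_interval[OF G e, of s t] that by simp
  qed
  show ?thesis
  proof (cases "s < t")
    case True then show ?thesis using *[of s t] st by auto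
  next
    case False then show ?thesis using free_seg_sym[OF *[of t s]] st by auto
  qed
qed

lemma vertex_chain:
  assumes G: "graph G" and l: "(adjacent G)\<^sup>*\<^sup>* u v"
  shows "(\<lambda>p q. \<exists>S. free_seg (realization G) p q S)\<^sup>*\<^sup>* (Inl u) (Inl v)"
  using l
proof induction
  case (step y z)
  then have e: "{y, z} \<in> edges G" by (simp add: adjacent_def)
  have "\<exists>S. free_seg (realization G) (Inl y) (Inl z) S"
    by (rule edge_cases[OF G e])
      (use free_seg_edge[OF G e, of 0 1] free_seg_edge[OF G e, of 1 0] in auto)
  from rtranclp.rtrancl_into_rtrancl[OF step(3), of "Inl z", OF this] show ?case .
qed blast

lemma free_chain:
  assumes G: "graph G" "connected_graph G"
    and xy: "x \<in> topspace (realization G)" "y \<in> topspace (realization G)"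
  shows "(\<lambda>p q. \<exists>S. free_seg (realization G) p q S)\<^sup>*\<^sup>* x y" (is "?F\<^sup>*\<^sup>* x y")
proof -
  have *: "\<exists>v\<in>verts G. ?F\<^sup>*\<^sup>* x (Inl v) \<and> ?F\<^sup>*\<^sup>* (Inl v) x" if x: "x \<in> topspace (realization G)" for x
  proof -
    consider v where "v \<in> verts G" "x = Inl v" | e t where "e \<in> edges G" "0 < t" "t < 1" "x = Inr (e, t)"
      using x unfolding topspace_realization[OF G(1)] by auto
    then show ?thesis
    proof cases
      case 2
      have "?F x (Inl (tail e))" "?F (Inl (tail e)) x"
        using free_seg_edge[OF G(1) 2(1), of t 0] free_seg_edge[OF G(1) 2(1), of 0 t] 2 edge_pt_interior[of t e] by auto
      then show ?thesis using tail_head(3)[OF G(1) 2(1)] by blast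
    qed blast
  qed
  obtain u v where "u \<in> verts G" "?F\<^sup>*\<^sup>* x (Inl u)" "v \<in> verts G" "?F\<^sup>*\<^sup>* (Inl v) y"
    using *[OF xy(1)] *[OF xy(2)] by blast
  moreover have "?F\<^sup>*\<^sup>* (Inl u) (Inl v)"
    using G(2) calculation vertex_chain[OF G(1)] by (auto simp: connected_graph_def linked_def)
  ultimately show ?thesis by (meson rtranclp_trans)
qed

lemma k_connected_2D:
  assumes "k_connected 2 G"
  shows "connected_graph G" "\<And>v. v \<in> verts G \<Longrightarrow> connected_graph (delete_verts G {v})"
proof -
  show "connected_graph G"
    using assms[unfolded k_connected_def, rule_format, of "{}"] by (simp add: delete_verts_empty)
  show "connected_graph (delete_verts G {v})" if "v \<in> verts G" for v
    using assms[unfolded k_connected_def, rule_format, of "{v}"] that by simp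
qed

text \<open>Each of the two points first moves along its edge to a vertex without passing
  \<open>x\<close>. Vertices are then joined by deleting a vertex: \<open>x\<close> itself, or an
  endvertex of the edge that contains \<open>x\<close>.\<close>

lemma avoiding_seg:
  assumes G: "graph G" "k_connected 2 G" "\<not> is_K2 G"
    and y: "y \<in> topspace (realization G)" "y \<noteq> x" and z: "z \<in> topspace (realization G)" "z \<noteq> x"
  shows "\<exists>A. seg (realization G) y z A \<and> x \<notin> A"
proof -
  let ?X = "realization G"
  define J where "J = (\<lambda>p q. \<exists>A. seg ?X p q A \<and> x \<notin> A)"
  have J_sym: "J p q \<Longrightarrow> J q p" for p q unfolding J_def using seg_sym by metis
  have J_trans: "J p r" if pq: "J p q" and qr: "J q r" for p q r
  proof -
    obtain A B where A: "seg ?X p q A" "seg ?X q r B" "x \<notin> A \<union> B" using pq qr unfolding J_def by blast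
    obtain C where "seg ?X p r C" "C \<subseteq> A \<union> B" by (rule seg_trans[OF Hausdorff_realization[OF G(1)] A(1,2)])
    then show ?thesis using A(3) unfolding J_def by blast
  qed
  have J_edge: "J (edge_pt e s) (edge_pt e t)"
    if "e \<in> edges G" "0 \<le> s" "s \<le> t" "t \<le> 1" "x \<notin> edge_pt e ` {s..t}" for e s t
    unfolding J_def using seg_edge[OF G(1) that(1-4)] that(5) by blast
  have link: "linked (delete_verts G {w}) u v" if "w \<in> verts G" "u \<in> verts G - {w}" "v \<in> verts G - {w}" for u v w
    using k_connected_2D(2)[OF G(2) that(1)] that(2,3) by (auto simp: connected_graph_def delete_verts_def)
  have "\<exists>v\<in>verts G. Inl v \<noteq> x \<and> J p (Inl v)" if p: "p \<in> topspace ?X" "p \<noteq> x" for p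
  proof -
    consider v where "v \<in> verts G" "p = Inl v" | e t where "e \<in> edges G" "0 < t" "t < 1" "p = Inr (e, t)"
      using p unfolding topspace_realization[OF G(1)] by auto
    then show ?thesis
    proof cases
      case 1
      have "J p p" unfolding J_def using seg_refl[OF p(1)] p(2) by blast
      then show ?thesis using 1 p by blast
    next
      case 2
      note th = tail_head(2-4)[OF G(1) 2(1)]
      have i: "inj_on (edge_pt e) {0..1}" by (rule inj_on_edge_pt[OF G(1) 2(1)])
      \<comment> \<open>Only \<open>p\<close> belongs to both parts of the edge, so at least one
        part leads from \<open>p\<close> to a vertex without meeting \<open>x\<close>.\<close>
      have "x \<notin> edge_pt e ` {0..t} \<or> x \<notin> edge_pt e ` {t..1}"
      proof (rule ccontr)
        assume "\<not> ?thesis"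
        then obtain r s where rs: "r \<in> {0..t}" "x = edge_pt e r" "s \<in> {t..1}" "x = edge_pt e s" by blast
        then have "r = s" using inj_onD[OF i, of r s] 2 by auto
        then have "x = p" using rs 2 edge_pt_interior[of t e] by auto
        then show False using p by simp
      qed
      then show ?thesis
      proof
        assume x: "x \<notin> edge_pt e ` {0..t}"
        then have "J (Inl (tail e)) p" using J_edge[OF 2(1), of 0 t] 2 edge_pt_interior[of t e] by simp
        moreover have "Inl (tail e) \<noteq> x" using x 2(2) by (metis atLeastAtMost_iff edge_pt_simps(1) image_eqI less_eq_real_def)
        ultimately show ?thesis using th J_sym by blast
      next
        assume x: "x \<notin> edge_pt e ` {t..1}"
        then have "J p (Inl (head e))" using J_edge[OF 2(1), of t 1] 2 edge_pt_interior[of t e] by simp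
        moreover have "Inl (head e) \<noteq> x" using x 2(3) by (metis atLeastAtMost_iff edge_pt_simps(2) image_eqI less_eq_real_def)
        ultimately show ?thesis using th by blast
      qed
    qed
  qed
  moreover have "J (Inl u) (Inl v)" if uv: "u \<in> verts G" "v \<in> verts G" "Inl u \<noteq> x" "Inl v \<noteq> x" for u v
  proof -
    have via: "J (Inl u) (Inl v)" if w: "w \<in> verts G" "u \<in> verts G - {w}" "v \<in> verts G - {w}"
      "x = Inl w \<or> (\<exists>e t. x = Inr (e, t) \<and> w \<in> e)" for w u v
      by (rule seg_linked_delete[OF G(1) link[OF w(1-3)]]) (use w(4) in \<open>auto simp: J_def\<close>)
    consider w where "x = Inl w" "w \<in> verts G" | e t where "x = Inr (e, t)" "e \<in> edges G"
      | "x \<notin> topspace ?X"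
      unfolding topspace_realization[OF G(1)] by (cases x) auto
    then show ?thesis
    proof cases
      case 1
      then show ?thesis using via[of w u v] uv by auto
    next
      case 2
      obtain a b where ab: "e = {a, b}" "a \<noteq> b" "a \<in> verts G" "b \<in> verts G"
        by (rule that[OF tail_head[OF G(1) 2(2)]])
      have "verts G \<noteq> {a, b}"
      proof
        assume V: "verts G = {a, b}"
        have "edges G \<subseteq> {{a, b}}"
        proof
          fix e' assume "e' \<in> edges G"
          note th = tail_head[OF G(1) this]
          have "{tail e', head e'} = {a, b}" using th(2-4) unfolding V by auto
          then show "e' \<in> {{a, b}}" using th(1) by simp
        qed
        then have "edges G = {{a, b}}" using 2(2) ab(1) by blast
        then show False using G(3) V ab(2) unfolding is_K2_def by blast
      qed
      then obtain c where c: "c \<in> verts G" "c \<noteq> a" "c \<noteq> b" using ab by blast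
      \<comment> \<open>Deleting either endvertex keeps the arc off the edge. The endvertices
        themselves are joined through a third vertex \<open>c\<close>, which exists because the
        graph is not K2.\<close>
      have a: "J (Inl u) (Inl v)" if "u \<in> verts G - {a}" "v \<in> verts G - {a}" for u v
        using via[OF ab(3) that] 2 ab by blast
      have b: "J (Inl u) (Inl v)" if "u \<in> verts G - {b}" "v \<in> verts G - {b}" for u v
        using via[OF ab(4) that] 2 ab by blast
      have "J (Inl a) (Inl c)" "J (Inl c) (Inl b)" using a[of c b] b[of a c] c ab by blast+
      then have Jab: "J (Inl a) (Inl b)" by (rule J_trans)
      consider "u \<noteq> a" "v \<noteq> a" | "u \<noteq> b" "v \<noteq> b" | "u = a" "v = b" | "u = b" "v = a" using ab(2) by blast
      then show ?thesis using a[of u v] b[of u v] uv Jab J_sym[OF Jab] by cases auto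
    next
      case 3
      have "linked G u v" using k_connected_2D(1)[OF G(2)] uv by (auto simp: connected_graph_def)
      then obtain A where A: "seg ?X (Inl u) (Inl v) A" by (rule seg_linked[OF G(1)])
      then show ?thesis using seg_subset[OF A] 3 unfolding J_def by blast
    qed
  qed
  ultimately obtain u v where "J y (Inl u)" "J z (Inl v)" "J (Inl u) (Inl v)" using y z by meson
  then have "J y z" using J_trans J_sym by blast
  then show ?thesis unfolding J_def .
qed

lemma cyclic_space_realization:
  assumes "graph G" "k_connected 2 G" "\<not> is_K2 G"
  shows "cyclic_space (realization G)"
  by (unfold_locales)
    (use Hausdorff_realization avoiding_seg free_chain k_connected_2D(1) assms in \<open>blast+\<close>)

text \<open>If \<open>T\<close> missed a point of the edge on either side of
  \<open>edge_pt e s\<close>, the open interval between these two points would split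
  \<open>T\<close>.\<close>

lemma connected_half_edge:
  assumes G: "graph G" and e: "e \<in> edges G" and T: "connectedin (realization G) T"
    and s: "edge_pt e s \<in> T" "0 < s" "s < 1" and out: "p \<in> T" "p \<notin> edge_pt e ` {0<..<1}"
  shows "edge_pt e ` {0..s} \<subseteq> T \<or> edge_pt e ` {s..1} \<subseteq> T"
proof (rule ccontr)
  assume "\<not> ?thesis"
  then obtain t1 t2 where t: "t1 \<in> {0..s}" "edge_pt e t1 \<notin> T" "t2 \<in> {s..1}" "edge_pt e t2 \<notin> T" by blast
  then have t': "0 \<le> t1" "t1 < s" "s < t2" "t2 \<le> 1" using s(1) by (cases "t1 = s"; cases "t2 = s"; auto)+
  let ?U = "edge_pt e ` {t1<..<t2}" and ?K = "edge_pt e ` {t1..t2}"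
  have "openin (realization G) ?U" using open_edge_interval[OF G e] t' by simp
  moreover have "closedin (realization G) ?K"
    using seg_closed[OF Hausdorff_realization[OF G] seg_edge[OF G e, of t1 t2]] t' by simp
  then have "openin (realization G) (topspace (realization G) - ?K)" by blast
  moreover have KU: "T \<inter> ?K \<subseteq> ?U"
  proof
    fix q assume "q \<in> T \<inter> ?K"
    then obtain r where "r \<in> {t1..t2}" "q = edge_pt e r" "q \<in> T" by blast
    then show "q \<in> ?U" using t by (cases "r = t1"; cases "r = t2"; auto)
  qed
  then have "T \<subseteq> ?U \<union> (topspace (realization G) - ?K)" using connectedin_subset_topspace[OF T] by blast
  moreover have "?U \<inter> (topspace (realization G) - ?K) \<inter> T = {}" by auto
  moreover have "edge_pt e s \<in> ?U" using t' by (intro imageI) simp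
  then have "?U \<inter> T \<noteq> {}" using s(1) by blast
  moreover have "?U \<subseteq> edge_pt e ` {0<..<1}" using t' by (intro image_mono) auto
  then have "p \<notin> ?U" using out(2) by blast
  then have "p \<notin> ?K" using KU out by blast
  then have "(topspace (realization G) - ?K) \<inter> T \<noteq> {}" using out connectedin_subset_topspace[OF T] by blast
  ultimately show False using T unfolding connectedin by blast
qed

text \<open>\<open>A\<close> contains a piece of \<open>e\<close> next to \<open>v\<close>. The two
  alternatives account for the arbitrary orientation of \<open>e\<close>.\<close>

definition germ :: "'a \<Rightarrow> 'a set \<Rightarrow> ('a + 'a set \<times> real) set \<Rightarrow> bool" where
  "germ v e A \<longleftrightarrow> v = tail e \<and> (\<exists>s. 0 < s \<and> s < 1/2 \<and> edge_pt e ` {0..s} \<subseteq> A) \<or>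
    v = head e \<and> (\<exists>s. 1/2 < s \<and> s < 1 \<and> edge_pt e ` {s..1} \<subseteq> A)"

text \<open>The open star of radius 1/2; within it, a point other than the centre determines its
  edge, and midpoints are excluded.\<close>

definition star :: "'a ugraph \<Rightarrow> 'a \<Rightarrow> ('a + 'a set \<times> real) set" where
  "star G v = {Inl v} \<union> {Inr (e, t) |e t. e \<in> edges G \<and> (v = tail e \<and> 0 < t \<and> t < 1/2 \<or> v = head e \<and> 1/2 < t \<and> t < 1)}"

lemma openin_star:
  assumes G: "graph G" and v: "v \<in> verts G"
  shows "openin (realization G) (star G v)"
  unfolding openin_realization[OF G]
proof (intro conjI ballI)
  show "star G v \<subseteq> topspace (realization G)"
    using v by (auto simp: star_def topspace_realization[OF G])
  fix e assume e: "e \<in> edges G"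
  have "{t \<in> {0..1}. edge_pt e t \<in> star G v} =
      (if v = tail e then {0..1} \<inter> {..<1/2} else if v = head e then {0..1} \<inter> {1/2<..} else {})"
    using e tail_head(2)[OF G e] by (auto simp: star_def edge_pt_def)
  moreover have "openin (top_of_set {0..1::real}) ({0..1} \<inter> {..<1/2})" "openin (top_of_set {0..1::real}) ({0..1} \<inter> {1/2<..})"
    by (auto intro: openin_open_Int)
  ultimately show "openin (top_of_set {0..1}) {t \<in> {0..1}. edge_pt e t \<in> star G v}" by simp
qed

text \<open>An initial piece of the arc stays in the star of \<open>v\<close>. A point of it other
  than \<open>v\<close> lies on some edge \<open>e\<close>, and the arc can get there from
  \<open>v\<close> only along \<open>e\<close>.\<close>

lemma seg_germ:
  assumes G: "graph G" and v: "v \<in> verts G" and A: "seg (realization G) (Inl v) w A" "w \<noteq> Inl v"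
  obtains e where "e \<in> edges G" "v \<in> e" "germ v e A"
proof -
  let ?X = "realization G"
  have w: "w \<in> topspace ?X" using seg_subset[OF A(1)] seg_ends[OF A(1)] by blast
  have "closedin ?X (topspace ?X - star G v)" using openin_star[OF G v] by blast
  moreover have "closedin ?X {w}"
    by (rule closedin_Hausdorff_singleton[OF Hausdorff_realization[OF G] w])
  \<comment> \<open>Adding the end \<open>w\<close> ensures that the set is met even if the whole
    arc stays in the star.\<close>
  ultimately have K: "closedin ?X ((topspace ?X - star G v) \<union> {w})" by (rule closedin_Un)
  have "A \<inter> ((topspace ?X - star G v) \<union> {w}) \<noteq> {}" using seg_ends(2)[OF A(1)] by blast
  then obtain c A1 A2 where c: "seg ?X (Inl v) c A1" "seg ?X c w A2" "A1 \<union> A2 = A" "A1 \<inter> A2 = {c}"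
    "A1 \<inter> ((topspace ?X - star G v) \<union> {w}) = {c}"
    by (rule seg_first_hit[OF A(1) K])
  have "Inl v \<in> star G v" by (simp add: star_def)
  then have cv: "Inl v \<noteq> c" using c(5) A(2) by blast
  obtain y where y: "y \<in> A1" "y \<noteq> Inl v" "y \<noteq> c" by (rule seg_mid[OF c(1) cv])
  obtain B C where B: "seg ?X (Inl v) y B" "seg ?X y c C" "B \<union> C = A1" "B \<inter> C = {y}"
    by (rule seg_split[OF c(1) y(1)])
  have "c \<notin> B" using B(4) seg_ends[OF B(2)] y unfolding set_pointwise by (smt (verit))
  then have Bs: "B \<subseteq> star G v" using B(3) c(5) seg_subset[OF c(1)] unfolding set_pointwise by (smt (verit))
  have yB: "y \<in> B" "Inl v \<in> B" using seg_ends[OF B(1)] by auto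
  obtain e t where e: "y = Inr (e, t)" "e \<in> edges G" "v = tail e \<and> 0 < t \<and> t < 1/2 \<or> v = head e \<and> 1/2 < t \<and> t < 1"
    using yB Bs y(2) unfolding star_def by blast
  have t: "0 < t" "t < 1" using e by auto
  have ye: "edge_pt e t \<in> B" using yB e t by (simp add: edge_pt_interior)
  have vo: "Inl v \<notin> edge_pt e ` {0<..<1}" by (auto simp: edge_pt_def)
  \<comment> \<open>The part of \<open>e\<close> that leads from \<open>y\<close> away from
    \<open>v\<close> contains the midpoint, which is not in the star; so \<open>B\<close> contains
    the part towards \<open>v\<close>.\<close>
  have mid: "edge_pt e (1/2) \<notin> B"
    using Bs by (auto simp: star_def edge_pt_def)
  have BA: "B \<subseteq> A" using B(3) c(3) by blast
  have h: "edge_pt e ` {0..t} \<subseteq> B \<or> edge_pt e ` {t..1} \<subseteq> B"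
    by (rule connected_half_edge[OF G e(2) seg_connected[OF B(1)] ye t yB(2) vo])
  have "germ v e A"
    unfolding germ_def
  proof (cases "v = tail e \<and> 0 < t \<and> t < 1/2")
    case True
    then have "edge_pt e (1/2) \<in> edge_pt e ` {t..1}" by (intro imageI) simp
    then have "\<not> edge_pt e ` {t..1} \<subseteq> B" using mid by blast
    then show "v = tail e \<and> (\<exists>s. 0 < s \<and> s < 1/2 \<and> edge_pt e ` {0..s} \<subseteq> A) \<or>
      v = head e \<and> (\<exists>s. 1/2 < s \<and> s < 1 \<and> edge_pt e ` {s..1} \<subseteq> A)" using h True BA by blast
  next
    case False
    then have t': "v = head e \<and> 1/2 < t \<and> t < 1" using e by blast
    then have "edge_pt e (1/2) \<in> edge_pt e ` {0..t}" by (intro imageI) simp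
    then have "\<not> edge_pt e ` {0..t} \<subseteq> B" using mid by blast
    then show "v = tail e \<and> (\<exists>s. 0 < s \<and> s < 1/2 \<and> edge_pt e ` {0..s} \<subseteq> A) \<or>
      v = head e \<and> (\<exists>s. 1/2 < s \<and> s < 1 \<and> edge_pt e ` {s..1} \<subseteq> A)" using h t' BA by blast
  qed
  moreover have "v \<in> e" using e(3) mem_edge_iff[OF G e(2)] by blast
  ultimately show ?thesis using that e(2) by blast
qed

text \<open>Both arcs contain a common piece of \<open>e\<close> next to \<open>v\<close>, and two
  of its inner points cannot both equal \<open>w\<close>.\<close>

lemma germ_overlap:
  assumes G: "graph G" "e \<in> edges G" and g: "germ v e A" "germ v e B"
  shows "\<not> A \<inter> B \<subseteq> {Inl v, w}"
proof
  assume AB: "A \<inter> B \<subseteq> {Inl v, w}"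
  have i: "inj_on (edge_pt e) {0..1}" by (rule inj_on_edge_pt[OF G])
  have *: False if "edge_pt e s \<in> A \<inter> B" "edge_pt e t \<in> A \<inter> B" "0 < s" "s < t" "t < 1" for s t
  proof -
    have "edge_pt e s = w" "edge_pt e t = w" using AB that by (auto simp: edge_pt_def)
    then have "s = t" using inj_onD[OF i, of s t] that by auto
    then show False using that by simp
  qed
  have th: "tail e \<noteq> head e" by (rule tail_head(2)[OF G])
  show False
  proof (cases "v = tail e")
    case True
    then obtain s t where st: "0 < s" "s < 1/2" "edge_pt e ` {0..s} \<subseteq> A" "0 < t" "t < 1/2" "edge_pt e ` {0..t} \<subseteq> B"
      using g th unfolding germ_def by auto
    define m where "m = min s t"
    have m: "0 < m" "m < 1/2" "m \<le> s" "m \<le> t" using st by (auto simp: m_def)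
    then have "edge_pt e (m/2) \<in> A \<inter> B" "edge_pt e m \<in> A \<inter> B" using st by auto
    then show False using *[of "m/2" m] m by simp
  next
    case False
    then obtain s t where st: "1/2 < s" "s < 1" "edge_pt e ` {s..1} \<subseteq> A" "1/2 < t" "t < 1" "edge_pt e ` {t..1} \<subseteq> B"
      using g unfolding germ_def by auto
    define m where "m = max s t"
    have m: "1/2 < m" "m < 1" "s \<le> m" "t \<le> m" using st by (auto simp: m_def)
    then have "edge_pt e ((m+1)/2) \<in> A \<inter> B" "edge_pt e m \<in> A \<inter> B" using st by auto
    then show False using *[of m "(m+1)/2"] m by simp
  qed
qed

lemma vertex_degree_le_2_iff:
  "vertex_degree G v \<le> 2 \<longleftrightarrow> finite {e \<in> edges G. v \<in> e} \<and> card {e \<in> edges G. v \<in> e} \<le> 2"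
  by (auto simp: vertex_degree_def numeral_eq_enat)

lemma vertex_degree_le_2D:
  assumes "vertex_degree G v \<le> 2" "{e1, e2, e3} \<subseteq> {e \<in> edges G. v \<in> e}"
  shows "e1 = e2 \<or> e1 = e3 \<or> e2 = e3"
proof -
  have "card {e1, e2, e3} \<le> 2"
    using card_mono[OF _ assms(2)] assms(1) unfolding vertex_degree_le_2_iff by linarith
  then show ?thesis by (auto simp: card_insert_if split: if_splits)
qed

text \<open>Each of the three arcs leaves \<open>v\<close> along an edge, and by
  \<open>germ_overlap\<close> these edges are different.\<close>

lemma no_triod:
  assumes G: "graph G" and v: "v \<in> verts G" "vertex_degree G v \<le> 2" and w: "Inl v \<noteq> w"
    and T: "seg (realization G) (Inl v) w T1" "seg (realization G) (Inl v) w T2" "seg (realization G) (Inl v) w T3"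
  shows "\<not> (T1 \<inter> T2 = {Inl v, w} \<and> T1 \<inter> T3 = {Inl v, w} \<and> T2 \<inter> T3 = {Inl v, w})"
proof -
  obtain e1 where e1: "e1 \<in> edges G" "v \<in> e1" "germ v e1 T1" by (rule seg_germ[OF G v(1) T(1) w[symmetric]])
  obtain e2 where e2: "e2 \<in> edges G" "v \<in> e2" "germ v e2 T2" by (rule seg_germ[OF G v(1) T(2) w[symmetric]])
  obtain e3 where e3: "e3 \<in> edges G" "v \<in> e3" "germ v e3 T3" by (rule seg_germ[OF G v(1) T(3) w[symmetric]])
  have "e1 = e2 \<or> e1 = e3 \<or> e2 = e3" using vertex_degree_le_2D[OF v(2)] e1 e2 e3 by blast
  then show ?thesis
    using germ_overlap[OF G e1(1) e1(3), of T2 w] germ_overlap[OF G e1(1) e1(3), of T3 w]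
      germ_overlap[OF G e2(1) e2(3), of T3 w] e2(3) e3(3) by auto
qed

lemma K2_seg:
  assumes "graph G" "is_K2 G" "v \<in> verts G"
  obtains w where "verts G = {v, w}" "v \<noteq> w" "seg (realization G) (Inl v) (Inl w) (topspace (realization G))"
proof -
  obtain a b where ab: "a \<noteq> b" "verts G = {a, b}" "edges G = {{a, b}}" using assms(2) unfolding is_K2_def by blast
  obtain w where w: "verts G = {v, w}" "v \<noteq> w" "edges G = {{v, w}}"
    using ab assms(3) by (metis insertE insert_commute singletonD)
  have e: "{v, w} \<in> edges G" using w by simp
  have "topspace (realization G) \<subseteq> edge_pt {v, w} ` {0..1}"
  proof
    fix p assume "p \<in> topspace (realization G)"
    then consider "p = Inl (tail {v, w})" | "p = Inl (head {v, w})" | t where "p = Inr ({v, w}, t)" "0 < t" "t < 1"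
      unfolding topspace_realization[OF assms(1)] w using tail_head(1)[OF assms(1) e] by auto
    then show "p \<in> edge_pt {v, w} ` {0..1}"
    proof cases
      case 1 then show ?thesis by (intro image_eqI[of _ _ 0]) auto
    next
      case 2 then show ?thesis by (intro image_eqI[of _ _ 1]) auto
    next
      case 3 then show ?thesis by (intro image_eqI[of _ _ t]) (auto simp: edge_pt_interior)
    qed
  qed
  then have "topspace (realization G) = edge_pt {v, w} ` {0..1}"
    using edge_pt_in_topspace[OF assms(1) e] by blast
  then show ?thesis using that[OF w(1,2)] seg_along_edge[OF assms(1) e] by simp
qed

section \<open>Arcs in a link that start at a vertex of low degree\<close>

lemma connected_graph_edge_at:
  assumes G: "connected_graph G" "u \<in> verts G" "v \<in> verts G" "u \<noteq> v"
  obtains w where "{u, w} \<in> edges G"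
proof -
  have "(adjacent G)\<^sup>*\<^sup>* u v" using G by (auto simp: connected_graph_def linked_def)
  then show ?thesis
    by (cases rule: converse_rtranclpE) (use G(4) that in \<open>auto simp: adjacent_def\<close>)
qed

lemma k_connected_2_other_vertex:
  assumes "k_connected 2 G" "v \<in> verts G" obtains w where "w \<in> verts G" "w \<noteq> v"
  using k_connected_2D(2)[OF assms] that by (auto simp: connected_graph_def delete_verts_def)

text \<open>The general argument for \<open>arc_from_point\<close> does not cover K2, but the
  complex of K2 is itself an arc that starts at \<open>v\<close>.\<close>

lemma seg_from_low_degree_vertex:
  assumes G: "graph G" "k_connected 2 G" "n_ac 4 G" and v: "v \<in> verts G" "vertex_degree G v \<le> 2"
    and P: "P \<subseteq> topspace (realization G)" "finite P" "card P \<le> 3"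
  obtains w A where "seg (realization G) (Inl v) w A" "P \<subseteq> A"
proof (cases "is_K2 G")
  case True
  show ?thesis by (rule K2_seg[OF G(1) True v(1)]) (use that P in blast)
next
  case False
  let ?X = "realization G"
  interpret cyclic_space ?X by (rule cyclic_space_realization[OF G(1,2) False])
  obtain u where u: "u \<in> verts G" "u \<noteq> v" by (rule k_connected_2_other_vertex[OF G(2) v(1)])
  obtain w where e: "{v, w} \<in> edges G"
    by (rule connected_graph_edge_at[OF k_connected_2D(1)[OF G(2)] v(1) u(1)]) (use u in auto)
  let ?P = "P - {Inl v}"
  have "infinite ((\<lambda>t. Inr ({v, w}, t) :: 'a + 'a set \<times> real) ` {0<..<1})"
    by (subst finite_image_iff) (auto simp: inj_on_def infinite_Ioo)
  moreover have "(\<lambda>t. Inr ({v, w}, t)) ` {0<..<1} \<subseteq> topspace ?X"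
    using e by (auto simp: topspace_realization[OF G(1)])
  ultimately have "infinite (topspace ?X)" using finite_subset by blast
  then have inf: "infinite (topspace ?X - insert (Inl v) P)" using P(2) by simp
  \<comment> \<open>\<open>arc_from_point\<close> asks for exactly three points other than
    \<open>v\<close>; missing ones are supplied arbitrarily.\<close>
  obtain Q where Q: "finite Q" "card Q = 3 - card ?P" "Q \<subseteq> topspace ?X - insert (Inl v) P"
    using infinite_arbitrarily_large[OF inf] by blast
  have "card ?P \<le> 3" using P(2,3) by (metis card_Diff1_le order_trans)
  moreover have "card (?P \<union> Q) = card ?P + card Q" by (rule card_Un_disjoint) (use P Q in auto)
  ultimately have "card (?P \<union> Q) = 3" using Q by simp
  then obtain p1 p2 p3 where p: "?P \<union> Q = {p1, p2, p3}" "p1 \<noteq> p2" "p1 \<noteq> p3" "p2 \<noteq> p3"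
    unfolding card_3_iff by blast
  have top: "Inl v \<in> topspace ?X" "{p1, p2, p3} \<subseteq> topspace ?X"
    using v P Q unfolding p(1)[symmetric] by (auto simp: topspace_realization[OF G(1)])
  have nv: "Inl v \<notin> {p1, p2, p3}" using Q unfolding p(1)[symmetric] by auto
  have "card {Inl v, p1, p2, p3} \<le> 4" "finite {Inl v, p1, p2, p3}" "{Inl v, p1, p2, p3} \<subseteq> topspace ?X"
    using top by (simp_all add: card_insert_if)
  then obtain a b A where A: "seg ?X a b A" "{Inl v, p1, p2, p3} \<subseteq> A"
    using G(3)[unfolded n_ac_iff_seg[OF G(1)], rule_format, of "{Inl v, p1, p2, p3}"] by blast
  have d: "distinct [Inl v, p1, p2, p3]" using p(2-4) nv by simp
  have top': "p1 \<in> topspace ?X" "p2 \<in> topspace ?X" "p3 \<in> topspace ?X" using top(2) by auto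
  obtain z B where B: "seg ?X (Inl v) z B" "{p1, p2, p3} \<subseteq> B"
    by (rule arc_from_point[OF top(1) top' d A no_triod[OF G(1) v]])
  have "P \<subseteq> insert (Inl v) {p1, p2, p3}" unfolding p(1)[symmetric] by blast
  then have "P \<subseteq> B" using B(2) seg_ends(1)[OF B(1)] by blast
  then show ?thesis by (rule that[OF B(1)])
qed

section \<open>Chains of 4-ac links\<close>

locale link_chain =
  fixes G :: "'a ugraph" and I :: "int set" and L :: "int \<Rightarrow> 'a ugraph" and x :: "int \<Rightarrow> 'a"
  assumes graph: "graph G"
    and links: "chain_graph_links G I L"
    and joint: "\<And>i. i \<in> I \<Longrightarrow> i + 1 \<in> I \<Longrightarrow> verts (L i) \<inter> verts (L (i + 1)) = {x i}"
    and connected2: "\<And>i. i \<in> I \<Longrightarrow> k_connected 2 (L i)"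
    and four_ac: "\<And>i. i \<in> I \<Longrightarrow> n_ac 4 (L i)"
    and interior: "\<And>i. interior_index I i \<Longrightarrow> is_K2 (L i)"
    and degree: "\<And>v i. cut_vertex G v \<Longrightarrow> i \<in> I \<Longrightarrow> v \<in> verts (L i) \<Longrightarrow> vertex_degree (L i) v \<le> 2"
begin

abbreviation T :: "int \<Rightarrow> ('a + 'a set \<times> real) set" where
  "T i \<equiv> topspace (realization (L i))"

lemma interval: "i \<in> I \<Longrightarrow> k \<in> I \<Longrightarrow> i \<le> j \<Longrightarrow> j \<le> k \<Longrightarrow> j \<in> I"
  using links unfolding chain_graph_links_def by (meson atLeastAtMost_iff subsetD)

lemma subgraph_link: "i \<in> I \<Longrightarrow> subgraph (L i) G"
  using links unfolding chain_graph_links_def by blast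

lemma graph_link: "i \<in> I \<Longrightarrow> graph (L i)"
  using subgraph_link unfolding subgraph_def by blast

lemma verts_far: "i \<in> I \<Longrightarrow> j \<in> I \<Longrightarrow> i + 1 < j \<Longrightarrow> verts (L i) \<inter> verts (L j) = {}"
  using links unfolding chain_graph_links_def by blast

lemma verts_union: "verts G = (\<Union>i\<in>I. verts (L i))" and edges_union: "edges G = (\<Union>i\<in>I. edges (L i))"
  using links unfolding chain_graph_links_def by blast+

lemma topspace_union: "topspace (realization G) = (\<Union>i\<in>I. T i)"
proof -
  have "p \<in> T i \<longleftrightarrow> (case p of Inl v \<Rightarrow> v \<in> verts (L i) | Inr (e, t) \<Rightarrow> e \<in> edges (L i) \<and> t \<in> {0<..<1})"
    if "i \<in> I" for i p
    unfolding topspace_realization[OF graph_link[OF that]] by (cases p) auto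
  then have "p \<in> (\<Union>i\<in>I. T i) \<longleftrightarrow>
      (case p of Inl v \<Rightarrow> v \<in> verts G | Inr (e, t) \<Rightarrow> e \<in> edges G \<and> t \<in> {0<..<1})" for p
    unfolding verts_union edges_union by (cases p) auto
  moreover have "p \<in> topspace (realization G) \<longleftrightarrow>
      (case p of Inl v \<Rightarrow> v \<in> verts G | Inr (e, t) \<Rightarrow> e \<in> edges G \<and> t \<in> {0<..<1})" for p
    unfolding topspace_realization[OF graph] by (cases p) auto
  ultimately show ?thesis by (intro set_eqI) (simp only:)
qed

lemma topspace_far:
  assumes ij: "i \<in> I" "j \<in> I" "i + 1 < j" shows "T i \<inter> T j = {}"
proof -
  have "edges (L i) \<inter> edges (L j) = {}"
  proof (rule ccontr)
    assume "\<not> ?thesis"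
    then obtain e where e: "e \<in> edges (L i)" "e \<in> edges (L j)" by blast
    have "tail e \<in> verts (L i)" "tail e \<in> verts (L j)"
      using tail_head(3)[OF graph_link] e ij by blast+
    then show False using verts_far[OF ij] by blast
  qed
  then show ?thesis
    using verts_far[OF ij] unfolding topspace_realization[OF graph_link[OF ij(1)]] topspace_realization[OF graph_link[OF ij(2)]]
    by blast
qed

lemma topspace_consecutive:
  assumes i: "i \<in> I" "i + 1 \<in> I" shows "T i \<inter> T (i + 1) = {Inl (x i)}"
proof -
  have "edges (L i) \<inter> edges (L (i + 1)) = {}"
    using links i unfolding chain_graph_links_def by blast
  then show ?thesis
    using joint[OF i] unfolding topspace_realization[OF graph_link[OF i(1)]] topspace_realization[OF graph_link[OF i(2)]]
    by blast
qed

lemma joint_in: assumes "i \<in> I" "i + 1 \<in> I" shows "x i \<in> verts (L i)" "x i \<in> verts (L (i + 1))"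
  using joint[OF assms] by blast+

text \<open>Makes the degree condition available at the joints. Away from the joint, no edge leads
  from the links up to \<open>i\<close> to the later ones.\<close>

lemma cut_vertex_joint:
  assumes i: "i \<in> I" "i + 1 \<in> I" shows "cut_vertex G (x i)"
proof -
  let ?v = "x i"
  obtain a where a: "a \<in> verts (L i)" "a \<noteq> ?v"
    by (rule k_connected_2_other_vertex[OF connected2[OF i(1)] joint_in(1)[OF i]])
  obtain b where b: "b \<in> verts (L (i + 1))" "b \<noteq> ?v"
    by (rule k_connected_2_other_vertex[OF connected2[OF i(2)] joint_in(2)[OF i]])
  define S where "S = (\<Union>j\<in>{j \<in> I. j \<le> i}. verts (L j)) - {?v}"
  have overlap: "z = ?v" if "z \<in> verts (L j)" "z \<in> verts (L k)" "j \<in> I" "k \<in> I" "j \<le> i" "i < k" for z j k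
  proof (cases "j + 1 < k")
    case True then show ?thesis using verts_far[OF that(3,4)] that(1,2) by blast
  next
    case False
    then have "j = i" "k = i + 1" using that by auto
    then show ?thesis using joint[OF i] that(1,2) by blast
  qed
  have closed: "z \<in> S" if y: "y \<in> S" "adjacent (delete_verts G {?v}) y z" for y z
  proof -
    have e: "{y, z} \<in> edges G" "z \<noteq> ?v" using y(2) by (auto simp: adjacent_def delete_verts_def)
    then obtain k where k: "k \<in> I" "{y, z} \<in> edges (L k)" using edges_union by blast
    have yz: "y \<in> verts (L k)" "z \<in> verts (L k)" using edge_subset[OF graph_link[OF k(1)] k(2)] by auto
    obtain j where j: "j \<in> I" "j \<le> i" "y \<in> verts (L j)" "y \<noteq> ?v" using y(1) unfolding S_def by blast
    have "k \<le> i" using overlap[OF j(3) yz(1) j(1) k(1) j(2)] j(4) by force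
    then show "z \<in> S" using k(1) yz(2) e(2) unfolding S_def by blast
  qed
  have "z \<in> S" if "(adjacent (delete_verts G {?v}))\<^sup>*\<^sup>* a z" for z
    using that
  proof induction
    case base then show ?case using a i unfolding S_def by blast
  next
    case (step y z) then show ?case using closed by blast
  qed
  moreover have "b \<notin> S"
  proof
    assume "b \<in> S"
    then obtain j where "j \<in> I" "j \<le> i" "b \<in> verts (L j)" unfolding S_def by blast
    then show False using overlap[of b j "i + 1"] b i by auto
  qed
  ultimately have "\<not> linked (delete_verts G {?v}) a b" unfolding linked_def by blast
  moreover have "connected_graph G" using links unfolding chain_graph_links_def by blast
  moreover have "a \<in> verts G" "b \<in> verts G" "?v \<in> verts G" using a b joint_in[OF i] i verts_union by blast+
  ultimately show ?thesis using a(2) b(2) unfolding cut_vertex_def connected_graph_def by blast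
qed

text \<open>An interior link is a single edge, so its complex is an arc between its two joints;
  these arcs are appended one by one and cover the links passed.\<close>

lemma seg_to_joint:
  assumes m: "m \<in> I" "n \<in> I" and A: "seg (realization G) z (Inl (x m)) A" "A \<subseteq> T m"
    and k: "m \<le> k" "k < n"
  shows "\<exists>B. seg (realization G) z (Inl (x k)) B \<and> A \<subseteq> B \<and> B \<subseteq> (\<Union>j\<in>{m..k}. T j) \<and> (\<forall>j\<in>{m+1..k}. T j \<subseteq> B)"
  using k
proof (induction k rule: int_ge_induct)
  case base
  then show ?case using A by (intro exI[of _ A]) auto
next
  case (step k)
  then obtain B where B: "seg (realization G) z (Inl (x k)) B" "A \<subseteq> B" "B \<subseteq> (\<Union>j\<in>{m..k}. T j)"
    "\<forall>j\<in>{m+1..k}. T j \<subseteq> B" by auto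
  have kI: "k \<in> I" "k + 1 \<in> I" "k + 2 \<in> I" using interval[OF m] step by auto
  have "interior_index I (k + 1)" 
    unfolding interior_index_def using kI by (intro conjI bexI[of _ k] bexI[of _ "k + 2"]) simp_all
  then have K2: "is_K2 (L (k + 1))" by (rule interior)
  obtain w where w: "verts (L (k + 1)) = {x k, w}" "x k \<noteq> w"
    "seg (realization (L (k + 1))) (Inl (x k)) (Inl w) (T (k + 1))"
    by (rule K2_seg[OF graph_link[OF kI(2)] K2 joint_in(2)[OF kI(1,2)]])
  have kI': "k + 1 + 1 \<in> I" using kI(3) by (simp add: add.assoc)
  \<comment> \<open>The two joints lie in the links \<open>k\<close> and \<open>k + 2\<close>, which
    are disjoint.\<close>
  have "x (k + 1) \<noteq> x k"
    using joint_in(2)[OF kI(2) kI'] joint_in(1)[OF kI(1,2)] verts_far[OF kI(1) kI'] by auto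
  then have xw: "x (k + 1) = w" using joint_in(1)[OF kI(2) kI'] w(1) by blast
  have s: "seg (realization G) (Inl (x k)) (Inl (x (k + 1))) (T (k + 1))"
    using w(3) seg_subgraph_iff[OF graph subgraph_link[OF kI(2)]] xw by simp
  have "T j \<inter> T (k + 1) \<subseteq> {Inl (x k)}" if "j \<in> {m..k}" for j
  proof (cases "j = k")
    case True then show ?thesis using topspace_consecutive[OF kI(1,2)] by simp
  next
    case False
    have "j \<in> I" using interval[OF m(1) kI(1)] that by simp
    then show ?thesis using topspace_far[of j "k + 1"] kI that False by simp
  qed
  then have "B \<inter> T (k + 1) \<subseteq> {Inl (x k)}" using B(3) by blast
  then have i: "B \<inter> T (k + 1) = {Inl (x k)}" using seg_ends(2)[OF B(1)] seg_ends(1)[OF s] by blast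
  show ?case
  proof (intro exI conjI ballI)
    show "seg (realization G) z (Inl (x (k + 1))) (B \<union> T (k + 1))" by (rule seg_join[OF B(1) s i])
    show "A \<subseteq> B \<union> T (k + 1)" using B(2) by blast
    have "{m..k+1} = insert (k + 1) {m..k}" using step(1) by auto
    then show "B \<union> T (k + 1) \<subseteq> (\<Union>j\<in>{m..k+1}. T j)" using B(3) by auto
    fix j assume "j \<in> {m+1..k+1}"
    then show "T j \<subseteq> B \<union> T (k + 1)" using B(4) by (cases "j = k + 1") auto
  qed
qed

text \<open>If no link contains all points, each of the two extreme links used contains at most
  three of them. Arcs from the joints through these points are connected along the interior
  links.\<close>

lemma four_ac_chain: "n_ac 4 G"
  unfolding n_ac_iff_seg[OF graph]
proof (intro allI impI, elim conjE)
  fix P :: "('a + 'a set \<times> real) set"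
  assume P: "P \<subseteq> topspace (realization G)" "finite P" "card P \<le> 4"
  let ?goal = "\<exists>a b A. a \<noteq> b \<and> seg (realization G) a b A \<and> P \<subseteq> A"
  show ?goal
  proof (cases "\<exists>i\<in>I. P \<subseteq> T i")
    case True
    then obtain i where i: "i \<in> I" "P \<subseteq> T i" by blast
    then obtain a b A where "a \<noteq> b" "seg (realization (L i)) a b A" "P \<subseteq> A"
      using four_ac[OF i(1), unfolded n_ac_iff_seg[OF graph_link[OF i(1)]], rule_format, of P] P by blast
    then show ?thesis using seg_subgraph_iff[OF graph subgraph_link[OF i(1)]] by blast
  next
    case False
    \<comment> \<open>A joint lies in two links; \<open>f\<close> selects one link for each
      point.\<close>
    have "\<forall>p\<in>P. \<exists>i\<in>I. p \<in> T i" using P(1) unfolding topspace_union by blast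
    then obtain f where f: "\<And>p. p \<in> P \<Longrightarrow> f p \<in> I" "\<And>p. p \<in> P \<Longrightarrow> p \<in> T (f p)" by metis
    have "I \<noteq> {}" using links unfolding chain_graph_links_def by blast
    then have "P \<noteq> {}" using False by blast
    define m where "m = Min (f ` P)"
    define n where "n = Max (f ` P)"
    have fP: "finite (f ` P)" "f ` P \<noteq> {}" using P(2) \<open>P \<noteq> {}\<close> by auto
    have "m \<in> f ` P" "n \<in> f ` P" unfolding m_def n_def using fP by auto
    then have mn: "m \<in> I" "n \<in> I" using f(1) by auto
    have between: "m \<le> f p" "f p \<le> n" if "p \<in> P" for p
      unfolding m_def n_def using fP that by auto
    have "m \<noteq> n"
    proof
      assume "m = n"
      then have "P \<subseteq> T m" using between f(2) by (metis order_antisym subsetI)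
      then show False using False mn by blast
    qed
    moreover have "m \<le> n" using between \<open>P \<noteq> {}\<close> by fastforce
    ultimately have mn': "m < n" by simp
    have I: "m + 1 \<in> I" "n - 1 \<in> I" using interval[OF mn] mn' by auto
    have n1: "n - 1 + 1 = n" by simp
    have small: "card (P \<inter> T i) \<le> 3" "finite (P \<inter> T i)" if "i \<in> I" for i
    proof -
      have "P \<inter> T i \<subset> P" using False that by blast
      then have "card (P \<inter> T i) < card P" using P(2) by (rule psubset_card_mono[rotated])
      then show "card (P \<inter> T i) \<le> 3" using P(3) by simp
      show "finite (P \<inter> T i)" using P(2) by simp
    qed
    have jm: "x m \<in> verts (L m)" "cut_vertex G (x m)" using joint_in cut_vertex_joint mn(1) I(1) by blast+
    obtain z A where A: "seg (realization (L m)) (Inl (x m)) z A" "P \<inter> T m \<subseteq> A"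
      by (rule seg_from_low_degree_vertex[OF graph_link[OF mn(1)] connected2[OF mn(1)] four_ac[OF mn(1)]
            jm(1) degree[OF jm(2) mn(1) jm(1)] Int_lower2 small(2,1)[OF mn(1)]])
    have jn: "x (n - 1) \<in> verts (L n)" "cut_vertex G (x (n - 1))"
      using joint_in(2)[OF I(2)] cut_vertex_joint[OF I(2)] mn(2) unfolding n1 by blast+
    obtain z' B where B: "seg (realization (L n)) (Inl (x (n - 1))) z' B" "P \<inter> T n \<subseteq> B"
      by (rule seg_from_low_degree_vertex[OF graph_link[OF mn(2)] connected2[OF mn(2)] four_ac[OF mn(2)]
            jn(1) degree[OF jn(2) mn(2) jn(1)] Int_lower2 small(2,1)[OF mn(2)]])
    have A': "seg (realization G) z (Inl (x m)) A" "A \<subseteq> T m"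
      using seg_sym[OF A(1)] seg_subgraph_iff[OF graph subgraph_link[OF mn(1)]] by blast+
    have B': "seg (realization G) (Inl (x (n - 1))) z' B" "B \<subseteq> T n"
      using B(1) seg_subgraph_iff[OF graph subgraph_link[OF mn(2)]] by blast+
    obtain C where C: "seg (realization G) z (Inl (x (n - 1))) C" "A \<subseteq> C" "C \<subseteq> (\<Union>j\<in>{m..n - 1}. T j)"
      "\<forall>j\<in>{m+1..n - 1}. T j \<subseteq> C"
      using seg_to_joint[OF mn A', of "n - 1"] mn' by auto
    have "T j \<inter> T n \<subseteq> {Inl (x (n - 1))}" if "j \<in> {m..n - 1}" for j
    proof (cases "j = n - 1")
      case True then show ?thesis using topspace_consecutive[of "n - 1"] I mn by simp
    next
      case False
      have "j \<in> I" using interval[OF mn] that by simp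
      then show ?thesis using topspace_far[of j n] mn that False by simp
    qed
    then have "C \<inter> B \<subseteq> {Inl (x (n - 1))}" using C(3) B'(2) by blast
    then have i: "C \<inter> B = {Inl (x (n - 1))}" using seg_ends(2)[OF C(1)] seg_ends(1)[OF B'(1)] by blast
    have s: "seg (realization G) z z' (C \<union> B)" by (rule seg_join[OF C(1) B'(1) i])
    have PCB: "P \<subseteq> C \<union> B"
    proof
      fix p assume p: "p \<in> P"
      consider "f p = m" | "f p = n" | "f p \<in> {m+1..n - 1}" using between[OF p] by force
      then show "p \<in> C \<union> B" using f(2)[OF p] p A(2) B(2) C(2,4) by cases blast+
    qed
    \<comment> \<open>\<open>seg\<close> admits one-point arcs, so the ends have to be shown
      distinct; otherwise all points would lie in the link \<open>m\<close>.\<close>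
    have "z \<noteq> z'"
    proof
      assume "z = z'"
      then have "C \<union> B = {z}" using seg_degenerate s by metis
      then have "P \<subseteq> {z}" using PCB by simp
      then have "P \<subseteq> T m" using seg_ends(1)[OF A'(1)] A'(2) by blast
      then show False using False mn by blast
    qed
    with s PCB show ?thesis by (intro exI conjI)
  qed
qed

end

lemma n_ac_4_if_chain:
  assumes "graph G" "chain_graph_links G I L" "\<forall>i\<in>I. k_connected 2 (L i) \<and> n_ac 4 (L i)"
    "\<forall>i. interior_index I i \<longrightarrow> is_K2 (L i)"
    "\<forall>v i. cut_vertex G v \<and> i \<in> I \<and> v \<in> verts (L i) \<longrightarrow> vertex_degree (L i) v \<le> 2"
  shows "n_ac 4 G"
proof -
  define x where "x i = (SOME v. verts (L i) \<inter> verts (L (i + 1)) = {v})" for i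
  have x: "verts (L i) \<inter> verts (L (i + 1)) = {x i}" if "i \<in> I" "i + 1 \<in> I" for i
  proof -
    have "\<exists>v. verts (L i) \<inter> verts (L (i + 1)) = {v}"
      using assms(2) that unfolding chain_graph_links_def by blast
    then show ?thesis unfolding x_def by (rule someI_ex)
  qed
  interpret link_chain G I L x
  proof (rule link_chain.intro[OF assms(1,2)])
    show "verts (L i) \<inter> verts (L (i + 1)) = {x i}" if "i \<in> I" "i + 1 \<in> I" for i
      by (rule x[OF that])
  qed (use assms(3-5) in blast)+
  show ?thesis by (rule four_ac_chain)
qed

section \<open>Separation by a cut vertex\<close>

definition induced :: "'a ugraph \<Rightarrow> 'a set \<Rightarrow> 'a ugraph" where
  "induced G S = \<lparr>verts = verts G \<inter> S, edges = {e \<in> edges G. e \<subseteq> S}\<rparr>"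

text \<open>\<open>C\<close> is a union of components of \<open>G - W\<close>.\<close>

definition piece :: "'a ugraph \<Rightarrow> 'a set \<Rightarrow> 'a set \<Rightarrow> bool" where
  "piece G W C \<longleftrightarrow> C \<subseteq> verts G - W \<and> (\<forall>e\<in>edges G. e \<inter> C \<noteq> {} \<longrightarrow> e \<subseteq> W \<union> C)"

text \<open>Open for every \<open>C\<close>. If \<open>C\<close> is a piece, it becomes closed on
  adding the points of \<open>W\<close>, so connected sets leave it only through
  \<open>W\<close>.\<close>

definition region :: "'a ugraph \<Rightarrow> 'a set \<Rightarrow> ('a + 'a set \<times> real) set" where
  "region G C = {p \<in> topspace (realization G). case p of Inl v \<Rightarrow> v \<in> C | Inr (e, t) \<Rightarrow> e \<inter> C \<noteq> {}}"

lemma induced_simps [simp]: "verts (induced G S) = verts G \<inter> S" "edges (induced G S) = {e \<in> edges G. e \<subseteq> S}"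
  by (simp_all add: induced_def)

lemma graph_induced: "graph G \<Longrightarrow> graph (induced G S)"
  unfolding graph_def nsets_def induced_def by auto

lemma subgraph_induced: "graph G \<Longrightarrow> subgraph (induced G S) G"
  using graph_induced[of G S] by (auto simp: subgraph_def)

lemma delete_verts_eq_induced: "graph G \<Longrightarrow> delete_verts G W = induced G (verts G - W)"
  using edge_subset[of G] by (auto simp: delete_verts_def induced_def)

lemma delete_verts_induced: "graph G \<Longrightarrow> S \<subseteq> verts G \<Longrightarrow> delete_verts (induced G S) W = induced G (S - W)"
  by (auto simp: delete_verts_def induced_def)

section \<open>Linked vertices in induced subgraphs\<close>

lemma linked_refl: "v \<in> verts G \<Longrightarrow> linked G v v"
  by (simp add: linked_def)

lemma linked_sym: "linked G u v \<Longrightarrow> linked G v u"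
proof -
  have "symp (adjacent G)" by (auto simp: symp_def adjacent_def insert_commute)
  then have "symp (adjacent G)\<^sup>*\<^sup>*" by (rule symp_rtranclp)
  then show "linked G u v \<Longrightarrow> linked G v u" by (auto simp: linked_def dest: sympD)
qed

lemma linked_trans: "linked G u v \<Longrightarrow> linked G v w \<Longrightarrow> linked G u w"
  unfolding linked_def by auto

lemma linked_edge: "graph G \<Longrightarrow> {u, v} \<in> edges G \<Longrightarrow> linked G u v"
  using edge_subset[of G "{u, v}"] by (auto simp: linked_def adjacent_def)

lemma linked_induced_mono:
  assumes "linked (induced G S) u v" "S \<subseteq> T" shows "linked (induced G T) u v"
proof -
  have "(adjacent (induced G S))\<^sup>*\<^sup>* \<le> (adjacent (induced G T))\<^sup>*\<^sup>*"
    by (rule rtranclp_mono) (use assms(2) in \<open>auto simp: adjacent_def\<close>)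
  then show ?thesis using assms by (auto simp: linked_def)
qed

lemma connected_graphI:
  assumes "v \<in> verts G" "\<And>u. u \<in> verts G \<Longrightarrow> linked G u v"
  shows "connected_graph G"
  unfolding connected_graph_def using assms linked_sym linked_trans by (metis empty_iff)

lemma connected_graphD: "connected_graph G \<Longrightarrow> u \<in> verts G \<Longrightarrow> v \<in> verts G \<Longrightarrow> linked G u v"
  unfolding connected_graph_def by blast

lemma piece_vertex: "piece G W C \<Longrightarrow> u \<in> C \<Longrightarrow> u \<in> verts G \<and> u \<notin> W"
  unfolding piece_def by blast

lemma piece_edge: "piece G W C \<Longrightarrow> e \<in> edges G \<Longrightarrow> u \<in> e \<Longrightarrow> u \<in> C \<Longrightarrow> e \<subseteq> W \<union> C"
  unfolding piece_def by blast

lemma Inl_in_region: "graph G \<Longrightarrow> Inl v \<in> region G C \<longleftrightarrow> v \<in> verts G \<and> v \<in> C"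
  by (auto simp: region_def topspace_realization)

lemma Inr_in_region: "graph G \<Longrightarrow> Inr (e, t) \<in> region G C \<longleftrightarrow> e \<in> edges G \<and> 0 < t \<and> t < 1 \<and> e \<inter> C \<noteq> {}"
  by (auto simp: region_def topspace_realization)

lemma openin_region:
  assumes G: "graph G" shows "openin (realization G) (region G C)"
  unfolding openin_realization[OF G]
proof (intro conjI ballI)
  show "region G C \<subseteq> topspace (realization G)" by (auto simp: region_def)
  fix e assume e: "e \<in> edges G"
  have "{t \<in> {0..1}. edge_pt e t \<in> region G C} =
      (if e \<inter> C = {} then {} else {0..1} \<inter> ((if tail e \<in> C then UNIV else {0<..}) \<inter> (if head e \<in> C then UNIV else {..<1})))"
    using e mem_edge_iff[OF G e] tail_head(3,4)[OF G e]
    by (auto simp: edge_pt_def Inl_in_region[OF G] Inr_in_region[OF G] split: if_splits)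
  moreover have "open ((if tail e \<in> C then UNIV else {0<..}) \<inter> (if head e \<in> C then UNIV else {..<1::real}))"
    by auto
  ultimately show "openin (top_of_set {0..1}) {t \<in> {0..1}. edge_pt e t \<in> region G C}"
    by (simp add: openin_open_Int)
qed

lemma closedin_region:
  assumes G: "graph G" and W: "W \<subseteq> verts G" and C: "piece G W C"
  shows "closedin (realization G) (region G C \<union> Inl ` W)"
  unfolding closedin_realization[OF G]
proof (intro conjI ballI)
  show "region G C \<union> Inl ` W \<subseteq> topspace (realization G)"
    using W by (auto simp: region_def topspace_realization[OF G])
  fix e assume e: "e \<in> edges G"
  show "closed {t \<in> {0..1}. edge_pt e t \<in> region G C \<union> Inl ` W}"
  proof (cases "e \<inter> C = {}")
    case True
    then have "{t \<in> {0..1}. edge_pt e t \<in> region G C \<union> Inl ` W} \<subseteq> {0, 1}"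
      by (auto simp: edge_pt_def Inr_in_region[OF G])
    then show ?thesis by (meson finite.emptyI finite_insert finite_subset finite_imp_closed)
  next
    case False
    then have "e \<subseteq> W \<union> C" using C e unfolding piece_def by blast
    then have "tail e \<in> W \<union> C" "head e \<in> W \<union> C" using mem_edge_iff[OF G e] by blast+
    then have "edge_pt e t \<in> region G C \<union> Inl ` W" if "t \<in> {0..1}" for t
      using that e False tail_head(3,4)[OF G e]
      by (cases "t = 0"; cases "t = 1") (auto simp: edge_pt_def Inl_in_region[OF G] Inr_in_region[OF G])
    then have "{t \<in> {0..1}. edge_pt e t \<in> region G C \<union> Inl ` W} = {0..1}" by blast
    then show ?thesis by simp
  qed
qed

text \<open>Outside \<open>W\<close>, the region of a piece is both open and closed.\<close>

lemma connected_in_region: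
  assumes G: "graph G" and W: "W \<subseteq> verts G" and C: "piece G W C"
    and T: "connectedin (realization G) T" "T \<inter> Inl ` W = {}" "p \<in> T" "p \<in> region G C"
  shows "T \<subseteq> region G C"
proof (rule ccontr)
  assume n: "\<not> T \<subseteq> region G C"
  let ?V = "topspace (realization G) - (region G C \<union> Inl ` W)"
  have Ts: "T \<subseteq> topspace (realization G)" by (rule connectedin_subset_topspace[OF T(1)])
  have "openin (realization G) ?V" using closedin_region[OF G W C] by blast
  moreover have "T \<subseteq> region G C \<union> ?V" using Ts T(2) by blast
  moreover have "region G C \<inter> ?V \<inter> T = {}" by blast
  moreover have "region G C \<inter> T \<noteq> {}" using T by blast
  moreover have "?V \<inter> T \<noteq> {}" using n Ts T(2) by blast
  ultimately show False by (rule connectedinD[OF T(1) openin_region[OF G]])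
qed

lemma connected_in_region_singleton:
  assumes "graph G" "v \<in> verts G" "piece G {v} C" "connectedin (realization G) T" "Inl v \<notin> T" "p \<in> T" "p \<in> region G C"
  shows "T \<subseteq> region G C"
  by (rule connected_in_region[OF assms(1) _ assms(3,4) _ assms(6,7)]) (use assms(2,5) in auto)

lemma n_ac_4_seg:
  assumes "graph G" "n_ac 4 G" "P \<subseteq> topspace (realization G)" "finite P" "card P \<le> 4"
  obtains a b A where "a \<noteq> b" "seg (realization G) a b A" "P \<subseteq> A"
  using assms(2)[unfolded n_ac_iff_seg[OF assms(1)], rule_format, OF conjI[OF assms(3) conjI[OF assms(4,5)]]] that
  by blast

text \<open>The vertices linked to \<open>u\<close> form a piece for the empty separator, and an arc
  through \<open>u\<close> and \<open>v\<close> cannot leave its region.\<close>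

lemma n_ac_4_connected:
  assumes G: "graph G" "n_ac 4 G"
  shows "connected_graph G" "\<And>v. verts G \<noteq> {v}"
proof -
  \<comment> \<open>Even without prescribed points there is an arc, so the complex has at least two
    points.\<close>
  obtain a b A where A: "a \<noteq> b" "seg (realization G) a b A" by (rule n_ac_4_seg[OF G, of "{}"]) auto
  then have ab: "a \<in> topspace (realization G)" "b \<in> topspace (realization G)"
    using seg_ends[OF A(2)] seg_subset[OF A(2)] by auto
  have ne: "\<exists>v. v \<in> verts G" using ab(1) tail_head(3)[OF G(1)] unfolding topspace_realization[OF G(1)] by blast
  then obtain v where v: "v \<in> verts G" by blast
  have "linked G u v" if u: "u \<in> verts G" for u
  proof -
    define D where "D = {w \<in> verts G. linked G u w}"
    have "e \<subseteq> D" if e: "e \<in> edges G" "e \<inter> D \<noteq> {}" for e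
    proof -
      obtain w where w: "w \<in> e" "w \<in> D" using e(2) by blast
      obtain w' where e': "e = {w, w'}" by (rule edge_obtain[OF G(1) e(1) w(1)])
      have "linked G w w'" using linked_edge[OF G(1)] e(1) e' by blast
      then have "w' \<in> D" using w(2) linked_trans unfolding D_def by (auto simp: linked_def)
      then show ?thesis using w e' by blast
    qed
    then have D: "piece G {} D" unfolding piece_def D_def by auto
    have "{Inl u, Inl v} \<subseteq> topspace (realization G)" using u v by (auto simp: topspace_realization[OF G(1)])
    then obtain a b B where B: "seg (realization G) a b B" "{Inl u, Inl v} \<subseteq> B"
      by (rule n_ac_4_seg[OF G]) (auto simp: card_insert_if)
    have "Inl u \<in> region G D" using u linked_refl by (auto simp: Inl_in_region[OF G(1)] D_def)
    then have "B \<subseteq> region G D" using connected_in_region[OF G(1) _ D seg_connected[OF B(1)]] B(2) by blast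
    then have "Inl v \<in> region G D" using B(2) by blast
    then show ?thesis by (auto simp: Inl_in_region[OF G(1)] D_def)
  qed
  then show "connected_graph G" by (rule connected_graphI[OF v])
  show "verts G \<noteq> {v}" for v
  proof
    assume V: "verts G = {v}"
    have "edges G = {}"
    proof (rule equals0I)
      fix e assume "e \<in> edges G"
      from tail_head(2-4)[OF G(1) this] show False unfolding V by simp
    qed
    then have "topspace (realization G) = {Inl v}" using V by (simp add: topspace_realization[OF G(1)])
    then show False using A(1) ab by simp
  qed
qed

lemma piece_complement:
  assumes G: "graph G" and C: "piece G {v} C" shows "piece G {v} (verts G - {v} - C)"
  unfolding piece_def
proof (intro conjI ballI impI)
  fix e assume e: "e \<in> edges G" "e \<inter> (verts G - {v} - C) \<noteq> {}"
  have "e \<inter> C = {}"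
  proof (rule ccontr)
    assume "e \<inter> C \<noteq> {}"
    then have "e \<subseteq> {v} \<union> C" using C e(1) unfolding piece_def by blast
    then show False using e(2) by blast
  qed
  then show "e \<subseteq> {v} \<union> (verts G - {v} - C)" using edge_subset[OF G e(1)] by blast
qed blast

lemma seg_through:
  assumes "seg X a b A" "c \<in> A" "p \<in> A"
  obtains s t A1 A2 where "seg X s c A1" "seg X c t A2" "A1 \<union> A2 = A" "A1 \<inter> A2 = {c}" "p \<in> A1"
proof -
  obtain A1 A2 where A: "seg X a c A1" "seg X c b A2" "A1 \<union> A2 = A" "A1 \<inter> A2 = {c}"
    by (rule seg_split[OF assms(1,2)])
  show ?thesis
  proof (cases "p \<in> A1")
    case True show ?thesis by (rule that[OF A True])
  next
    case False
    then have p: "p \<in> A2" using A(3) assms(3) by blast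
    have u: "A2 \<union> A1 = A" "A2 \<inter> A1 = {c}" using A(3,4) by (simp_all add: Un_commute Int_commute)
    show ?thesis by (rule that[OF seg_sym[OF A(2)] seg_sym[OF A(1)] u p])
  qed
qed

text \<open>Removing \<open>v\<close> from an arc leaves at most two connected parts, and a
  connected set that misses \<open>v\<close> cannot meet two pieces.\<close>

lemma no_three_pieces:
  assumes G: "graph G" "n_ac 4 G" and v: "v \<in> verts G"
    and C: "piece G {v} C1" "piece G {v} C2" "piece G {v} C3"
    and a: "a1 \<in> C1" "a2 \<in> C2" "a3 \<in> C3" and d: "C1 \<inter> C2 = {}" "C1 \<inter> C3 = {}" "C2 \<inter> C3 = {}"
  shows False
proof -
  let ?X = "realization G"
  have av: "a1 \<in> verts G" "a2 \<in> verts G" "a3 \<in> verts G" "a1 \<noteq> v" "a2 \<noteq> v" "a3 \<noteq> v"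
    using piece_vertex[OF C(1) a(1)] piece_vertex[OF C(2) a(2)] piece_vertex[OF C(3) a(3)] by auto
  then have "{Inl a1, Inl a2, Inl a3} \<subseteq> topspace ?X" by (simp add: topspace_realization[OF G(1)])
  then obtain s t A where A: "seg ?X s t A" "{Inl a1, Inl a2, Inl a3} \<subseteq> A"
    by (rule n_ac_4_seg[OF G]) (auto simp: card_insert_if)
  have sep: "\<not> (Inl x \<in> T \<and> Inl y \<in> T)"
    if "connectedin ?X T" "Inl v \<notin> T" "piece G {v} C" "x \<in> C" "y \<notin> C" for T C x y
  proof
    assume xy: "Inl x \<in> T \<and> Inl y \<in> T"
    have "Inl x \<in> region G C" using that(3,4) unfolding piece_def Inl_in_region[OF G(1)] by blast
    then have "T \<subseteq> region G C" using connected_in_region_singleton[OF G(1) v that(3,1,2)] xy by blast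
    then show False using xy that(5) Inl_in_region[OF G(1)] by blast
  qed
  have n: "a2 \<notin> C1" "a3 \<notin> C1" "a3 \<notin> C2" using a d by blast+
  have two: "\<not> (Inl a1 \<in> T \<and> Inl a2 \<in> T) \<and> \<not> (Inl a1 \<in> T \<and> Inl a3 \<in> T) \<and> \<not> (Inl a2 \<in> T \<and> Inl a3 \<in> T)"
    if "connectedin ?X T" "Inl v \<notin> T" for T
    using sep[OF that C(1) a(1) n(1)] sep[OF that C(1) a(1) n(2)] sep[OF that C(2) a(2) n(3)] by argo
  show False
  proof (cases "Inl v \<in> A")
    case False
    then show False using two[OF seg_connected[OF A(1)]] A(2) by simp
  next
    case True
    obtain A1 A2 where S: "seg ?X s (Inl v) A1" "seg ?X (Inl v) t A2" "A1 \<union> A2 = A" "A1 \<inter> A2 = {Inl v}"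
      by (rule seg_split[OF A(1) True])
    have c: "connectedin ?X (A1 - {Inl v})" "connectedin ?X (A2 - {Inl v})"
      using seg_connected_minus_end[OF S(1)] seg_connected_minus_end[OF seg_sym[OF S(2)]] by auto
    have m: "Inl a \<in> A1 - {Inl v} \<or> Inl a \<in> A2 - {Inl v}" if "Inl a \<in> A" "a \<noteq> v" for a
      using that S(3) by auto
    have in12: "Inl a1 \<in> A1 - {Inl v} \<or> Inl a1 \<in> A2 - {Inl v}"
      "Inl a2 \<in> A1 - {Inl v} \<or> Inl a2 \<in> A2 - {Inl v}"
      "Inl a3 \<in> A1 - {Inl v} \<or> Inl a3 \<in> A2 - {Inl v}"
      using m A(2) av(4-6) by simp_all
    have "Inl v \<notin> A1 - {Inl v}" "Inl v \<notin> A2 - {Inl v}" by auto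
    then show False using in12 two[OF c(1)] two[OF c(2)] by argo
  qed
qed

text \<open>Otherwise the vertices linked to \<open>a\<close> within \<open>C\<close>, the rest of
  \<open>C\<close>, and the other vertices beyond \<open>v\<close> would be three pieces.\<close>

lemma piece_connected:
  assumes G: "graph G" "n_ac 4 G" and v: "v \<in> verts G" and C: "piece G {v} C" and n: "verts G - {v} - C \<noteq> {}"
    and ab: "a \<in> C" "b \<in> C"
  shows "linked (induced G C) a b"
proof (rule ccontr)
  assume nl: "\<not> linked (induced G C) a b"
  have CV: "C \<subseteq> verts G - {v}" using C unfolding piece_def by blast
  define D where "D = {u \<in> C. linked (induced G C) a u}"
  have eD: "e \<subseteq> {v} \<union> D" if e: "e \<in> edges G" "e \<inter> D \<noteq> {}" for e
  proof
    fix w assume w: "w \<in> e"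
    obtain u where u: "u \<in> e" "u \<in> D" using e(2) by blast
    have eC: "e \<subseteq> {v} \<union> C" using C e(1) u unfolding piece_def D_def by blast
    obtain u' where u': "e = {u, u'}" by (rule edge_obtain[OF G(1) e(1) u(1)])
    show "w \<in> {v} \<union> D"
    proof (cases "w = v \<or> w = u")
      case True then show ?thesis using u by blast
    next
      case False
      then have "w = u'" "w \<in> C" using w u' eC by blast+
      then have "{u, w} \<in> edges (induced G C)" using e(1) u' u(2) unfolding D_def by simp
      then have uw: "linked (induced G C) u w" by (rule linked_edge[OF graph_induced[OF G(1)]])
      have "linked (induced G C) a u" using u(2) unfolding D_def by blast
      from linked_trans[OF this uw] show ?thesis using \<open>w \<in> C\<close> unfolding D_def by blast
    qed
  qed
  then have D: "piece G {v} D" using CV unfolding piece_def D_def by blast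
  have D': "piece G {v} (C - D)"
    unfolding piece_def
  proof (intro conjI ballI impI)
    fix e assume e: "e \<in> edges G" "e \<inter> (C - D) \<noteq> {}"
    then have eC: "e \<subseteq> {v} \<union> C" using C unfolding piece_def by blast
    have "e \<inter> D = {}"
    proof (rule ccontr)
      assume "e \<inter> D \<noteq> {}"
      then have "e \<subseteq> {v} \<union> D" by (rule eD[OF e(1)])
      then show False using e(2) CV by blast
    qed
    then show "e \<subseteq> {v} \<union> (C - D)" using eC by blast
  qed (use CV in blast)
  have "a \<in> D" using ab CV linked_refl[of a "induced G C"] unfolding D_def by auto
  moreover have "b \<in> C - D" using ab nl unfolding D_def by blast
  moreover obtain c where "c \<in> verts G - {v} - C" using n by blast
  ultimately show False
    by (rule no_three_pieces[OF G v D D' piece_complement[OF G(1) C]]) (auto simp: D_def)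
qed

text \<open>Split the arc at the inner point of \<open>e\<close>. Each part contains one of the two
  parts of \<open>e\<close>, and not the same one, as the parts of the arc share only this point; so
  both ends of \<open>e\<close> are covered.\<close>

lemma seg_covers_edge:
  assumes G: "graph G" and e: "e \<in> edges G" "v \<in> e" and T: "seg (realization G) p r T"
    and pr: "p \<notin> edge_pt e ` {0<..<1}" "r \<notin> edge_pt e ` {0<..<1}"
    and s: "edge_pt e s \<in> T" "0 < s" "s < 1"
  shows "Inl v \<in> T"
proof -
  obtain T1 T2 where S: "seg (realization G) p (edge_pt e s) T1" "seg (realization G) (edge_pt e s) r T2"
    "T1 \<union> T2 = T" "T1 \<inter> T2 = {edge_pt e s}"
    by (rule seg_split[OF T s(1)])
  have es: "edge_pt e s \<in> T1" "edge_pt e s \<in> T2" "p \<in> T1" "r \<in> T2"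
    using seg_ends[OF S(1)] seg_ends[OF S(2)] by auto
  have h1: "edge_pt e ` {0..s} \<subseteq> T1 \<or> edge_pt e ` {s..1} \<subseteq> T1"
    by (rule connected_half_edge[OF G e(1) seg_connected[OF S(1)] es(1) s(2,3) es(3) pr(1)])
  have h2: "edge_pt e ` {0..s} \<subseteq> T2 \<or> edge_pt e ` {s..1} \<subseteq> T2"
    by (rule connected_half_edge[OF G e(1) seg_connected[OF S(2)] es(2) s(2,3) es(4) pr(2)])
  have i: "inj_on (edge_pt e) {0..1}" by (rule inj_on_edge_pt[OF G e(1)])
  have "edge_pt e 0 \<noteq> edge_pt e s" "edge_pt e 1 \<noteq> edge_pt e s"
    using inj_onD[OF i, of 0 s] inj_onD[OF i, of 1 s] s by auto
  then have nn: "\<not> (edge_pt e 0 \<in> T1 \<and> edge_pt e 0 \<in> T2)" "\<not> (edge_pt e 1 \<in> T1 \<and> edge_pt e 1 \<in> T2)"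
    using S(4) by blast+
  have "edge_pt e 0 \<in> edge_pt e ` {0..s}" "edge_pt e 1 \<in> edge_pt e ` {s..1}"
    using s by (auto intro!: imageI simp del: edge_pt_simps)
  then have "edge_pt e 0 \<in> T" "edge_pt e 1 \<in> T" using h1 h2 nn S(3) by blast+
  then show ?thesis using mem_edge_iff[OF G e(1), of v] e(2) by auto
qed

text \<open>A marker on the edge: by \<open>seg_covers_edge\<close>, an arc through it with both
  ends outside the interior of the edge visits both endvertices.\<close>

abbreviation edge_midpoint :: "'a set \<Rightarrow> 'a + 'a set \<times> real" where
  "edge_midpoint e \<equiv> edge_pt e (1/2)"

lemma edge_midpoint_in_interior: "edge_midpoint e \<in> edge_pt e' ` {0<..<1} \<longleftrightarrow> e = e'"
  by (auto simp: edge_pt_def image_iff intro!: bexI[of _ "1/2"])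

lemma Inl_notin_interior: "Inl v \<notin> edge_pt e ` {0<..<1}"
  by (auto simp: edge_pt_def)

section \<open>The two sides of a cut vertex\<close>

text \<open>One of the two parts at a cut vertex. Connectedness of \<open>C\<close> is a consequence
  in a 4-ac graph, see \<open>piece_connected\<close>.\<close>

definition side :: "'a ugraph \<Rightarrow> 'a \<Rightarrow> 'a set \<Rightarrow> bool" where
  "side G v C \<longleftrightarrow> v \<in> verts G \<and> piece G {v} C \<and> C \<noteq> {} \<and> verts G - {v} - C \<noteq> {}"

definition edge_graph :: "'a \<Rightarrow> 'a \<Rightarrow> 'a ugraph" where
  "edge_graph v w = \<lparr>verts = {v, w}, edges = {{v, w}}\<rparr>"

lemma edge_graph_simps [simp]: "verts (edge_graph v w) = {v, w}" "edges (edge_graph v w) = {{v, w}}"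
  by (simp_all add: edge_graph_def)

lemma graph_edge_graph: "v \<noteq> w \<Longrightarrow> graph (edge_graph v w)"
  by (auto simp: graph_def nsets_def)

lemma is_K2_edge_graph: "v \<noteq> w \<Longrightarrow> is_K2 (edge_graph v w)"
  by (auto simp: is_K2_def)

lemma k_connected_edge_graph:
  assumes "v \<noteq> w" shows "k_connected 2 (edge_graph v w)"
  unfolding k_connected_def
proof (intro allI impI, elim conjE)
  fix W assume W: "W \<subseteq> verts (edge_graph v w)" "finite W" "card W < 2"
  have g: "graph (edge_graph v w)" by (rule graph_edge_graph[OF assms])
  have "card {v, w} = 2" using assms by simp
  then have "W \<noteq> {v, w}" using W(3) by auto
  then consider "W = {}" | "W = {v}" | "W = {w}" using W(1) by auto
  then show "connected_graph (delete_verts (edge_graph v w) W)"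
  proof cases
    case 1
    show ?thesis unfolding 1 delete_verts_empty
      by (rule connected_graphI[of v]) (use linked_refl[of v] linked_sym linked_edge[OF g, of w v] in \<open>auto simp: insert_commute\<close>)
  next
    case 2
    have "verts (delete_verts (edge_graph v w) W) = {w}" using 2 assms by (auto simp: delete_verts_def)
    then show ?thesis by (intro connected_graphI[of w]) (auto intro: linked_refl)
  next
    case 3
    have "verts (delete_verts (edge_graph v w) W) = {v}" using 3 assms by (auto simp: delete_verts_def)
    then show ?thesis by (intro connected_graphI[of v]) (auto intro: linked_refl)
  qed
qed

lemma n_ac_edge_graph:
  assumes "v \<noteq> w" shows "n_ac n (edge_graph v w)"
proof -
  have g: "graph (edge_graph v w)" by (rule graph_edge_graph[OF assms])
  obtain u where u: "verts (edge_graph v w) = {v, u}" "v \<noteq> u"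
    "seg (realization (edge_graph v w)) (Inl v) (Inl u) (topspace (realization (edge_graph v w)))"
    by (rule K2_seg[OF g is_K2_edge_graph[OF assms], of v]) simp
  have ne: "Inl v \<noteq> Inl u" using u(2) by simp
  show ?thesis unfolding n_ac_iff_seg[OF g]
  proof (intro allI impI, elim conjE)
    fix P assume "P \<subseteq> topspace (realization (edge_graph v w))"
    with ne u(3) show "\<exists>a b A. a \<noteq> b \<and> seg (realization (edge_graph v w)) a b A \<and> P \<subseteq> A"
      by (intro exI conjI)
  qed
qed

lemma vertex_degree_edge_graph: "vertex_degree (edge_graph v w) u \<le> 2"
proof -
  have s: "{e \<in> edges (edge_graph v w). u \<in> e} \<subseteq> {{v, w}}" by auto
  then have "finite {e \<in> edges (edge_graph v w). u \<in> e}" by (rule finite_subset) simp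
  moreover have "card {e \<in> edges (edge_graph v w). u \<in> e} \<le> card {{v, w}}" by (rule card_mono[OF _ s]) simp
  ultimately show ?thesis unfolding vertex_degree_le_2_iff by simp
qed

text \<open>Since \<open>S\<close> communicates with the rest of the graph only through
  \<open>v\<close>, the vertices of \<open>S - {y}\<close> not linked to \<open>v\<close> are
  separated by \<open>y\<close> in the whole graph and not merely in the induced subgraph.\<close>

lemma unlinked_piece:
  assumes G: "graph G" and S: "S \<subseteq> verts G" "\<And>e u. e \<in> edges G \<Longrightarrow> u \<in> e \<Longrightarrow> u \<in> S - {v} \<Longrightarrow> e \<subseteq> S"
    and v: "v \<in> S" "v \<noteq> y"
    and n: "\<not> connected_graph (induced G (S - {y}))"
  obtains D where "piece G {y} D" "D \<noteq> {}" "D \<subseteq> S - {y}" "v \<notin> D"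
proof -
  let ?D = "{u \<in> S - {y}. \<not> linked (induced G (S - {y})) v u}"
  have "piece G {y} ?D"
    unfolding piece_def
  proof (intro conjI ballI impI)
    show "?D \<subseteq> verts G - {y}" using S(1) by blast
    fix e assume e: "e \<in> edges G" "e \<inter> ?D \<noteq> {}"
    then obtain u where u: "u \<in> e" "u \<in> S" "u \<noteq> y" "\<not> linked (induced G (S - {y})) v u" by blast
    have "u \<noteq> v" using u(4) linked_refl[of v "induced G (S - {y})"] v S(1) by auto
    then have eS: "e \<subseteq> S" using S(2)[OF e(1) u(1)] u(2) by blast
    obtain w where w: "e = {u, w}" by (rule edge_obtain[OF G e(1) u(1)])
    show "e \<subseteq> {y} \<union> ?D"
    proof (cases "w = y")
      case True then show ?thesis using w u by blast
    next
      case False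
      then have "{w, u} \<in> edges (induced G (S - {y}))" using e(1) w eS u by (auto simp: insert_commute)
      then have wu: "linked (induced G (S - {y})) w u" by (rule linked_edge[OF graph_induced[OF G]])
      have "\<not> linked (induced G (S - {y})) v w" using linked_trans[OF _ wu] u(4) by blast
      then show ?thesis using w u eS False by blast
    qed
  qed
  moreover have "?D \<noteq> {}"
  proof
    assume D: "?D = {}"
    have "connected_graph (induced G (S - {y}))"
    proof (rule connected_graphI[of v])
      show "v \<in> verts (induced G (S - {y}))" using v S(1) by auto
      fix u assume "u \<in> verts (induced G (S - {y}))"
      then have "u \<in> S - {y}" by simp
      then have "linked (induced G (S - {y})) v u" using D by blast
      then show "linked (induced G (S - {y})) u v" by (rule linked_sym)
    qed
    then show False using n by blast
  qed
  moreover have "v \<notin> ?D" using linked_refl[of v "induced G (S - {y})"] v S(1) by auto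
  ultimately show ?thesis using that[of ?D] by blast
qed

lemma not_2_connected_vertex:
  assumes G: "graph G" and S: "S \<subseteq> verts G" "connected_graph (induced G S)" "\<not> k_connected 2 (induced G S)"
  obtains y where "y \<in> S" "\<not> connected_graph (induced G (S - {y}))"
proof -
  obtain W where W: "W \<subseteq> verts (induced G S)" "finite W" "card W < 2" "\<not> connected_graph (delete_verts (induced G S) W)"
    using S(3) unfolding k_connected_def by blast
  have "W \<noteq> {}" using W(4) S(2) by (auto simp: delete_verts_empty)
  then have "card W = 1" using W(2,3) by (metis card_0_eq less_2_cases One_nat_def)
  then obtain y where y: "W = {y}" by (rule card_1_singletonE)
  show ?thesis using that[of y] W(1,4) unfolding y delete_verts_induced[OF G S(1)] by simp
qed

section \<open>Sides of a cut vertex in a 4-ac graph\<close>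

locale four_ac_graph =
  fixes G :: "'a ugraph"
  assumes graph: "graph G" and four_ac: "n_ac 4 G"
begin

lemma connected: "connected_graph G" by (rule n_ac_4_connected(1)[OF graph four_ac])

lemma sideD:
  assumes "side G v C"
  shows "v \<in> verts G" "piece G {v} C" "C \<noteq> {}" "verts G - {v} - C \<noteq> {}" "C \<subseteq> verts G" "v \<notin> C"
  using assms unfolding side_def piece_def by blast+

lemma side_edge: "side G v C \<Longrightarrow> e \<in> edges G \<Longrightarrow> u \<in> e \<Longrightarrow> u \<in> C \<Longrightarrow> e \<subseteq> insert v C"
  using piece_edge[OF sideD(2)] by fastforce

lemma side_complement: assumes "side G v C" shows "side G v (verts G - {v} - C)"
proof -
  have "verts G - {v} - (verts G - {v} - C) = C" using sideD[OF assms] by blast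
  then show ?thesis
    unfolding side_def using sideD[OF assms] piece_complement[OF graph sideD(2)[OF assms]] by simp
qed

text \<open>A walk from \<open>C\<close> to \<open>v\<close> leaves \<open>C\<close> only by an edge
  to \<open>v\<close>.\<close>

lemma side_neighbour:
  assumes C: "side G v C" obtains x where "x \<in> C" "{v, x} \<in> edges G"
proof -
  obtain a where a: "a \<in> C" using sideD(3)[OF C] by blast
  then have "linked G a v" using connected_graphD[OF connected] sideD(1,5)[OF C] by blast
  then have "(adjacent G)\<^sup>*\<^sup>* a v" by (simp add: linked_def)
  moreover have "z \<in> C \<or> (\<exists>x\<in>C. {v, x} \<in> edges G)" if "(adjacent G)\<^sup>*\<^sup>* a z" for z
    using that
  proof induction
    case base then show ?case using a by blast
  next
    case (step y z)
    show ?case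
    proof (cases "y \<in> C")
      case True
      have e: "{y, z} \<in> edges G" using step(2) by (simp add: adjacent_def)
      then have "{y, z} \<subseteq> insert v C" by (rule side_edge[OF C]) (use True in auto)
      then consider "z \<in> C" | "z = v" by blast
      then show ?thesis
      proof cases
        case 2
        then have "{v, y} \<in> edges G" using e by (simp add: insert_commute)
        then show ?thesis using True by blast
      qed blast
    next
      case False then show ?thesis using step(3) by blast
    qed
  qed
  ultimately have "\<exists>x\<in>C. {v, x} \<in> edges G" using sideD(6)[OF C] by blast
  then show ?thesis using that by blast
qed

lemma side_linked: "side G v C \<Longrightarrow> a \<in> C \<Longrightarrow> b \<in> C \<Longrightarrow> linked (induced G C) a b"
  by (rule piece_connected[OF graph four_ac sideD(1) sideD(2) sideD(4)])

lemma side_linked_base: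
  assumes C: "side G v C" and a: "a \<in> insert v C" shows "linked (induced G (insert v C)) a v"
proof -
  obtain x where x: "x \<in> C" "{v, x} \<in> edges G" by (rule side_neighbour[OF C])
  have "{x, v} \<in> edges (induced G (insert v C))" using x by (simp add: insert_commute)
  then have xv: "linked (induced G (insert v C)) x v" by (rule linked_edge[OF graph_induced[OF graph]])
  show ?thesis
  proof (cases "a = v")
    case True then show ?thesis using linked_refl[of v] sideD(1)[OF C] by simp
  next
    case False
    then have "linked (induced G C) a x" using side_linked[OF C] a x by blast
    then have "linked (induced G (insert v C)) a x" by (rule linked_induced_mono) blast
    then show ?thesis using xv by (rule linked_trans)
  qed
qed

lemma connected_side: assumes C: "side G v C" shows "connected_graph (induced G (insert v C))"
  by (rule connected_graphI[of v]) (use sideD(1)[OF C] side_linked_base[OF C] in auto)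

text \<open>The separating vertex \<open>y\<close> is not \<open>v\<close>, because \<open>C\<close>
  alone is connected. \<open>D\<close> is what lies behind \<open>y\<close> as seen from
  \<open>v\<close>.\<close>

lemma side_not_2_connected:
  assumes C: "side G v C" and n: "\<not> k_connected 2 (induced G (insert v C))"
  obtains y D where "y \<in> C" "piece G {y} D" "D \<noteq> {}" "D \<subseteq> C - {y}"
proof -
  have sub: "insert v C \<subseteq> verts G" using sideD[OF C] by blast
  obtain y where y: "y \<in> insert v C" "\<not> connected_graph (induced G (insert v C - {y}))"
    by (rule not_2_connected_vertex[OF graph sub connected_side[OF C] n])
  have "y \<noteq> v"
  proof
    assume yv: "y = v"
    obtain a where a: "a \<in> C" using sideD(3)[OF C] by blast
    have "insert v C - {y} = C" using yv sideD(6)[OF C] by blast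
    moreover have "connected_graph (induced G C)"
      by (rule connected_graphI[of a]) (use a side_linked[OF C] sideD(5)[OF C] in auto)
    ultimately show False using y(2) by simp
  qed
  then have yC: "y \<in> C" and vy: "v \<noteq> y" using y(1) by auto
  obtain D where D: "piece G {y} D" "D \<noteq> {}" "D \<subseteq> insert v C - {y}" "v \<notin> D"
  proof (rule unlinked_piece[OF graph sub _ _ vy y(2)])
    show "e \<subseteq> insert v C" if "e \<in> edges G" "u \<in> e" "u \<in> insert v C - {v}" for e u
      using side_edge[OF C that(1,2)] that(3) by blast
  qed simp
  then have "D \<subseteq> C - {y}" by blast
  then show ?thesis by (rule that[OF yC D(1,2)])
qed

text \<open>The arc has to pass \<open>v\<close> and does so only once, so everything it visits on
  this side forms a single arc that starts at \<open>v\<close>.\<close>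

lemma seg_beyond:
  assumes C: "side G v C" and A: "seg (realization G) a b A" and p: "p \<in> A" "p \<noteq> Inl v" "p \<notin> region G C"
    and q: "q \<in> A" "q \<in> region G C"
  obtains t B where "seg (realization G) (Inl v) t B" "B \<subseteq> A" "A \<inter> region G C \<subseteq> B" "B - {Inl v} \<subseteq> region G C"
proof -
  note v = sideD(1)[OF C] and pC = sideD(2)[OF C]
  have vr: "Inl v \<notin> region G C" using sideD(6)[OF C] by (simp add: Inl_in_region[OF graph])
  have "Inl v \<in> A"
  proof (rule ccontr)
    assume "Inl v \<notin> A"
    then have "A \<subseteq> region G C"
      by (rule connected_in_region_singleton[OF graph v pC seg_connected[OF A] _ q])
    then show False using p by blast
  qed
  then obtain s t A1 A2 where S: "seg (realization G) s (Inl v) A1" "seg (realization G) (Inl v) t A2" "A1 \<union> A2 = A"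
    "A1 \<inter> A2 = {Inl v}" "p \<in> A1"
    by (rule seg_through[OF A _ p(1)])
  have disj: "r \<notin> region G C" if r: "r \<in> A1" for r
  proof
    assume rC: "r \<in> region G C"
    then have r': "r \<in> A1 - {Inl v}" using r vr by auto
    have "A1 - {Inl v} \<subseteq> region G C"
      by (rule connected_in_region_singleton[OF graph v pC seg_connected_minus_end[OF S(1)] _ r' rC]) simp
    then show False using S(5) p(2,3) by blast
  qed
  have q2: "q \<in> A2 - {Inl v}" using disj q S(3) vr by blast
  have "A2 - {Inl v} \<subseteq> region G C"
    by (rule connected_in_region_singleton[OF graph v pC seg_connected_minus_end[OF seg_sym[OF S(2)]] _ q2 q(2)]) simp
  moreover have "A2 \<subseteq> A" "A \<inter> region G C \<subseteq> A2" using S(3) disj by blast+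
  ultimately show ?thesis using that[OF S(2)] by blast
qed

text \<open>The point \<open>d\<close> behind \<open>y\<close> forces the arc to continue from
  \<open>v\<close> to \<open>y\<close>, and both midpoints lie on this part. The midpoint visited
  second then lies on an arc with ends outside its edge, so this edge is traversed and
  \<open>v\<close> would be visited twice.\<close>

lemma unique_neighbour:
  assumes C: "side G v C" and D: "y \<in> C" "piece G {y} D" "D \<noteq> {}" "D \<subseteq> C - {y}"
    and x: "x1 \<in> C" "x2 \<in> C" "{v, x1} \<in> edges G" "{v, x2} \<in> edges G"
  shows "x1 = x2"
proof (rule ccontr)
  assume ne: "x1 \<noteq> x2"
  let ?X = "realization G"
  note v = sideD(1)[OF C]
  have yV: "y \<in> verts G" using D(1) sideD(5)[OF C] by blast
  define p where "p = edge_midpoint {v, x1}"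
  define q where "q = edge_midpoint {v, x2}"
  obtain b where b: "b \<in> verts G - {v} - C" using sideD(4)[OF C] by blast
  obtain d where d: "d \<in> D" using D(3) by blast
  have dC: "d \<in> C" "d \<noteq> y" "d \<in> verts G" using d D(4) sideD(5)[OF C] by blast+
  have pq: "p = Inr ({v, x1}, 1/2)" "q = Inr ({v, x2}, 1/2)" by (simp_all add: p_def q_def edge_pt_interior)
  have "{v, x1} \<noteq> {v, x2}" using ne by (simp add: doubleton_eq_iff)
  then have "p \<noteq> q" using pq by simp
  have "{Inl b, Inl d, p, q} \<subseteq> topspace ?X"
    using b dC x unfolding pq by (simp add: topspace_realization[OF graph])
  then obtain s t A where A: "seg ?X s t A" "{Inl b, Inl d, p, q} \<subseteq> A"
    by (rule n_ac_4_seg[OF graph four_ac]) (auto simp: card_insert_if)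
  have reg: "p \<in> region G C" "q \<in> region G C" "Inl d \<in> region G C"
    unfolding pq using x dC by (auto simp: Inr_in_region[OF graph] Inl_in_region[OF graph])
  have inA: "Inl b \<in> A" "p \<in> A" "q \<in> A" "Inl d \<in> A" using A(2) by auto
  obtain u B where B: "seg ?X (Inl v) u B" "B \<subseteq> A" "A \<inter> region G C \<subseteq> B" "B - {Inl v} \<subseteq> region G C"
    by (rule seg_beyond[OF C A(1) inA(1) _ _ inA(2) reg(1)]) (use b in \<open>auto simp: Inl_in_region[OF graph]\<close>)
  have inB: "p \<in> B" "q \<in> B" "Inl d \<in> B" "Inl v \<in> B" using inA reg B(3) seg_ends(1)[OF B(1)] by blast+
  have vD: "v \<notin> D" "v \<noteq> y" using D sideD(6)[OF C] by blast+
  \<comment> \<open>An edge at \<open>v\<close> has no end in \<open>D\<close>, since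
    \<open>D\<close> can be entered only from \<open>y\<close>; so the midpoints are not behind
    \<open>y\<close>.\<close>
  have notD: "r \<notin> region G D" if r: "r \<in> {p, q}" for r
  proof -
    have "z \<notin> D" if "{v, z} \<in> edges G" for z
    proof
      assume "z \<in> D"
      then have "{v, z} \<subseteq> {y} \<union> D" using piece_edge[OF D(2) that] by blast
      then show False using vD by blast
    qed
    then show ?thesis using r x vD unfolding pq by (auto simp: Inr_in_region[OF graph])
  qed
  have dD: "Inl d \<in> region G D" using d dC by (simp add: Inl_in_region[OF graph])
  have vnD: "Inl v \<notin> region G D" using vD by (simp add: Inl_in_region[OF graph])
  have "Inl y \<in> B"
  proof (rule ccontr)
    assume "Inl y \<notin> B"
    then have "B \<subseteq> region G D"
      by (rule connected_in_region_singleton[OF graph yV D(2) seg_connected[OF B(1)] _ inB(3) dD])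
    then show False using inB(4) vnD by blast
  qed
  then obtain B1 B2 where S: "seg ?X (Inl v) (Inl y) B1" "seg ?X (Inl y) u B2" "B1 \<union> B2 = B" "B1 \<inter> B2 = {Inl y}"
    by (rule seg_split[OF B(1)])
  have vB1: "Inl v \<in> B1 - {Inl y}" using seg_ends(1)[OF S(1)] vD by simp
  have "Inl d \<notin> B1"
  proof
    assume "Inl d \<in> B1"
    then have "Inl d \<in> B1 - {Inl y}" using dC by simp
    from connected_in_region_singleton[OF graph yV D(2) seg_connected_minus_end[OF S(1)] _ this dD]
    have "B1 - {Inl y} \<subseteq> region G D" by simp
    then show False using vB1 vnD by blast
  qed
  then have "Inl d \<in> B2 - {Inl y}" using inB(3) S(3) dC by auto
  from connected_in_region_singleton[OF graph yV D(2) seg_connected_minus_end[OF seg_sym[OF S(2)]] _ this dD]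
  have B2: "B2 - {Inl y} \<subseteq> region G D" by simp
  have pqB1: "p \<in> B1" "q \<in> B1"
  proof -
    have "r \<in> B1" if "r \<in> {p, q}" "r \<in> B" for r
    proof (rule ccontr)
      assume "r \<notin> B1"
      then have "r \<in> B2" using that(2) S(3) by blast
      moreover have "r \<noteq> Inl y" using that(1) unfolding pq by auto
      ultimately show False using B2 notD[OF that(1)] by blast
    qed
    then show "p \<in> B1" "q \<in> B1" using inB by auto
  qed
  have pqt: "{p, q} \<subseteq> topspace ?X" using pqB1 seg_subset[OF S(1)] by blast
  have "closedin ?X {p, q}" by (rule closedin_Hausdorff_finite[OF Hausdorff_realization[OF graph] pqt]) simp
  moreover have "B1 \<inter> {p, q} \<noteq> {}" using pqB1 by blast
  ultimately obtain c E F where E: "seg ?X (Inl v) c E" "seg ?X c (Inl y) F" "E \<union> F = B1" "E \<inter> F = {c}" "E \<inter> {p, q} = {c}"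
    by (rule seg_first_hit[OF S(1)])
  \<comment> \<open>\<open>F\<close> runs from the midpoint reached first to the vertex
    \<open>y\<close>; neither end is inside the edge marked by the other midpoint.\<close>
  have key: False if c: "c = edge_midpoint {v, z}" and r: "edge_midpoint {v, z'} \<in> B1" "{v, z'} \<in> edges G" "{v, z} \<noteq> {v, z'}"
    "edge_midpoint {v, z'} \<notin> E" for z z'
  proof -
    have rF: "edge_midpoint {v, z'} \<in> F" using r E(3) by blast
    have "Inl v \<in> F"
      by (rule seg_covers_edge[OF graph r(2) _ E(2) _ Inl_notin_interior rF])
        (use r(3) in \<open>simp_all add: c edge_midpoint_in_interior\<close>)
    then have "Inl v = c" using E(4) seg_ends(1)[OF E(1)] by blast
    then show False unfolding c by (simp add: edge_pt_interior)
  qed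
  have only: "r = c" if "r \<in> {p, q}" "r \<in> E" for r
  proof -
    have "r \<in> E \<inter> {p, q}" using that by blast
    then show "r = c" unfolding E(5) by simp
  qed
  have ne': "{v, x1} \<noteq> {v, x2}" "{v, x2} \<noteq> {v, x1}" using ne by (simp_all add: doubleton_eq_iff)
  have "c \<in> {p, q}" using E(5) by blast
  then consider "c = p" | "c = q" by blast
  then show False
  proof cases
    case 1
    have "q \<notin> E"
    proof
      assume "q \<in> E"
      from only[OF _ this] 1 \<open>p \<noteq> q\<close> show False by simp
    qed
    then show False using key[OF 1[unfolded p_def] pqB1(2)[unfolded q_def] x(4) ne'(1)] unfolding q_def by simp
  next
    case 2
    have "p \<notin> E"
    proof
      assume "p \<in> E"
      from only[OF _ this] 2 \<open>p \<noteq> q\<close> show False by simp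
    qed
    then show False using key[OF 2[unfolded q_def] pqB1(1)[unfolded p_def] x(3) ne'(2)] unfolding p_def by simp
  qed
qed

text \<open>From \<open>v\<close> the arc visits three midpoints of edges at \<open>v\<close>. The
  second one lies on an arc between the other two, so its edge is traversed and the arc would return
  to \<open>v\<close>.\<close>

lemma side_degree:
  assumes C: "side G v C" shows "vertex_degree (induced G (insert v C)) v \<le> 2"
proof (rule ccontr)
  let ?X = "realization G"
  let ?E = "{e \<in> edges (induced G (insert v C)). v \<in> e}"
  assume "\<not> ?thesis"
  then have big: "\<not> (finite ?E \<and> card ?E \<le> 2)" by (simp only: vertex_degree_le_2_iff not_False_eq_True)
  obtain S where S: "S \<subseteq> ?E" "card S = 3"
  proof (cases "finite ?E")
    case True
    with big have "\<not> card ?E \<le> 2" by blast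
    then have "3 \<le> card ?E" by linarith
    then show ?thesis by (rule obtain_subset_with_card_n) (rule that)
  next
    case False
    then obtain S where "S \<subseteq> ?E" "card S = 3" using infinite_arbitrarily_large[of ?E 3] by blast
    then show ?thesis by (rule that)
  qed
  then obtain e1 e2 e3 where e: "S = {e1, e2, e3}" "e1 \<noteq> e2" "e1 \<noteq> e3" "e2 \<noteq> e3" unfolding card_3_iff by blast
  have eS: "e \<in> edges G \<and> v \<in> e \<and> e \<inter> C \<noteq> {}" if "e \<in> S" for e
  proof -
    have e: "e \<in> edges G" "v \<in> e" "e \<subseteq> insert v C" using that S(1) by auto
    obtain w where "e = {v, w}" "v \<noteq> w" by (rule edge_obtain[OF graph e(1,2)])
    then show ?thesis using e by blast
  qed
  obtain b where b: "b \<in> verts G - {v} - C" using sideD(4)[OF C] by blast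
  let ?M = "edge_midpoint ` S"
  have mid: "edge_midpoint e = Inr (e, 1/2)" for e :: "'a set" by (simp add: edge_pt_interior)
  have Mreg: "edge_midpoint e \<in> region G C" if "e \<in> S" for e
    using eS[OF that] unfolding mid by (simp add: Inr_in_region[OF graph])
  have fS: "finite S" using e(1) by simp
  have "insert (Inl b) ?M \<subseteq> topspace ?X"
    using b Mreg unfolding region_def by (auto simp: topspace_realization[OF graph])
  moreover have "finite (insert (Inl b) ?M)" using fS by simp
  moreover have "card (insert (Inl b) ?M) \<le> 4"
    using card_image_le[OF fS, of edge_midpoint] S(2) fS by (simp add: card_insert_if)
  ultimately obtain s t A where A: "seg ?X s t A" "insert (Inl b) ?M \<subseteq> A"
    by (rule n_ac_4_seg[OF graph four_ac])
  have bA: "Inl b \<in> A" and MA: "?M \<subseteq> A" using A(2) by auto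
  have e1: "edge_midpoint e1 \<in> A" "edge_midpoint e1 \<in> region G C" using MA Mreg e(1) by blast+
  obtain u B where B: "seg ?X (Inl v) u B" "B \<subseteq> A" "A \<inter> region G C \<subseteq> B" "B - {Inl v} \<subseteq> region G C"
    by (rule seg_beyond[OF C A(1) bA _ _ e1]) (use b in \<open>auto simp: Inl_in_region[OF graph]\<close>)
  have MB: "?M \<subseteq> B" using MA Mreg B(3) by blast
  have cl: "closedin ?X M" if "M \<subseteq> ?M" for M
  proof (rule closedin_Hausdorff_finite[OF Hausdorff_realization[OF graph]])
    show "M \<subseteq> topspace ?X" using that MB seg_subset[OF B(1)] by blast
    show "finite M" using that fS finite_subset by blast
  qed
  have "B \<inter> ?M \<noteq> {}" using MB e(1) by blast
  then obtain c F1 F where F: "seg ?X (Inl v) c F1" "seg ?X c u F" "F1 \<union> F = B" "F1 \<inter> F = {c}" "F1 \<inter> ?M = {c}"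
    by (rule seg_first_hit[OF B(1) cl[OF subset_refl]])
  have cM: "c \<in> ?M" using F(5) by blast
  then obtain f where f: "f \<in> S" "c = edge_midpoint f" by blast
  have MF: "r \<in> F" if r: "r \<in> ?M" for r
  proof (cases "r \<in> F1")
    case True
    then have "r \<in> F1 \<inter> ?M" using r by blast
    then have "r = c" unfolding F(5) by simp
    then show ?thesis using seg_ends(1)[OF F(2)] by simp
  next
    case False
    have "r \<in> B" using MB r by (rule subsetD)
    then show ?thesis using False F(3) by auto
  qed
  have vF: "Inl v \<notin> F"
  proof
    assume "Inl v \<in> F"
    then have "Inl v \<in> F1 \<inter> F" using seg_ends(1)[OF F(1)] by simp
    then have "Inl v = c" unfolding F(4) by simp
    then show False unfolding f(2) mid by simp
  qed
  obtain g h where gh: "g \<in> S" "h \<in> S" "g \<noteq> f" "h \<noteq> f" "g \<noteq> h"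
  proof -
    consider "f = e1" | "f = e2" | "f = e3" using f(1) unfolding e(1) by blast
    then show ?thesis
      using that[of e2 e3] that[of e1 e3] that[of e1 e2] e by cases auto
  qed
  \<comment> \<open>Applied to whichever of the two remaining midpoints is visited first, with the
    later one as the end of \<open>K\<close>.\<close>
  have between: False if gh: "g \<in> S" "g \<noteq> f" "h \<noteq> g" and K: "seg ?X c (edge_midpoint h) K" "K \<subseteq> F" "edge_midpoint g \<in> K" for g h K
  proof -
    have "Inl v \<in> K"
      by (rule seg_covers_edge[OF graph _ _ K(1) _ _ K(3)])
        (use eS[OF gh(1)] gh(2,3) in \<open>simp_all add: f(2) edge_midpoint_in_interior\<close>)
    then show False using K(2) vF by blast
  qed
  have gF: "edge_midpoint g \<in> F" "edge_midpoint h \<in> F" using MF gh(1,2) by simp_all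
  obtain K1 K2 where K: "seg ?X c (edge_midpoint g) K1" "seg ?X (edge_midpoint g) u K2" "K1 \<union> K2 = F" "K1 \<inter> K2 = {edge_midpoint g}"
    by (rule seg_split[OF F(2) gF(1)])
  show False
  proof (cases "edge_midpoint h \<in> K1")
    case True
    then show False using between[OF gh(2,4,5) K(1)] K(3) by blast
  next
    case False
    then have "edge_midpoint h \<in> K2" using gF(2) K(3) by blast
    then obtain K3 K4 where K': "seg ?X (edge_midpoint g) (edge_midpoint h) K3" "seg ?X (edge_midpoint h) u K4" "K3 \<union> K4 = K2"
      "K3 \<inter> K4 = {edge_midpoint h}"
      by (rule seg_split[OF K(2)])
    have "K1 \<inter> K3 = {edge_midpoint g}" using K(4) K'(3) seg_ends(2)[OF K(1)] seg_ends(1)[OF K'(1)] by blast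
    then have s: "seg ?X c (edge_midpoint h) (K1 \<union> K3)" by (rule seg_join[OF K(1) K'(1)])
    have "K1 \<union> K3 \<subseteq> F" using K(3) K'(3) by blast
    then show False using between[OF gh(1,3) _ s] gh(5) seg_ends(2)[OF K(1)] by blast
  qed
qed

lemma topspace_side:
  assumes C: "side G v C"
  shows "topspace (realization (induced G (insert v C))) = insert (Inl v) (region G C)"
proof (rule set_eqI)
  fix p
  have e: "e \<subseteq> insert v C \<longleftrightarrow> e \<inter> C \<noteq> {}" if "e \<in> edges G" for e
  proof
    assume "e \<subseteq> insert v C"
    moreover have "tail e \<in> e" "head e \<in> e" "tail e \<noteq> head e"
      using mem_edge_iff[OF graph that] tail_head(2)[OF graph that] by blast+
    ultimately show "e \<inter> C \<noteq> {}" by (metis disjoint_iff insertE subsetD)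
  next
    assume "e \<inter> C \<noteq> {}" then show "e \<subseteq> insert v C" using side_edge[OF C that] by blast
  qed
  show "p \<in> topspace (realization (induced G (insert v C))) \<longleftrightarrow> p \<in> insert (Inl v) (region G C)"
    using sideD(1,5)[OF C] e
    by (cases p) (auto simp: topspace_realization[OF graph_induced[OF graph]] Inl_in_region[OF graph] Inr_in_region[OF graph])
qed

text \<open>An arc of the whole graph is trimmed at \<open>v\<close> by \<open>seg_beyond\<close>
  unless it already stays on this side.\<close>

lemma side_n_ac:
  assumes C: "side G v C" shows "n_ac 4 (induced G (insert v C))"
  unfolding n_ac_iff_seg[OF graph_induced[OF graph]]
proof (intro allI impI, elim conjE)
  let ?X = "realization G"
  let ?R = "realization (induced G (insert v C))"
  fix P assume P: "P \<subseteq> topspace ?R" "finite P" "card P \<le> 4"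
  note v = sideD(1)[OF C]
  obtain a where a: "a \<in> C" using sideD(3)[OF C] by blast
  have ar: "Inl a \<in> region G C" using a sideD(5)[OF C] by (auto simp: Inl_in_region[OF graph])
  have vr: "Inl v \<notin> region G C" using sideD(6)[OF C] by (simp add: Inl_in_region[OF graph])
  \<comment> \<open>A point other than \<open>v\<close> is included, so that the trimmed arc does
    not degenerate to \<open>v\<close>.\<close>
  obtain Q q where Q: "P \<subseteq> Q" "Q \<subseteq> topspace ?R" "finite Q" "card Q \<le> 4" "q \<in> Q" "q \<in> region G C"
  proof (cases "P \<subseteq> {Inl v}")
    case True
    show ?thesis
      by (rule that[of "{Inl v, Inl a}" "Inl a"])
        (use True ar in \<open>auto simp: topspace_side[OF C] card_insert_if\<close>)
  next
    case False
    then obtain q where "q \<in> P" "q \<noteq> Inl v" by blast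
    then show ?thesis using that[of P q] P unfolding topspace_side[OF C] by blast
  qed
  have Qt: "Q \<subseteq> topspace ?X" using Q(2) v unfolding topspace_side[OF C] by (auto simp: region_def topspace_realization[OF graph])
  obtain s t A where A: "s \<noteq> t" "seg ?X s t A" "Q \<subseteq> A" by (rule n_ac_4_seg[OF graph four_ac Qt Q(3,4)])
  have qA: "q \<in> A" using A(3) Q(5) by blast
  have "\<exists>s t B. s \<noteq> t \<and> seg ?X s t B \<and> Q \<subseteq> B \<and> B \<subseteq> insert (Inl v) (region G C)"
  proof (cases "A \<subseteq> insert (Inl v) (region G C)")
    case True then show ?thesis using A by blast
  next
    case False
    then obtain z where z: "z \<in> A" "z \<noteq> Inl v" "z \<notin> region G C" by blast
    obtain r B where B: "seg ?X (Inl v) r B" "B \<subseteq> A" "A \<inter> region G C \<subseteq> B" "B - {Inl v} \<subseteq> region G C"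
      by (rule seg_beyond[OF C A(2) z qA Q(6)])
    have qB: "q \<in> B" using B(3) qA Q(6) by blast
    have "Inl v \<noteq> r" using seg_degenerate[of ?X "Inl v" B] B(1) qB Q(6) vr by blast
    moreover have "Q \<subseteq> B"
      using Q(2) A(3) B(3) seg_ends(1)[OF B(1)] unfolding topspace_side[OF C] by blast
    moreover have "B \<subseteq> insert (Inl v) (region G C)" using B(4) by blast
    ultimately show ?thesis using B(1) by blast
  qed
  then obtain s t B where B: "s \<noteq> t" "seg ?X s t B" "Q \<subseteq> B" "B \<subseteq> topspace ?R"
    unfolding topspace_side[OF C] by blast
  then have "seg ?R s t B" using seg_subgraph_iff[OF graph subgraph_induced[OF graph]] by blast
  then show "\<exists>s t A. s \<noteq> t \<and> seg ?R s t A \<and> P \<subseteq> A" using B(1,3) Q(1) by blast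
qed

text \<open>Without \<open>u\<close>, every vertex is still linked to \<open>v\<close>: on this side
  by 2-connectedness, on the other because it is connected and does not contain
  \<open>u\<close>.\<close>

lemma not_cut_vertex_in_side:
  assumes C: "side G v C" and k: "k_connected 2 (induced G (insert v C))" and u: "u \<in> C"
  shows "\<not> cut_vertex G u"
proof
  assume "cut_vertex G u"
  then obtain a b where ab: "a \<in> verts G - {u}" "b \<in> verts G - {u}" "\<not> linked (delete_verts G {u}) a b"
    unfolding cut_vertex_def by blast
  let ?K = "induced G (verts G - {u})"
  have sub: "insert v C \<subseteq> verts G" using sideD[OF C] by blast
  have uv: "u \<noteq> v" using u sideD(6)[OF C] by blast
  have to_v: "linked ?K c v" if c: "c \<in> verts G - {u}" for c
  proof (cases "c \<in> insert v C")
    case True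
    have "u \<in> verts (induced G (insert v C))" using u sub by auto
    from k_connected_2D(2)[OF k this] have "connected_graph (induced G (insert v C - {u}))"
      unfolding delete_verts_induced[OF graph sub] .
    then have "linked (induced G (insert v C - {u})) c v"
      by (rule connected_graphD) (use c True uv sub in auto)
    then show ?thesis by (rule linked_induced_mono) (use sub in blast)
  next
    case False
    have "linked (induced G (insert v (verts G - {v} - C))) c v"
      by (rule side_linked_base[OF side_complement[OF C]]) (use c False in blast)
    then show ?thesis by (rule linked_induced_mono) (use u uv sub in blast)
  qed
  have "linked ?K a b" using linked_trans[OF to_v[OF ab(1)] linked_sym[OF to_v[OF ab(2)]]] .
  then show False using ab(3) unfolding delete_verts_eq_induced[OF graph] by simp
qed

text \<open>The peeling step. As \<open>x\<close> is the only neighbour of \<open>v\<close> in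
  \<open>C\<close>, no other vertex of \<open>C\<close> has an edge to \<open>v\<close>, so the rest
  of \<open>C\<close> is a side of \<open>x\<close>.\<close>

lemma side_step:
  assumes C: "side G v C" and n: "\<not> k_connected 2 (induced G (insert v C))"
  shows "\<exists>x. x \<in> C \<and> {v, x} \<in> edges G \<and> (\<forall>y\<in>C. {v, y} \<in> edges G \<longrightarrow> y = x) \<and> side G x (C - {x})"
proof -
  obtain y D where D: "y \<in> C" "piece G {y} D" "D \<noteq> {}" "D \<subseteq> C - {y}" by (rule side_not_2_connected[OF C n])
  obtain x where x: "x \<in> C" "{v, x} \<in> edges G" by (rule side_neighbour[OF C])
  have un: "\<forall>z\<in>C. {v, z} \<in> edges G \<longrightarrow> z = x" using unique_neighbour[OF C D] x by blast
  have vx: "v \<noteq> x" using x sideD(6)[OF C] by blast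
  have "side G x (C - {x})"
    unfolding side_def
  proof (intro conjI)
    show "x \<in> verts G" using x sideD(5)[OF C] by blast
    show "C - {x} \<noteq> {}" using D by blast
    show "verts G - {x} - (C - {x}) \<noteq> {}" using vx sideD(1,6)[OF C] by blast
    show "piece G {x} (C - {x})"
      unfolding piece_def
    proof (intro conjI ballI impI)
      show "C - {x} \<subseteq> verts G - {x}" using sideD(5)[OF C] by blast
      fix e assume e: "e \<in> edges G" "e \<inter> (C - {x}) \<noteq> {}"
      then obtain u where u: "u \<in> e" "u \<in> C" "u \<noteq> x" by blast
      have eC: "e \<subseteq> insert v C" by (rule side_edge[OF C e(1) u(1,2)])
      have "v \<notin> e"
      proof
        assume ve: "v \<in> e"
        obtain w where w: "e = {v, w}" by (rule edge_obtain[OF graph e(1) ve])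
        then have "u = w" using u sideD(6)[OF C] by blast
        then have "{v, u} \<in> edges G" using w e(1) by simp
        then show False using un u by blast
      qed
      then show "e \<subseteq> {x} \<union> (C - {x})" using eC by blast
    qed
  qed
  then show ?thesis using x un by blast
qed

end

section \<open>Building the chain\<close>

text \<open>The links \<open>M n\<close> with \<open>n \<in> J\<close> lead away from the cut vertex \<open>v\<close> into its side \<open>C\<close>.\<close>

locale half_chain =
  fixes G :: "'a ugraph" and v :: 'a and C :: "'a set" and J :: "nat set" and M :: "nat \<Rightarrow> 'a ugraph"
  assumes zero: "0 \<in> J" and down: "\<And>m n. n \<in> J \<Longrightarrow> m \<le> n \<Longrightarrow> m \<in> J"
    and sub: "\<And>n. n \<in> J \<Longrightarrow> subgraph (M n) G"
    and conn: "\<And>n. n \<in> J \<Longrightarrow> k_connected 2 (M n)"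
    and nac: "\<And>n. n \<in> J \<Longrightarrow> n_ac 4 (M n)"
    and inner: "\<And>n. Suc n \<in> J \<Longrightarrow> is_K2 (M n)"
    and consecutive: "\<And>n. Suc n \<in> J \<Longrightarrow> \<exists>u. verts (M n) \<inter> verts (M (Suc n)) = {u}"
    and apart: "\<And>m n. m \<in> J \<Longrightarrow> n \<in> J \<Longrightarrow> Suc m < n \<Longrightarrow> verts (M m) \<inter> verts (M n) = {}"
    and base: "v \<in> verts (M 0)" "\<And>n. n \<in> J \<Longrightarrow> 0 < n \<Longrightarrow> v \<notin> verts (M n)"
    and verts: "(\<Union>n\<in>J. verts (M n)) = insert v C"
    and edges: "(\<Union>n\<in>J. edges (M n)) = {e \<in> edges G. e \<subseteq> insert v C}"
    and deg: "\<And>n u. n \<in> J \<Longrightarrow> u \<in> verts (M n) \<Longrightarrow> cut_vertex G u \<Longrightarrow> vertex_degree (M n) u \<le> 2"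

context four_ac_graph begin

text \<open>Edges from \<open>a n\<close> to \<open>a (Suc n)\<close> are peeled off as long as the
  rest \<open>R n\<close> is not 2-connected. If this stops, the rest is the last link; otherwise
  the half chain is infinite.\<close>

lemma half_chain_exists:
  assumes C0: "side G v0 C0"
  obtains J M where "half_chain G v0 C0 J M"
proof -
  define Q where "Q v C x \<longleftrightarrow> x \<in> C \<and> {v, x} \<in> edges G \<and> (\<forall>y\<in>C. {v, y} \<in> edges G \<longrightarrow> y = x) \<and> side G x (C - {x})"
    for v x :: 'a and C
  \<comment> \<open>The choice and the recursion run on with arbitrary values once the rest is
    2-connected; only indices in \<open>J\<close> are meaningful.\<close>
  define nx where "nx v C = (SOME x. Q v C x)" for v C
  define s where "s = rec_nat (v0, C0) (\<lambda>_ p. (nx (fst p) (snd p), snd p - {nx (fst p) (snd p)}))"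
  define a where "a n = fst (s n)" for n
  define D where "D n = snd (s n)" for n
  have a0: "a 0 = v0" "D 0 = C0" by (simp_all add: a_def D_def s_def)
  have aS: "a (Suc n) = nx (a n) (D n)" "D (Suc n) = D n - {a (Suc n)}" for n
    by (simp_all add: a_def D_def s_def)
  define R where "R n = induced G (insert (a n) (D n))" for n
  define T where "T n \<longleftrightarrow> k_connected 2 (R n)" for n
  \<comment> \<open>The inequality is strict, so the first index with a 2-connected rest still
    belongs to \<open>J\<close> and carries the last link.\<close>
  define J where "J = {n. \<forall>m<n. \<not> T m}"
  have J0: "0 \<in> J" by (simp add: J_def)
  have J_le: "m \<in> J" if "n \<in> J" "m \<le> n" for m n using that by (auto simp: J_def)
  have J_not: "\<not> T n" if "Suc n \<in> J" for n using that by (simp add: J_def)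
  have J_Suc: "Suc n \<in> J" if "n \<in> J" "\<not> T n" for n using that by (simp add: J_def less_Suc_eq)
  have step: "Q (a n) (D n) (a (Suc n))" if "side G (a n) (D n)" "\<not> T n" for n
  proof -
    have "\<exists>x. Q (a n) (D n) x" using side_step[OF that(1)] that(2) unfolding Q_def T_def R_def by blast
    then show ?thesis unfolding aS(1) nx_def by (rule someI_ex)
  qed
  have sd: "side G (a n) (D n)" if "n \<in> J" for n
    using that
  proof (induction n)
    case 0 then show ?case using C0 a0 by simp
  next
    case (Suc n)
    have "n \<in> J" using J_le[OF Suc.prems] by simp
    from step[OF Suc.IH[OF this] J_not[OF Suc.prems]] show ?case unfolding Q_def aS(2) by blast
  qed
  have q: "Q (a n) (D n) (a (Suc n))" if "Suc n \<in> J" for n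
    by (rule step[OF sd J_not[OF that]]) (use J_le[OF that] in simp)
  have ins: "insert (a (Suc n)) (D (Suc n)) = D n" if "Suc n \<in> J" for n
    using q[OF that] unfolding aS(2) Q_def by blast
  have mono: "insert (a n) (D n) \<subseteq> D m" if "n \<in> J" "m < n" for m n
    using that
  proof (induction n)
    case (Suc n)
    have n: "n \<in> J" using J_le[OF Suc.prems(1)] by simp
    show ?case
    proof (cases "m = n")
      case True then show ?thesis using ins[OF Suc.prems(1)] by simp
    next
      case False
      then have "insert (a n) (D n) \<subseteq> D m" using Suc.IH[OF n] Suc.prems(2) by simp
      then show ?thesis using ins[OF Suc.prems(1)] by blast
    qed
  qed simp
  have notD: "a n \<notin> D n" if "n \<in> J" for n using sideD(6)[OF sd[OF that]] .
  define M where "M n = (if T n then R n else edge_graph (a n) (a (Suc n)))" for n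
  have RV: "verts (R n) = insert (a n) (D n)" if "n \<in> J" for n
    unfolding R_def using sideD(1,5)[OF sd[OF that]] by auto
  have nT: "M n = edge_graph (a n) (a (Suc n))" "a n \<noteq> a (Suc n)" "a (Suc n) \<in> D n" "{a n, a (Suc n)} \<in> edges G"
    if "n \<in> J" "\<not> T n" for n
    using q[OF J_Suc[OF that]] notD[OF that(1)] that(2) unfolding M_def Q_def by auto
  have VM: "verts (M n) \<subseteq> insert (a n) (D n)" "a n \<in> verts (M n)" if "n \<in> J" for n
    using RV[OF that] nT[OF that] by (cases "T n"; auto simp: M_def)+
  \<comment> \<open>The peeling never stops under this assumption, and \<open>u\<close> would
    survive all steps although it has finite distance from \<open>v0\<close>.\<close>
  have linkedJ: False if u: "\<And>n. n \<in> J \<and> u \<in> insert (a n) (D n)" for u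
  proof -
    \<comment> \<open>An edge into \<open>D n\<close> comes from \<open>a n\<close> or from
      \<open>D n\<close>, and both lie in the previous rest \<open>D n'\<close>. So getting one step
      deeper costs at least one edge.\<close>
    have away: "z \<notin> D n" if "(adjacent G ^^ k) v0 z" "k \<le> n" for k n z
      using that
    proof (induction k arbitrary: z n)
      case 0
      have "v0 \<notin> C0" using sideD(6)[OF C0] .
      moreover have "D n \<subseteq> C0" using mono[of n 0] u[of n] a0 by (cases "n = 0") auto
      ultimately show ?case using 0 by auto
    next
      case (Suc k)
      then obtain w where w: "(adjacent G ^^ k) v0 w" "adjacent G w z" by auto
      obtain n' where n': "n = Suc n'" "k \<le> n'" using Suc.prems(2) by (cases n) auto
      show ?case
      proof
        assume z: "z \<in> D n"
        have e: "{w, z} \<in> edges G" using w(2) by (simp add: adjacent_def)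
        have nJ: "Suc n' \<in> J" using u by blast
        have "{w, z} \<subseteq> insert (a n) (D n)" by (rule side_edge[OF sd e]) (use z u in auto)
        then have "w \<in> D n'" using ins[OF nJ] unfolding n'(1) by simp
        then show False using Suc.IH[OF w(1) n'(2)] by blast
      qed
    qed
    have "u \<in> insert v0 C0" using u[of 0] a0 by simp
    then have "linked G v0 u" using connected_graphD[OF connected] sideD(1,5)[OF C0] by blast
    then obtain k where k: "(adjacent G ^^ k) v0 u" unfolding linked_def using rtranclp_imp_relpowp by metis
    have "u \<in> D k" using u[of "Suc k"] ins by blast
    then show False using away[OF k] by blast
  qed
  have "half_chain G v0 C0 J M"
  proof
    show "0 \<in> J" by (rule J0)
    show "m \<in> J" if "n \<in> J" "m \<le> n" for m n by (rule J_le[OF that])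
    show "subgraph (M n) G" if n: "n \<in> J" for n
    proof (cases "T n")
      case True then show ?thesis using subgraph_induced[OF graph] by (simp add: M_def R_def)
    next
      case False
      note nT = nT[OF n False]
      have "a n \<in> verts G" "a (Suc n) \<in> verts G" using sideD(1,5)[OF sd[OF n]] nT(3) by auto
      then show ?thesis unfolding subgraph_def nT(1) using graph_edge_graph[OF nT(2)] nT(4) by simp
    qed
    show "k_connected 2 (M n)" if n: "n \<in> J" for n
    proof (cases "T n")
      case True then show ?thesis by (simp add: M_def T_def)
    next
      case False then show ?thesis using nT[OF n False] k_connected_edge_graph by simp
    qed
    show "n_ac 4 (M n)" if n: "n \<in> J" for n
    proof (cases "T n")
      case True then show ?thesis using side_n_ac[OF sd[OF n]] by (simp add: M_def R_def)
    next
      case False then show ?thesis using nT[OF n False] n_ac_edge_graph by simp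
    qed
    have Jn: "n \<in> J" if "Suc n \<in> J" for n using J_le[OF that] by simp
    show "is_K2 (M n)" if "Suc n \<in> J" for n
      using nT[OF Jn[OF that] J_not[OF that]] is_K2_edge_graph by simp
    show "\<exists>u. verts (M n) \<inter> verts (M (Suc n)) = {u}" if n: "Suc n \<in> J" for n
    proof -
      note nT = nT[OF Jn[OF n] J_not[OF n]]
      have "a n \<notin> verts (M (Suc n))" using VM(1)[OF n] ins[OF n] notD[OF Jn[OF n]] by blast
      then have "verts (M n) \<inter> verts (M (Suc n)) = {a (Suc n)}" using VM(2)[OF n] unfolding nT(1) by auto
      then show ?thesis by blast
    qed
    show "verts (M m) \<inter> verts (M n) = {}" if mn: "m \<in> J" "n \<in> J" "Suc m < n" for m n
    proof -
      have Sm: "Suc m \<in> J" using J_le[OF mn(2)] mn(3) by simp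
      note nT = nT[OF mn(1) J_not[OF Sm]]
      have n: "verts (M n) \<subseteq> D (Suc m)" using VM(1)[OF mn(2)] mono[OF mn(2,3)] by blast
      have "a (Suc m) \<notin> D (Suc m)" by (rule notD[OF Sm])
      moreover have "a m \<notin> D (Suc m)" using notD[OF mn(1)] unfolding aS(2) by blast
      ultimately show ?thesis using n unfolding nT(1) by auto
    qed
    show "v0 \<in> verts (M 0)" using VM(2)[OF J0] a0 by simp
    show "v0 \<notin> verts (M n)" if "n \<in> J" "0 < n" for n
      using VM(1)[OF that(1)] mono[OF that] a0 sideD(6)[OF C0] by auto
    have insub: "insert (a n) (D n) \<subseteq> insert v0 C0" if "n \<in> J" for n
      using mono[OF that, of 0] a0 by (cases "n = 0") auto
    show "(\<Union>n\<in>J. verts (M n)) = insert v0 C0"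
    proof
      show "(\<Union>n\<in>J. verts (M n)) \<subseteq> insert v0 C0" using VM(1) insub by blast
      show "insert v0 C0 \<subseteq> (\<Union>n\<in>J. verts (M n))"
      proof (rule subsetI, rule ccontr)
        fix u assume u: "u \<in> insert v0 C0" "u \<notin> (\<Union>n\<in>J. verts (M n))"
        \<comment> \<open>A vertex missed by all links prevents the peeling from stopping, since the
          last link would contain it, and remains in every rest.\<close>
        have "n \<in> J \<and> u \<in> insert (a n) (D n)" for n
        proof (induction n)
          case 0 then show ?case using J0 a0 u by simp
        next
          case (Suc n)
          then have n: "n \<in> J" "u \<in> insert (a n) (D n)" by auto
          then have "u \<notin> verts (M n)" using u(2) by blast
          then have "\<not> T n" using RV[OF n(1)] n(2) unfolding M_def by auto
          moreover have "u \<noteq> a n" using VM(2)[OF n(1)] \<open>u \<notin> verts (M n)\<close> by blast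
          ultimately show ?case using J_Suc[OF n(1)] ins n(2) by blast
        qed
        then show False by (rule linkedJ)
      qed
    qed
    show "(\<Union>n\<in>J. edges (M n)) = {e \<in> edges G. e \<subseteq> insert v0 C0}"
    proof
      show "(\<Union>n\<in>J. edges (M n)) \<subseteq> {e \<in> edges G. e \<subseteq> insert v0 C0}"
      proof
        fix e assume "e \<in> (\<Union>n\<in>J. edges (M n))"
        then obtain n where n: "n \<in> J" "e \<in> edges (M n)" by blast
        have "e \<in> edges G \<and> e \<subseteq> insert (a n) (D n)"
          using n nT[OF n(1)] by (cases "T n") (auto simp: M_def R_def)
        then show "e \<in> {e \<in> edges G. e \<subseteq> insert v0 C0}" using insub[OF n(1)] by blast
      qed
      show "{e \<in> edges G. e \<subseteq> insert v0 C0} \<subseteq> (\<Union>n\<in>J. edges (M n))"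
      proof (rule subsetI, rule ccontr)
        fix e assume e': "e \<in> {e \<in> edges G. e \<subseteq> insert v0 C0}" "e \<notin> (\<Union>n\<in>J. edges (M n))"
        then have e: "e \<in> edges G" "e \<subseteq> insert v0 C0" by auto
        have te: "tail e \<in> e" using mem_edge_iff[OF graph e(1)] by blast
        \<comment> \<open>An edge missed by all links survives in the same way, and its tail
          contradicts \<open>linkedJ\<close>.\<close>
        have "n \<in> J \<and> e \<subseteq> insert (a n) (D n)" for n
        proof (induction n)
          case 0 then show ?case using J0 a0 e by simp
        next
          case (Suc n)
          then have n: "n \<in> J" "e \<subseteq> insert (a n) (D n)" by auto
          then have eM: "e \<notin> edges (M n)" using e'(2) by blast
          then have T: "\<not> T n" using n(2) e(1) unfolding M_def R_def by auto
          note nT = nT[OF n(1) T]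
          have Sn: "Suc n \<in> J" by (rule J_Suc[OF n(1) T])
          have "a n \<notin> e"
          proof
            assume an: "a n \<in> e"
            obtain w where w: "e = {a n, w}" "a n \<noteq> w" by (rule edge_obtain[OF graph e(1) an])
            then have "w \<in> D n" using n(2) by blast
            then have "w = a (Suc n)" using q[OF Sn] e(1) w(1) unfolding Q_def by blast
            then show False using eM w(1) unfolding nT(1) by simp
          qed
          then show ?case using Sn ins[OF Sn] n(2) by blast
        qed
        then have "n \<in> J \<and> tail e \<in> insert (a n) (D n)" for n using te by blast
        then show False by (rule linkedJ)
      qed
    qed
    show "vertex_degree (M n) u \<le> 2" if n: "n \<in> J" "u \<in> verts (M n)" "cut_vertex G u" for n u
    proof (cases "T n")
      case True
      have k: "k_connected 2 (induced G (insert (a n) (D n)))" using True unfolding T_def R_def .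
      \<comment> \<open>In the 2-connected last link only its first vertex \<open>a n\<close> can be
        a cut vertex, and there \<open>side_degree\<close> applies.\<close>
      have "u \<notin> D n" using not_cut_vertex_in_side[OF sd[OF n(1)] k] n(3) by blast
      then have "u = a n" using VM(1)[OF n(1)] n(2) by blast
      then show ?thesis using side_degree[OF sd[OF n(1)]] True by (simp add: M_def R_def)
    next
      case False then show ?thesis using nT[OF n(1) False] vertex_degree_edge_graph by simp
    qed
  qed
  then show ?thesis by (rule that)
qed

lemma chain_2_connected:
  assumes k: "k_connected 2 G"
  shows "chain_graph_links G {0} (\<lambda>_. G)" "\<not> cut_vertex G v"
proof -
  have "subgraph G G" using graph by (simp add: subgraph_def)
  then show "chain_graph_links G {0} (\<lambda>_. G)"
    unfolding chain_graph_links_def using connected by auto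
  show "\<not> cut_vertex G v"
  proof
    assume "cut_vertex G v"
    then obtain a b where ab: "v \<in> verts G" "a \<in> verts G - {v}" "b \<in> verts G - {v}" "\<not> linked (delete_verts G {v}) a b"
      unfolding cut_vertex_def by blast
    then show False using connected_graphD[OF k_connected_2D(2)[OF k ab(1)], of a b] by (simp add: delete_verts_def)
  qed
qed

lemma side_exists:
  assumes n: "\<not> k_connected 2 G"
  obtains v C where "side G v C"
proof -
  have iG: "induced G (verts G) = G" using delete_verts_eq_induced[OF graph, of "{}"] by (simp add: delete_verts_empty)
  obtain y where y: "y \<in> verts G" "\<not> connected_graph (induced G (verts G - {y}))"
    by (rule not_2_connected_vertex[OF graph subset_refl]) (use n connected in \<open>auto simp: iG\<close>)
  have "verts G \<noteq> {y}" by (rule n_ac_4_connected(2)[OF graph four_ac])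
  then obtain v where v: "v \<in> verts G" "v \<noteq> y" using y(1) by blast
  obtain C where C: "piece G {y} C" "C \<noteq> {}" "C \<subseteq> verts G - {y}" "v \<notin> C"
  proof (rule unlinked_piece[OF graph subset_refl _ v y(2)])
    show "e \<subseteq> verts G" if "e \<in> edges G" for e by (rule edge_subset[OF graph that])
  qed
  then have "side G y C" using y(1) v unfolding side_def by blast
  then show ?thesis by (rule that)
qed

end

section \<open>Gluing the two half chains at the cut vertex\<close>

lemma edges_disjoint_if:
  assumes "graph H" "graph K" "verts H \<inter> verts K \<subseteq> {u}" shows "edges H \<inter> edges K = {}"
proof (rule equals0I)
  fix e assume "e \<in> edges H \<inter> edges K"
  then have e: "e \<in> edges H" "e \<in> edges K" by auto
  have "tail e = u" "head e = u" using tail_head(3,4)[OF assms(1) e(1)] tail_head(3,4)[OF assms(2) e(2)] assms(3) by blast+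
  then show False using tail_head(2)[OF assms(1) e(1)] by simp
qed

locale two_half_chains =
  pos: half_chain G v C J M + neg: half_chain G v C' J' M'
  for G :: "'a ugraph" and v C C' J J' M M' +
  assumes graph: "graph G" and conn: "connected_graph G"
    and parts: "verts G = insert v C \<union> C'" "C \<inter> C' = {}" "v \<notin> C" "v \<notin> C'"
    and edge_parts: "\<And>e. e \<in> edges G \<Longrightarrow> e \<subseteq> insert v C \<or> e \<subseteq> insert v C'"
begin

text \<open>One half chain occupies the indices 0, 1, 2, ..., the other one -1, -2, -3, .... The
  reflection \<open>- 1 - i\<close> makes the first links of both halves consecutive, and these
  share \<open>v\<close>.\<close>

definition I :: "int set" where
  "I = {i. if 0 \<le> i then nat i \<in> J else nat (- 1 - i) \<in> J'}"

definition L :: "int \<Rightarrow> 'a ugraph" where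
  "L i = (if 0 \<le> i then M (nat i) else M' (nat (- 1 - i)))"

lemma index_cases:
  assumes "i \<in> I"
  obtains n where "n \<in> J" "i = int n" "L i = M n" | n where "n \<in> J'" "i = - 1 - int n" "L i = M' n"
proof (cases "0 \<le> i")
  case True
  then show ?thesis using assms that(1)[of "nat i"] by (simp add: I_def L_def)
next
  case False
  then show ?thesis using assms that(2)[of "nat (- 1 - i)"] by (simp add: I_def L_def)
qed

lemma indices: "n \<in> J \<Longrightarrow> int n \<in> I" "n \<in> J' \<Longrightarrow> - 1 - int n \<in> I" "L (int n) = M n" "L (- 1 - int n) = M' n"
  by (simp_all add: I_def L_def)

lemma interval: assumes "i \<in> I" "k \<in> I" "i \<le> j" "j \<le> k" shows "j \<in> I"
proof (cases "0 \<le> j")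
  case True
  then have "nat k \<in> J" using assms by (simp add: I_def)
  then show ?thesis using True pos.down[of "nat k" "nat j"] assms(4) by (simp add: I_def)
next
  case False
  then have "nat (- 1 - i) \<in> J'" using assms by (simp add: I_def)
  then show ?thesis using False neg.down[of "nat (- 1 - i)" "nat (- 1 - j)"] assms(3) by (simp add: I_def)
qed

lemma half_verts: "n \<in> J \<Longrightarrow> verts (M n) \<subseteq> insert v C" "n \<in> J' \<Longrightarrow> verts (M' n) \<subseteq> insert v C'"
  using pos.verts neg.verts by blast+

lemma opposite: "n \<in> J \<Longrightarrow> m \<in> J' \<Longrightarrow> verts (M n) \<inter> verts (M' m) \<subseteq> {v}"
  using half_verts(1)[of n] half_verts(2)[of m] parts(2-4) by blast

lemma opposite_zero: "verts (M' 0) \<inter> verts (M 0) = {v}"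
  using opposite[OF pos.zero neg.zero] pos.base(1) neg.base(1) by blast

lemma union_I: "(\<Union>i\<in>I. f (L i)) = (\<Union>n\<in>J. f (M n)) \<union> (\<Union>n\<in>J'. f (M' n))"
proof
  show "(\<Union>i\<in>I. f (L i)) \<subseteq> (\<Union>n\<in>J. f (M n)) \<union> (\<Union>n\<in>J'. f (M' n))"
    by (auto elim!: index_cases)
  show "(\<Union>n\<in>J. f (M n)) \<union> (\<Union>n\<in>J'. f (M' n)) \<subseteq> (\<Union>i\<in>I. f (L i))"
    using indices by (metis (no_types, lifting) SUP_upper UN_least Un_least)
qed

lemma link_subgraph: "i \<in> I \<Longrightarrow> subgraph (L i) G"
  by (elim index_cases) (simp_all add: pos.sub neg.sub)

lemma consecutive: assumes "i \<in> I" "i + 1 \<in> I" shows "\<exists>u. verts (L i) \<inter> verts (L (i + 1)) = {u}"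
proof -
  consider "0 \<le> i" | "i = - 1" | "i < - 1" by linarith
  then show ?thesis
  proof cases
    case 1
    then have "nat (i + 1) = Suc (nat i)" by simp
    then show ?thesis using 1 assms pos.consecutive[of "nat i"] by (simp add: I_def L_def)
  next
    case 2
    then show ?thesis using opposite_zero by (simp add: L_def)
  next
    case 3
    then have "nat (- 1 - i) = Suc (nat (- 1 - (i + 1)))" by simp
    then have "\<exists>u. verts (M' (nat (- 1 - (i + 1)))) \<inter> verts (M' (nat (- 1 - i))) = {u}"
      using 3 assms neg.consecutive[of "nat (- 1 - (i + 1))"] by (simp add: I_def)
    then show ?thesis using 3 by (simp add: L_def Int_commute)
  qed
qed

text \<open>Links of different halves meet at most in \<open>v\<close>, which lies only in the first
  link of each half, and these two are consecutive.\<close>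

lemma far: assumes "i \<in> I" "j \<in> I" "i + 1 < j" shows "verts (L i) \<inter> verts (L j) = {}"
  using assms(1)
proof (cases rule: index_cases)
  case i: (1 m)
  show ?thesis using assms(2)
  proof (cases rule: index_cases)
    case (1 n)
    then show ?thesis using pos.apart[of m n] i assms(3) by simp
  qed (use i assms(3) in simp)
next
  case i: (2 m)
  show ?thesis using assms(2)
  proof (cases rule: index_cases)
    case j: (1 n)
    have "v \<notin> verts (L i) \<or> v \<notin> verts (L j)"
    proof (cases "n = 0")
      case True
      then have "0 < m" using i j assms(3) by auto
      then show ?thesis using neg.base(2) i by simp
    next
      case False then show ?thesis using pos.base(2) j by simp
    qed
    then show ?thesis using opposite[of n m] i j by auto
  next
    case j: (2 n)
    then have "verts (M' n) \<inter> verts (M' m) = {}" using neg.apart[of n m] i assms(3) by simp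
    then show ?thesis using i j by (simp add: Int_commute)
  qed
qed

lemma chain_links: "chain_graph_links G I L"
  unfolding chain_graph_links_def
proof (intro conjI ballI impI)
  show "connected_graph G" by (rule conn)
  show "I \<noteq> {}" using indices(1)[OF pos.zero] by blast
  show "{i..k} \<subseteq> I" if "i \<in> I" "k \<in> I" for i k using interval[OF that] by auto
  show "subgraph (L i) G" if "i \<in> I" for i by (rule link_subgraph[OF that])
  show "verts G = (\<Union>i\<in>I. verts (L i))"
    unfolding union_I[of verts] pos.verts neg.verts using parts(1) by blast
  show "edges G = (\<Union>i\<in>I. edges (L i))"
    unfolding union_I[of edges] pos.edges neg.edges using edge_parts by blast
  show "verts (L i) \<inter> verts (L j) = {}" if "i \<in> I" "j \<in> I" "i + 1 < j" for i j by (rule far[OF that])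
  show "\<exists>u. verts (L i) \<inter> verts (L (i + 1)) = {u}" if "i \<in> I" "i + 1 \<in> I" for i by (rule consecutive[OF that])
  show "edges (L i) \<inter> edges (L (i + 1)) = {}" if i: "i \<in> I" "i + 1 \<in> I" for i
  proof -
    obtain u where u: "verts (L i) \<inter> verts (L (i + 1)) = {u}" using consecutive[OF i] by blast
    have "graph (L i)" "graph (L (i + 1))" using link_subgraph i unfolding subgraph_def by blast+
    then show ?thesis by (rule edges_disjoint_if) (simp add: u)
  qed
qed

text \<open>An interior link has a successor in its own half, away from \<open>v\<close>, so it was
  peeled off as an edge.\<close>

lemma interior_K2: assumes "interior_index I i" shows "is_K2 (L i)"
proof -
  obtain j k where ijk: "i \<in> I" "j \<in> I" "j < i" "k \<in> I" "i < k" using assms unfolding interior_index_def by blast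
  have s: "i - 1 \<in> I" "i + 1 \<in> I" using interval[OF ijk(2,4)] ijk by auto
  show ?thesis
  proof (cases "0 \<le> i")
    case True
    then have "nat (i + 1) = Suc (nat i)" by simp
    then show ?thesis using True s(2) pos.inner[of "nat i"] by (simp add: I_def L_def)
  next
    case False
    then have "nat (- 1 - (i - 1)) = Suc (nat (- 1 - i))" by simp
    then show ?thesis using False s(1) neg.inner[of "nat (- 1 - i)"] by (simp add: I_def L_def)
  qed
qed

lemma links_ok:
  assumes "i \<in> I" shows "k_connected 2 (L i)" "n_ac 4 (L i)"
    "\<And>u. cut_vertex G u \<Longrightarrow> u \<in> verts (L i) \<Longrightarrow> vertex_degree (L i) u \<le> 2"
  using assms by (cases rule: index_cases; simp add: pos.conn neg.conn pos.nac neg.nac pos.deg neg.deg)+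

end

lemma chain_if_n_ac_4:
  assumes "graph G" "n_ac 4 G"
  shows "\<exists>I L. chain_graph_links G I L \<and>
       (\<forall>i\<in>I. k_connected 2 (L i) \<and> n_ac 4 (L i)) \<and>
       (\<forall>i. interior_index I i \<longrightarrow> is_K2 (L i)) \<and>
       (\<forall>v i. cut_vertex G v \<and> i \<in> I \<and> v \<in> verts (L i) \<longrightarrow> vertex_degree (L i) v \<le> 2)"
proof -
  interpret four_ac_graph G by unfold_locales (fact assms)+
  show ?thesis
  proof (cases "k_connected 2 G")
    case True
    have "\<not> interior_index {0} i" for i unfolding interior_index_def by auto
    then show ?thesis using chain_2_connected[OF True] True assms(2)
      by (intro exI[of _ "{0}"] exI[of _ "\<lambda>_. G"]) simp
  next
    case False
    obtain v C where C: "side G v C" by (rule side_exists[OF False])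
    define C' where "C' = verts G - {v} - C"
    have C': "side G v C'" unfolding C'_def by (rule side_complement[OF C])
    obtain J M where "half_chain G v C J M" by (rule half_chain_exists[OF C])
    moreover obtain J' M' where "half_chain G v C' J' M'" by (rule half_chain_exists[OF C'])
    moreover have "two_half_chains_axioms G v C C'"
    proof
      show "graph G" "connected_graph G" by (fact graph, fact connected)
      show "verts G = insert v C \<union> C'" "C \<inter> C' = {}" "v \<notin> C" "v \<notin> C'" using sideD[OF C] unfolding C'_def by blast+
      show "e \<subseteq> insert v C \<or> e \<subseteq> insert v C'" if e: "e \<in> edges G" for e
      proof (cases "e \<inter> C = {}")
        case True then show ?thesis using edge_subset[OF graph e] unfolding C'_def by blast
      next
        case False then show ?thesis using side_edge[OF C e] by blast
      qed
    qed
    ultimately interpret two_half_chains G v C C' J J' M M' by (intro two_half_chains.intro)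
    show ?thesis
      by (rule exI[of _ I], rule exI[of _ L]) (use chain_links links_ok interior_K2 in blast)
  qed
qed

theorem theorem3p2p3:
  fixes G :: "'a ugraph"
  assumes "graph G"
  shows "n_ac 4 G \<longleftrightarrow>
    (\<exists>I L. chain_graph_links G I L \<and>
       (\<forall>i\<in>I. k_connected 2 (L i) \<and> n_ac 4 (L i)) \<and>
       (\<forall>i. interior_index I i \<longrightarrow> is_K2 (L i)) \<and>
       (\<forall>v i. cut_vertex G v \<and> i \<in> I \<and> v \<in> verts (L i) \<longrightarrow> vertex_degree (L i) v \<le> 2))"
  using chain_if_n_ac_4[OF assms] n_ac_4_if_chain[OF assms] by blast

end
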